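(* Let $R$ be one of $\mathbb Z$, $\mathbb Q$, or $\mathbb Z_p$ for a prime $p$. For each integer $n\ge1$, let $(\mathcal H^R_{Dwyer})^n$ be the set of group homomorphisms $f:A\to B$ that induce an isomorphism $H_1(A;R)\to H_1(B;R)$ and an epimorphism $H_2(A;R)/\Phi^R_n(A)\to H_2(B;R)/\Phi^R_n(B)$. Then for every $n\ge1$ and every group $A$, $$\{a\in A\mid \exists f:A\to B \text{ in } (\mathcal H^R_{Dwyer})^n \text{ with } f(a)\in B^R_{n+1}\}=A^R_{n+1},$$ i.e. the $R$-lower central series is stable with respect to the Dwyer $R$-class $\{(\mathcal H^R_{Dwyer})^n\}$.
   Context: The $R$-lower central series $\{A^R_n\}_{n\ge1}$ of a group $A$ is: for $R=\mathbb Z$, the lower central series $A_1=A$, $A_{n+1}=[A,A_n]$; for $R=\mathbb Q$, the rational lower central series $A^r_1=A$, $A^r_{n+1}=\{x\mid x^k\in[A,A^r_n]\text{ for some positive integer }k\}$; for $R=\mathbb Z_p$, $A_{p,1}=A$, $A_{p,n+1}=(A_{p,n})^p[A_{p,n},A]$. For a group $A$ and positive integer $n$, $\Phi^R_n(A)$ is the kernel of the natural map $H_2(A;R)\to H_2(A/A_n;R)$, where $A_n$ is the $n$-th term of the (ordinary) lower central series. *)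

theory Defs
  imports "HOL-Algebra.Algebra" "HOL-Computational_Algebra.Primes"
begin

datatype coeff = ZZ | QQ | ZZp nat

definition valid_coeff :: "coeff \<Rightarrow> bool" where
  "valid_coeff R = (case R of ZZp p \<Rightarrow> Factorial_Ring.prime p | _ \<Rightarrow> True)"

text \<open>Chains are represented with rational values: for Z and Z_p the values are integers,
  and Z_p-chains are integral chains taken modulo p (the ideal of chains with coefficients in pZ).\<close>

definition coeff_vals :: "coeff \<Rightarrow> rat set" where
  "coeff_vals R = (case R of QQ \<Rightarrow> UNIV | _ \<Rightarrow> \<int>)"

definition coeff_ideal :: "coeff \<Rightarrow> rat set" where
  "coeff_ideal R = (case R of ZZp p \<Rightarrow> {of_int (int p * k) | k. True} | _ \<Rightarrow> {0})"

section \<open>Inhomogeneous bar complex of a group\<close>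

definition chains :: "coeff \<Rightarrow> nat \<Rightarrow> ('a, 'b) monoid_scheme \<Rightarrow> ('a list \<Rightarrow> rat) set" where
  "chains R n G = {c. finite {xs. c xs \<noteq> 0} \<and>
      (\<forall>xs. c xs \<noteq> 0 \<longrightarrow> length xs = n \<and> set xs \<subseteq> carrier G) \<and>
      (\<forall>xs. c xs \<in> coeff_vals R)}"

definition ideal_chains :: "coeff \<Rightarrow> nat \<Rightarrow> ('a, 'b) monoid_scheme \<Rightarrow> ('a list \<Rightarrow> rat) set" where
  "ideal_chains R n G = {c \<in> chains R n G. \<forall>xs. c xs \<in> coeff_ideal R}"

definition face :: "('a, 'b) monoid_scheme \<Rightarrow> nat \<Rightarrow> 'a list \<Rightarrow> 'a list" where
  "face G i xs = (if i = 0 then tl xs else if i = length xs then butlast xs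
      else take (i - 1) xs @ [xs ! (i - 1) \<otimes>\<^bsub>G\<^esub> xs ! i] @ drop (i + 1) xs)"

definition bd_basis :: "('a, 'b) monoid_scheme \<Rightarrow> 'a list \<Rightarrow> 'a list \<Rightarrow> rat" where
  "bd_basis G xs ys = (\<Sum>i\<in>{0..length xs}. (-1) ^ i * (if face G i xs = ys then 1 else 0))"

definition bd :: "('a, 'b) monoid_scheme \<Rightarrow> ('a list \<Rightarrow> rat) \<Rightarrow> ('a list \<Rightarrow> rat)" where
  "bd G c = (\<lambda>ys. \<Sum>xs\<in>{xs. c xs \<noteq> 0}. c xs * bd_basis G xs ys)"

definition push :: "('a \<Rightarrow> 'c) \<Rightarrow> ('a list \<Rightarrow> rat) \<Rightarrow> ('c list \<Rightarrow> rat)" where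
  "push f c = (\<lambda>ys. \<Sum>xs\<in>{xs. c xs \<noteq> 0 \<and> map f xs = ys}. c xs)"

text \<open>Cycles and boundaries of the complex C(G) \<otimes> R, n \<ge> 1.\<close>

definition cycles :: "coeff \<Rightarrow> nat \<Rightarrow> ('a, 'b) monoid_scheme \<Rightarrow> ('a list \<Rightarrow> rat) set" where
  "cycles R n G = {c \<in> chains R n G. bd G c \<in> ideal_chains R (n - 1) G}"

definition boundaries :: "coeff \<Rightarrow> nat \<Rightarrow> ('a, 'b) monoid_scheme \<Rightarrow> ('a list \<Rightarrow> rat) set" where
  "boundaries R n G = {c \<in> chains R n G. \<exists>d \<in> chains R (n + 1) G. \<exists>e \<in> ideal_chains R n G.
      c = (\<lambda>xs. bd G d xs + e xs)}"

definition H_iso :: "coeff \<Rightarrow> nat \<Rightarrow> ('a, 'c) monoid_scheme \<Rightarrow> ('b, 'd) monoid_scheme \<Rightarrow> ('a \<Rightarrow> 'b) \<Rightarrow> bool" where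
  "H_iso R n A B f =
     ((\<forall>x \<in> cycles R n A. push f x \<in> boundaries R n B \<longrightarrow> x \<in> boundaries R n A) \<and>
      (\<forall>y \<in> cycles R n B. \<exists>x \<in> cycles R n A. (\<lambda>xs. push f x xs - y xs) \<in> boundaries R n B))"

definition commutators :: "('a, 'b) monoid_scheme \<Rightarrow> 'a set \<Rightarrow> 'a set \<Rightarrow> 'a set" where
  "commutators G H K = {h \<otimes>\<^bsub>G\<^esub> k \<otimes>\<^bsub>G\<^esub> inv\<^bsub>G\<^esub> h \<otimes>\<^bsub>G\<^esub> inv\<^bsub>G\<^esub> k | h k. h \<in> H \<and> k \<in> K}"

text \<open>Indexing: lcs G 1 = G (also lcs G 0 = G, unused), lcs G (n+1) = [G, lcs G n].\<close>

fun lcs :: "('a, 'b) monoid_scheme \<Rightarrow> nat \<Rightarrow> 'a set" where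
  "lcs G 0 = carrier G"
| "lcs G (Suc n) = (if n = 0 then carrier G
     else generate G (commutators G (carrier G) (lcs G n)))"

fun Rlcs :: "coeff \<Rightarrow> ('a, 'b) monoid_scheme \<Rightarrow> nat \<Rightarrow> 'a set" where
  "Rlcs R G 0 = carrier G"
| "Rlcs R G (Suc n) = (if n = 0 then carrier G else
     (case R of
        ZZ \<Rightarrow> generate G (commutators G (carrier G) (Rlcs R G n))
      | QQ \<Rightarrow> {x \<in> carrier G. \<exists>k::nat. k > 0 \<and>
               x [^]\<^bsub>G\<^esub> k \<in> generate G (commutators G (carrier G) (Rlcs R G n))}
      | ZZp p \<Rightarrow> generate G ({x [^]\<^bsub>G\<^esub> p | x. x \<in> Rlcs R G n}
                               \<union> commutators G (Rlcs R G n) (carrier G))))"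

text \<open>Chain-level description of Phi^R_n(G) = ker (H_2(G;R) \<rightarrow> H_2(G/G_n;R)):
  the 2-cycles whose image in G/G_n is homologous to zero.\<close>

definition Phi_cycles :: "coeff \<Rightarrow> nat \<Rightarrow> ('a, 'b) monoid_scheme \<Rightarrow> ('a list \<Rightarrow> rat) set" where
  "Phi_cycles R n G = {z \<in> cycles R 2 G.
      push (\<lambda>a. lcs G n #>\<^bsub>G\<^esub> a) z \<in> boundaries R 2 (G Mod (lcs G n))}"

definition Dwyer :: "coeff \<Rightarrow> nat \<Rightarrow> ('a, 'c) monoid_scheme \<Rightarrow> ('b, 'd) monoid_scheme \<Rightarrow> ('a \<Rightarrow> 'b) \<Rightarrow> bool" where
  "Dwyer R n A B f =
     (f \<in> hom A B \<and> H_iso R 1 A B f \<and>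
      (\<forall>y \<in> cycles R 2 B. \<exists>x \<in> cycles R 2 A. (\<lambda>xs. push f x xs - y xs) \<in> Phi_cycles R n B))"

end

theory Submission
  imports Defs "HOL-Library.Function_Algebras"
begin

text \<open>
The inclusion from right to left is witnessed by the identity. For the other one, let \<open>E\<close> be a group with
a central series whose factors are \<open>R\<close>-modules. Every homomorphism \<open>u: A \<rightarrow> E\<close> factors through \<open>f: A \<rightarrow> B\<close>
modulo the \<open>(n+1)\<close>-st term of the series: the obstruction to a lifting along one central extension is a
\<open>2\<close>-cocycle on \<open>B / B\<^sub>n\<close>, which kills \<open>\<Phi>\<^sub>n(B)\<close> and becomes a coboundary on \<open>A\<close>, so that it kills all
\<open>2\<close>-cycles of \<open>B\<close>; and \<open>f\<close> being an isomorphism on \<open>H\<^sub>1\<close>, the cochain that bounds it on \<open>A\<close> extends to \<open>B\<close>.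
No splitting of \<open>H\<^sub>1\<close> is needed. Hence \<open>u\<close> maps \<open>a\<close> into the \<open>(n+1)\<close>-st term whenever
\<open>f a\<close> lies in the \<open>(n+1)\<close>-st term of the \<open>R\<close>-lower central series of \<open>B\<close>.

For \<open>Z\<close> and \<open>Z\<^sub>p\<close> take \<open>E = A\<close> with its \<open>R\<close>-lower central series. For \<open>Q\<close> the factors of
that series need not be divisible, and \<open>E\<close> is the group of unipotent operators on the polynomial functions \<open>A \<rightarrow> Q\<close> of degree at
most \<open>n\<close>, on which \<open>A\<close> acts by translations. The elements of \<open>A\<close> that act trivially are those of the
rational series (a theorem of Jennings): by a finiteness argument in the group ring it suffices to
separate elements on subgroups that arise from the \<open>(n+1)\<close>-st term by infinite cyclic steps, and there
polynomial functions are constructed by induction along the steps.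
\<close>

section \<open>Linear extension of finitely supported functions\<close>

text \<open>The hypothesis on \<open>H_2\<close> refers to the ordinary term \<open>lcs B n\<close>
  for every \<open>R\<close>, so it can test an obstruction only if the cocycle is pulled back from
  \<open>B\<close> modulo \<open>lcs B n\<close>. Hence one lift per layer, for layers
  \<open>i \<le> n\<close> only: a homomorphism into the target modulo the \<open>i\<close>-th term
  of its series kills \<open>lcs B i\<close>, and so \<open>lcs B n\<close>. Passing between
  homology and cohomology by universal coefficients would bring in Ext terms; explicit cochains
  paired with bar chains avoid them. Over Q the target needs divisible central factors and must
  still detect every element outside the rational series. When a polynomial function is extended
  along a cyclic step, its degree must not grow. This is why degrees are weighted: conjugation by an
  element of weight \<open>w\<close> changes elements of weight \<open>v\<close> only by factors of
  weight \<open>v + w\<close>, so it moves a function only by terms whose degree is lower by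
  \<open>w\<close>. This requires commutators of \<open>F i\<close> and \<open>F j\<close> to lie in
  \<open>F (i + j)\<close>, and isolation of the terms makes the steps infinite cyclic.\<close>

definition fin_supp :: "('x \<Rightarrow> rat) \<Rightarrow> bool" where
  "fin_supp c \<longleftrightarrow> finite {x. c x \<noteq> 0}"

text \<open>Both \<open>bd\<close> and \<open>push\<close> are instances, so additivity and the
  composition law \<open>lin_lin\<close> are shown once for both. The same operation later pairs
  functions with elements of the group ring.\<close>

definition lin :: "('x \<Rightarrow> rat) \<Rightarrow> ('x \<Rightarrow> 'y \<Rightarrow> rat) \<Rightarrow> 'y \<Rightarrow> rat" where
  "lin c g = (\<lambda>y. \<Sum>x | c x \<noteq> 0. c x * g x y)"

definition delta :: "'x \<Rightarrow> 'x \<Rightarrow> rat" where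
  "delta x = (\<lambda>y. if x = y then 1 else 0)"

lemma lin_superset:
  assumes "finite S" "{x. c x \<noteq> 0} \<subseteq> S"
  shows "lin c g y = (\<Sum>x\<in>S. c x * g x y)"
  unfolding lin_def by (rule sum.mono_neutral_left) (use assms in auto)

lemma fin_supp_delta [simp]: "fin_supp (delta x)"
  by (simp add: delta_def fin_supp_def)

lemma fin_supp_combine:
  assumes "fin_supp c" "fin_supp d" and h: "h 0 0 = (0::rat)"
  shows "fin_supp (\<lambda>x. h (c x) (d x))"
proof -
  have "c x \<noteq> 0 \<or> d x \<noteq> 0" if "h (c x) (d x) \<noteq> 0" for x
    using h that by auto
  then have "{x. h (c x) (d x) \<noteq> 0} \<subseteq> {x. c x \<noteq> 0} \<union> {x. d x \<noteq> 0}"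
    by blast
  moreover have "finite ({x. c x \<noteq> 0} \<union> {x. d x \<noteq> 0})"
    using assms(1,2) unfolding fin_supp_def by (rule finite_UnI)
  ultimately show ?thesis
    unfolding fin_supp_def by (rule finite_subset)
qed

lemma fin_supp_add: "fin_supp c \<Longrightarrow> fin_supp d \<Longrightarrow> fin_supp (\<lambda>x. c x + d x)"
  by (rule fin_supp_combine) simp_all

lemma fin_supp_diff: "fin_supp c \<Longrightarrow> fin_supp d \<Longrightarrow> fin_supp (\<lambda>x. c x - d x)"
  by (rule fin_supp_combine) simp_all

lemma lin_add:
  assumes "fin_supp c" "fin_supp d"
  shows "lin (\<lambda>x. c x + d x) g = (\<lambda>y. lin c g y + lin d g y)"
proof
  fix y
  let ?S = "{x. c x \<noteq> 0} \<union> {x. d x \<noteq> 0}"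
  have "finite ?S" using assms by (simp add: fin_supp_def)
  then show "lin (\<lambda>x. c x + d x) g y = lin c g y + lin d g y"
    by (subst (1 2 3) lin_superset[where S = ?S]) (auto simp: sum.distrib algebra_simps)
qed

lemma lin_diff:
  assumes "fin_supp c" "fin_supp d"
  shows "lin (\<lambda>x. c x - d x) g = (\<lambda>y. lin c g y - lin d g y)"
proof
  fix y
  let ?S = "{x. c x \<noteq> 0} \<union> {x. d x \<noteq> 0}"
  have "finite ?S" using assms by (simp add: fin_supp_def)
  then show "lin (\<lambda>x. c x - d x) g y = lin c g y - lin d g y"
    by (subst (1 2 3) lin_superset[where S = ?S]) (auto simp: sum_subtractf algebra_simps)
qed

lemma lin_delta [simp]: "lin (delta x) g = g x"
proof
  fix y show "lin (delta x) g y = g x y"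
    by (subst lin_superset[where S = "{x}"]) (auto simp: delta_def)
qed

lemma lin_supp: "{y. lin c g y \<noteq> 0} \<subseteq> (\<Union>x\<in>{x. c x \<noteq> 0}. {y. g x y \<noteq> 0})"
proof
  fix y assume "y \<in> {y. lin c g y \<noteq> 0}"
  then have "(\<Sum>x | c x \<noteq> 0. c x * g x y) \<noteq> 0" by (simp add: lin_def)
  then obtain x where "x \<in> {x. c x \<noteq> 0}" "c x * g x y \<noteq> 0"
    by (rule sum.not_neutral_contains_not_neutral)
  then show "y \<in> (\<Union>x\<in>{x. c x \<noteq> 0}. {y. g x y \<noteq> 0})" by auto
qed

lemma fin_supp_lin:
  assumes "fin_supp c" "\<And>x. fin_supp (g x)"
  shows "fin_supp (lin c g)"
  unfolding fin_supp_def
  by (rule finite_subset[OF lin_supp]) (use assms in \<open>auto simp: fin_supp_def\<close>)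

lemma lin_cong:
  assumes "\<And>x. c x \<noteq> 0 \<Longrightarrow> g x = h x"
  shows "lin c g = lin c h"
  unfolding lin_def using assms by (auto intro!: sum.cong)

lemma lin_lin:
  assumes "fin_supp c" "\<And>x. fin_supp (g x)"
  shows "lin (lin c g) h = lin c (\<lambda>x. lin (g x) h)"
proof
  fix z
  let ?S = "{x. c x \<noteq> 0}"
  let ?T = "\<Union>x\<in>?S. {y. g x y \<noteq> 0}"
  have fT: "finite ?T" using assms by (auto simp: fin_supp_def)
  have "lin (lin c g) h z = (\<Sum>y\<in>?T. lin c g y * h y z)"
    by (rule lin_superset[OF fT lin_supp])
  also have "\<dots> = (\<Sum>y\<in>?T. \<Sum>x\<in>?S. c x * (g x y * h y z))"
    by (simp add: lin_def sum_distrib_right mult.assoc)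
  also have "\<dots> = (\<Sum>x\<in>?S. \<Sum>y\<in>?T. c x * (g x y * h y z))"
    by (rule sum.swap)
  also have "\<dots> = (\<Sum>x\<in>?S. c x * lin (g x) h z)"
  proof (rule sum.cong[OF refl])
    fix x assume x: "x \<in> ?S"
    have "lin (g x) h z = (\<Sum>y\<in>?T. g x y * h y z)"
      by (rule lin_superset[OF fT]) (use x in auto)
    then show "(\<Sum>y\<in>?T. c x * (g x y * h y z)) = c x * lin (g x) h z"
      by (simp add: sum_distrib_left)
  qed
  finally show "lin (lin c g) h z = lin c (\<lambda>x. lin (g x) h) z"
    by (simp add: lin_def)
qed

section \<open>Coefficients and chains\<close>

lemma coeff_vals_0 [simp]: "0 \<in> coeff_vals R"
  and coeff_vals_1 [simp]: "1 \<in> coeff_vals R"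
  by (auto simp: coeff_vals_def split: coeff.splits)

lemma coeff_vals_of_int [simp]: "of_int k \<in> coeff_vals R"
  by (auto simp: coeff_vals_def split: coeff.splits)

lemma coeff_vals_Ints: "k \<in> \<int> \<Longrightarrow> k \<in> coeff_vals R"
  by (simp add: coeff_vals_def split: coeff.splits)

lemma coeff_vals_arith:
  assumes "q \<in> coeff_vals R" "r \<in> coeff_vals R"
  shows "q + r \<in> coeff_vals R" "q - r \<in> coeff_vals R" "q * r \<in> coeff_vals R" "- q \<in> coeff_vals R"
  using assms by (auto simp: coeff_vals_def split: coeff.splits)

lemma coeff_ideal_0 [simp]: "0 \<in> coeff_ideal R"
  by (auto simp: coeff_ideal_def split: coeff.splits intro: exI[of _ 0])

lemma coeff_ideal_arith:
  assumes "q \<in> coeff_ideal R" "r \<in> coeff_ideal R"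
  shows "q + r \<in> coeff_ideal R" and "q - r \<in> coeff_ideal R"
proof -
  have *: "of_int (int p * k) + of_int (int p * l) = (of_int (int p * (k + l)) :: rat)"
    "of_int (int p * k) - of_int (int p * l) = (of_int (int p * (k - l)) :: rat)" for p k l
    by (simp_all add: algebra_simps)
  show "q + r \<in> coeff_ideal R" "q - r \<in> coeff_ideal R"
    using assms
    by (cases R; auto simp: coeff_ideal_def * simp del: of_int_mult of_int_add of_int_diff; fail)+
qed

lemma coeff_ideal_mult_Ints:
  assumes "q \<in> coeff_ideal R" "k \<in> \<int>"
  shows "q * k \<in> coeff_ideal R"
proof -
  obtain m where k: "k = of_int m" using Ints_cases[OF assms(2)] by blast
  have "q * k = of_int (int p * (l * m))" if "q = of_int (int p * l)" for p l
    using k that by simp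
  then show ?thesis
    using assms(1) by (cases R) (auto simp: coeff_ideal_def simp del: of_int_mult)
qed

lemma coeff_vals_sum: "(\<And>x. x \<in> S \<Longrightarrow> h x \<in> coeff_vals R) \<Longrightarrow> sum h S \<in> coeff_vals R"
  by (induction S rule: infinite_finite_induct) (simp_all add: coeff_vals_arith(1))

lemma coeff_ideal_sum: "(\<And>x. x \<in> S \<Longrightarrow> h x \<in> coeff_ideal R) \<Longrightarrow> sum h S \<in> coeff_ideal R"
  by (induction S rule: infinite_finite_induct) (simp_all add: coeff_ideal_arith(1))

lemma lin_vals:
  assumes "\<And>x. c x \<in> coeff_vals R" "\<And>x. c x \<noteq> 0 \<Longrightarrow> g x y \<in> \<int>"
  shows "lin c g y \<in> coeff_vals R"
  unfolding lin_def
  by (rule coeff_vals_sum, rule coeff_vals_arith(3)[OF assms(1) coeff_vals_Ints], rule assms(2)) simp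

lemma lin_ideal:
  assumes "\<And>x. c x \<in> coeff_ideal R" "\<And>x. c x \<noteq> 0 \<Longrightarrow> g x y \<in> \<int>"
  shows "lin c g y \<in> coeff_ideal R"
  unfolding lin_def
  by (rule coeff_ideal_sum, rule coeff_ideal_mult_Ints[OF assms(1)], rule assms(2)) simp

lemma bd_eq_lin: "bd G c = lin c (bd_basis G)"
  by (simp add: bd_def lin_def)

lemma push_eq_lin:
  assumes "fin_supp c"
  shows "push f c = lin c (\<lambda>xs. delta (map f xs))"
proof
  fix ys
  have "push f c ys = (\<Sum>xs\<in>{xs \<in> {xs. c xs \<noteq> 0}. map f xs = ys}. c xs)"
    by (simp add: push_def)
  also have "\<dots> = (\<Sum>xs | c xs \<noteq> 0. if map f xs = ys then c xs else 0)"
    by (rule sum.inter_filter) (use assms in \<open>simp add: fin_supp_def\<close>)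
  also have "\<dots> = lin c (\<lambda>xs. delta (map f xs)) ys"
    unfolding lin_def by (rule sum.cong) (auto simp: delta_def)
  finally show "push f c ys = lin c (\<lambda>xs. delta (map f xs)) ys" .
qed

lemma bd_basis_Ints: "bd_basis G xs ys \<in> \<int>"
  unfolding bd_basis_def by (auto intro!: Ints_sum Ints_mult Ints_power)

lemma delta_Ints: "delta x y \<in> \<int>"
  by (simp add: delta_def)

lemma bd_basis_supp: "{ys. bd_basis G xs ys \<noteq> 0} \<subseteq> (\<lambda>i. face G i xs) ` {0..length xs}"
proof
  fix ys assume "ys \<in> {ys. bd_basis G xs ys \<noteq> 0}"
  then have "(\<Sum>i\<in>{0..length xs}. (-1) ^ i * (if face G i xs = ys then 1 else 0 :: rat)) \<noteq> 0"
    by (simp add: bd_basis_def)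
  then obtain i where "i \<in> {0..length xs}" "(-1) ^ i * (if face G i xs = ys then 1 else 0 :: rat) \<noteq> 0"
    by (rule sum.not_neutral_contains_not_neutral)
  then show "ys \<in> (\<lambda>i. face G i xs) ` {0..length xs}" by (auto split: if_splits)
qed

lemma fin_supp_bd_basis [simp]: "fin_supp (bd_basis G xs)"
  unfolding fin_supp_def by (rule finite_subset[OF bd_basis_supp]) simp

lemma bd_basis_1: "bd_basis G [a] = (\<lambda>ys. 0)"
  by (rule ext) (simp add: bd_basis_def face_def)

lemma bd_basis_2:
  "bd_basis G [a, b] = (\<lambda>ys. (delta [b] ys - delta [a \<otimes>\<^bsub>G\<^esub> b] ys) + delta [a] ys)"
  by (rule ext) (simp add: bd_basis_def face_def delta_def numeral_2_eq_2)

lemma bd_basis_3: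
  "bd_basis G [a, b, c] = (\<lambda>ys. (delta [b, c] ys - delta [a \<otimes>\<^bsub>G\<^esub> b, c] ys)
     + (delta [a, b \<otimes>\<^bsub>G\<^esub> c] ys - delta [a, b] ys))"
  by (rule ext) (simp add: bd_basis_def face_def delta_def numeral_3_eq_3)

lemma chainsD:
  assumes "c \<in> chains R n G"
  shows "fin_supp c" "\<And>xs. c xs \<in> coeff_vals R"
    "\<And>xs. c xs \<noteq> 0 \<Longrightarrow> length xs = n" "\<And>xs. c xs \<noteq> 0 \<Longrightarrow> set xs \<subseteq> carrier G"
  using assms by (auto simp: chains_def fin_supp_def)

lemma chainsI:
  assumes "fin_supp c" "\<And>xs. c xs \<in> coeff_vals R"
    "\<And>xs. c xs \<noteq> 0 \<Longrightarrow> length xs = n \<and> set xs \<subseteq> carrier G"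
  shows "c \<in> chains R n G"
  using assms by (auto simp: chains_def fin_supp_def)

lemma chains_add:
  assumes "c \<in> chains R n G" "d \<in> chains R n G"
  shows "(\<lambda>x. c x + d x) \<in> chains R n G"
proof (rule chainsI)
  show "fin_supp (\<lambda>x. c x + d x)" by (intro fin_supp_add chainsD(1)[OF assms(1)] chainsD(1)[OF assms(2)])
  show "c x + d x \<in> coeff_vals R" for x
    by (intro coeff_vals_arith chainsD(2)[OF assms(1)] chainsD(2)[OF assms(2)])
  fix xs assume "c xs + d xs \<noteq> 0"
  then have "c xs \<noteq> 0 \<or> d xs \<noteq> 0" by auto
  then show "length xs = n \<and> set xs \<subseteq> carrier G"
    using chainsD(3,4)[OF assms(1)] chainsD(3,4)[OF assms(2)] by blast
qed

lemma chains_diff: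
  assumes "c \<in> chains R n G" "d \<in> chains R n G"
  shows "(\<lambda>x. c x - d x) \<in> chains R n G"
proof (rule chainsI)
  show "fin_supp (\<lambda>x. c x - d x)" by (intro fin_supp_diff chainsD(1)[OF assms(1)] chainsD(1)[OF assms(2)])
  show "c x - d x \<in> coeff_vals R" for x
    by (intro coeff_vals_arith chainsD(2)[OF assms(1)] chainsD(2)[OF assms(2)])
  fix xs assume "c xs - d xs \<noteq> 0"
  then have "c xs \<noteq> 0 \<or> d xs \<noteq> 0" by auto
  then show "length xs = n \<and> set xs \<subseteq> carrier G"
    using chainsD(3,4)[OF assms(1)] chainsD(3,4)[OF assms(2)] by blast
qed

lemma chains_zero: "(\<lambda>x. 0) \<in> chains R n G"
  by (rule chainsI) (auto simp: fin_supp_def)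

lemma chains_delta: "length xs = n \<Longrightarrow> set xs \<subseteq> carrier G \<Longrightarrow> delta xs \<in> chains R n G"
  by (rule chainsI) (simp, auto simp: delta_def split: if_splits)

lemma ideal_chains_add:
  "c \<in> ideal_chains R n G \<Longrightarrow> d \<in> ideal_chains R n G \<Longrightarrow> (\<lambda>x. c x + d x) \<in> ideal_chains R n G"
  by (auto simp: ideal_chains_def chains_add coeff_ideal_arith)

lemma ideal_chains_diff:
  "c \<in> ideal_chains R n G \<Longrightarrow> d \<in> ideal_chains R n G \<Longrightarrow> (\<lambda>x. c x - d x) \<in> ideal_chains R n G"
  by (auto simp: ideal_chains_def chains_diff coeff_ideal_arith)

lemma ideal_chains_zero: "(\<lambda>x. 0) \<in> ideal_chains R n G"
  by (simp add: ideal_chains_def chains_zero)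

lemma push_chains:
  assumes c: "c \<in> chains R n A" and f: "f \<in> carrier A \<rightarrow> carrier B"
  shows "push f c \<in> chains R n B"
proof (rule chainsI)
  have eq: "push f c = lin c (\<lambda>xs. delta (map f xs))" by (rule push_eq_lin[OF chainsD(1)[OF c]])
  show "fin_supp (push f c)" unfolding eq by (rule fin_supp_lin[OF chainsD(1)[OF c]]) simp
  show "push f c xs \<in> coeff_vals R" for xs
    unfolding eq by (rule lin_vals[OF chainsD(2)[OF c]]) (rule delta_Ints)
  fix ys assume "push f c ys \<noteq> 0"
  then have "ys \<in> (\<Union>x\<in>{x. c x \<noteq> 0}. {y. delta (map f x) y \<noteq> 0})"
    using lin_supp[of c "\<lambda>xs. delta (map f xs)"] unfolding eq by blast
  then obtain xs where "c xs \<noteq> 0" "ys = map f xs" by (auto simp: delta_def split: if_splits)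
  then show "length ys = n \<and> set ys \<subseteq> carrier B"
    using chainsD(3,4)[OF c] f by (fastforce)
qed

lemma push_ideal:
  assumes c: "c \<in> ideal_chains R n A" and f: "f \<in> carrier A \<rightarrow> carrier B"
  shows "push f c \<in> ideal_chains R n B"
proof -
  have c': "c \<in> chains R n A" "\<And>xs. c xs \<in> coeff_ideal R" using c by (auto simp: ideal_chains_def)
  have eq: "push f c = lin c (\<lambda>xs. delta (map f xs))" by (rule push_eq_lin[OF chainsD(1)[OF c'(1)]])
  have "push f c xs \<in> coeff_ideal R" for xs
    unfolding eq by (rule lin_ideal[OF c'(2)]) (rule delta_Ints)
  then show ?thesis using push_chains[OF c'(1) f] by (auto simp: ideal_chains_def)
qed

lemma push_diff:
  assumes "fin_supp c" "fin_supp d"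
  shows "push f (\<lambda>x. c x - d x) = (\<lambda>y. push f c y - push f d y)"
  unfolding push_eq_lin[OF fin_supp_diff[OF assms]] lin_diff[OF assms]
  using assms by (simp add: push_eq_lin)

lemma push_add:
  assumes "fin_supp c" "fin_supp d"
  shows "push f (\<lambda>x. c x + d x) = (\<lambda>y. push f c y + push f d y)"
  unfolding push_eq_lin[OF fin_supp_add[OF assms]] lin_add[OF assms]
  using assms by (simp add: push_eq_lin)

lemma push_delta [simp]: "push f (delta xs) = delta (map f xs)"
  by (simp add: push_eq_lin)

lemma bd_diff:
  assumes "fin_supp c" "fin_supp d"
  shows "bd G (\<lambda>x. c x - d x) = (\<lambda>y. bd G c y - bd G d y)"
  using assms by (simp add: bd_eq_lin lin_diff)

lemma bd_add:
  assumes "fin_supp c" "fin_supp d"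
  shows "bd G (\<lambda>x. c x + d x) = (\<lambda>y. bd G c y + bd G d y)"
  using assms by (simp add: bd_eq_lin lin_add)

lemma bd_delta [simp]: "bd G (delta xs) = bd_basis G xs"
  by (simp add: bd_eq_lin)

lemma bd_push_2:
  assumes c: "c \<in> chains R 2 A" and f: "f \<in> hom A B"
  shows "bd B (push f c) = push f (bd A c)"
proof -
  note fc = chainsD(1)[OF c]
  have "bd B (push f c) = lin c (\<lambda>xs. bd_basis B (map f xs))"
    by (simp add: bd_eq_lin push_eq_lin[OF fc] lin_lin[OF fc])
  also have "\<dots> = lin c (\<lambda>xs. push f (bd_basis A xs))"
  proof (rule lin_cong)
    fix xs assume "c xs \<noteq> 0"
    then have "length xs = 2" "set xs \<subseteq> carrier A" using chainsD(3,4)[OF c] by auto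
    then obtain a b where xs: "xs = [a, b]" and ab: "a \<in> carrier A" "b \<in> carrier A"
      by (auto simp: numeral_2_eq_2 length_Suc_conv)
    show "bd_basis B (map f xs) = push f (bd_basis A xs)"
      using hom_mult[OF f ab]
      by (simp add: xs bd_basis_2 push_add[OF fin_supp_diff] push_diff)
  qed
  also have "\<dots> = lin c (\<lambda>xs. lin (bd_basis A xs) (\<lambda>xs. delta (map f xs)))"
    by (simp add: push_eq_lin)
  also have "\<dots> = lin (lin c (bd_basis A)) (\<lambda>xs. delta (map f xs))"
    by (simp add: lin_lin[OF fc])
  also have "\<dots> = push f (bd A c)"
    by (simp add: push_eq_lin bd_eq_lin fin_supp_lin[OF fc])
  finally show ?thesis .
qed

lemma bd_chain_1:
  assumes "c \<in> chains R 1 G"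
  shows "bd G c = (\<lambda>x. 0)"
proof -
  have "bd G c = lin c (\<lambda>_ _. 0)"
    unfolding bd_eq_lin
  proof (rule lin_cong)
    fix xs assume "c xs \<noteq> 0"
    then have "length xs = 1" using chainsD(3)[OF assms] by auto
    then obtain a where "xs = [a]" by (auto simp: length_Suc_conv)
    then show "bd_basis G xs = (\<lambda>_. 0)" by (simp add: bd_basis_1)
  qed
  then show ?thesis by (simp add: lin_def)
qed

text \<open>The two faces of a 1-simplex cancel. The hypothesis on \<open>H_1\<close> therefore
  applies to every 1-chain, in particular to a single simplex \<open>[b]\<close>.\<close>

lemma cycles_1: "cycles R 1 G = chains R 1 G"
  by (auto simp: cycles_def bd_chain_1 ideal_chains_zero)

lemma ideal_chainsD:
  assumes "c \<in> ideal_chains R k G"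
  shows "c \<in> chains R k G" "c x \<in> coeff_ideal R"
  using assms by (auto simp: ideal_chains_def)

lemma fin_supp_bd: "fin_supp c \<Longrightarrow> fin_supp (bd G c)"
  unfolding bd_eq_lin by (rule fin_supp_lin) auto

lemma bd_vals: "c \<in> chains R k G \<Longrightarrow> bd G c xs \<in> coeff_vals R"
  unfolding bd_eq_lin using chainsD(2) bd_basis_Ints by (rule lin_vals)

lemma chains_delta_1: "b \<in> carrier G \<Longrightarrow> delta [b] \<in> chains R 1 G"
  by (rule chains_delta) auto

section \<open>Evaluating cochains on chains\<close>

text \<open>An \<open>R\<close>-module written multiplicatively, in the shape that fits
  rational-valued chains: the scalars are the coefficient values themselves, and
  \<open>sm_ideal\<close> lets the ideal act as zero, which for \<open>ZZp p\<close> expresses that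
  chains count modulo \<open>p\<close>.\<close>

locale coeff_module = comm_group M for M (structure) +
  fixes R :: coeff and sm :: "rat \<Rightarrow> 'a \<Rightarrow> 'a"
  assumes sm_closed [simp]: "q \<in> coeff_vals R \<Longrightarrow> x \<in> carrier M \<Longrightarrow> sm q x \<in> carrier M"
    and sm_add: "q \<in> coeff_vals R \<Longrightarrow> r \<in> coeff_vals R \<Longrightarrow> x \<in> carrier M \<Longrightarrow> sm (q + r) x = sm q x \<otimes> sm r x"
    and sm_mult: "q \<in> coeff_vals R \<Longrightarrow> x \<in> carrier M \<Longrightarrow> y \<in> carrier M \<Longrightarrow> sm q (x \<otimes> y) = sm q x \<otimes> sm q y"
    and sm_one [simp]: "x \<in> carrier M \<Longrightarrow> sm 1 x = x"
    and sm_ideal: "q \<in> coeff_ideal R \<Longrightarrow> x \<in> carrier M \<Longrightarrow> sm q x = \<one>"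
begin

lemma sm_zero [simp]: "x \<in> carrier M \<Longrightarrow> sm 0 x = \<one>"
  by (simp add: sm_ideal)

lemma sm_diff:
  assumes "q \<in> coeff_vals R" "r \<in> coeff_vals R" "x \<in> carrier M"
  shows "sm (q - r) x = sm q x \<otimes> inv (sm r x)"
proof -
  have "sm q x = sm (q - r) x \<otimes> sm r x"
    using sm_add[of "q - r" r x] assms by (simp add: coeff_vals_arith(2))
  then show ?thesis using assms by (simp add: coeff_vals_arith(2) m_assoc)
qed

lemma sm_unit [simp]: "q \<in> coeff_vals R \<Longrightarrow> sm q \<one> = \<one>"
  using sm_mult[of q \<one> \<one>] by (metis l_cancel_one' one_closed r_one sm_closed)

lemma sm_inv:
  assumes "q \<in> coeff_vals R" "x \<in> carrier M"
  shows "sm q (inv x) = inv (sm q x)"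
  using sm_mult[OF assms(1) inv_closed[OF assms(2)] assms(2)] assms
  by (metis inv_closed inv_equality l_inv sm_closed sm_unit)

text \<open>Associativity of scalars in the form that the pairing meets: one factor is an incidence
  number of \<open>bd\<close> or \<open>push\<close>, hence an integer, and induction on it uses
  only the two distributive laws.\<close>

lemma sm_times_int:
  assumes q: "q \<in> coeff_vals R" and x: "x \<in> carrier M"
  shows "sm (q * of_int k) x = sm q (sm (of_int k) x)"
proof (induction k rule: int_induct[where k = 0])
  case base show ?case using q x by simp
next
  case (step1 i)
  have "sm (q * of_int (i + 1)) x = sm (q * of_int i + q) x"
    by (simp add: algebra_simps)
  also have "\<dots> = sm q (sm (of_int i) x) \<otimes> sm q x"
    using step1 q x by (simp add: sm_add coeff_vals_arith)
  also have "\<dots> = sm q (sm (of_int i) x \<otimes> sm 1 x)" using q x by (simp add: sm_mult)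
  also have "sm (of_int i) x \<otimes> sm 1 x = sm (of_int (i + 1)) x" using x by (simp add: sm_add)
  finally show ?case .
next
  case (step2 i)
  have "sm (q * of_int (i - 1)) x = sm (q * of_int i - q) x"
    by (simp add: algebra_simps)
  also have "\<dots> = sm q (sm (of_int i) x) \<otimes> inv (sm q x)"
    using step2 q x by (simp add: sm_diff coeff_vals_arith)
  also have "\<dots> = sm q (sm (of_int i) x \<otimes> inv (sm 1 x))" using q x by (simp add: sm_mult sm_inv)
  also have "sm (of_int i) x \<otimes> inv (sm 1 x) = sm (of_int (i - 1)) x" using x sm_diff[of "of_int i" 1 x] by simp
  finally show ?case .
qed

lemma sm_of_nat: "x \<in> carrier M \<Longrightarrow> sm (of_nat k) x = x [^] k"
proof (induction k)
  case (Suc k)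
  then have "sm (of_nat k + 1) x = x [^] k \<otimes> x"
    using sm_add[of "of_nat k" 1 x] coeff_vals_of_int[of "int k"] by simp
  then show ?case by (simp add: add.commute)
qed simp

text \<open>The Kronecker pairing of a module-valued cochain \<open>\<phi>\<close> with a chain
  \<open>c\<close>.\<close>

definition ev :: "('x \<Rightarrow> 'a) \<Rightarrow> ('x \<Rightarrow> rat) \<Rightarrow> 'a" where
  "ev \<phi> c = (\<Otimes>x\<in>{x. c x \<noteq> 0}. sm (c x) (\<phi> x))"

lemma ev_superset:
  assumes "finite S" "{x. c x \<noteq> 0} \<subseteq> S" "\<And>x. c x \<in> coeff_vals R" "\<And>x. \<phi> x \<in> carrier M"
  shows "ev \<phi> c = (\<Otimes>x\<in>S. sm (c x) (\<phi> x))"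
  unfolding ev_def by (rule finprod_mono_neutral_cong_left) (use assms in auto)

lemma ev_closed [simp]:
  assumes "\<And>x. c x \<in> coeff_vals R" "\<And>x. \<phi> x \<in> carrier M"
  shows "ev \<phi> c \<in> carrier M"
  unfolding ev_def by (rule finprod_closed) (use assms in auto)

lemma ev_cong:
  assumes "\<And>x. c x \<noteq> 0 \<Longrightarrow> \<phi> x = \<psi> x" "\<And>x. c x \<in> coeff_vals R" "\<And>x. \<psi> x \<in> carrier M"
  shows "ev \<phi> c = ev \<psi> c"
  unfolding ev_def by (rule finprod_cong') (use assms in auto)

lemma ev_trivial:
  assumes "\<And>x. c x \<noteq> 0 \<Longrightarrow> sm (c x) (\<phi> x) = \<one>"
  shows "ev \<phi> c = \<one>"
  unfolding ev_def by (rule finprod_one_eqI) (use assms in auto)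

text \<open>This is what lets the pairing descend to chains with coefficients in \<open>R\<close>,
  represented as chains modulo the ideal.\<close>

lemma ev_ideal:
  assumes "\<And>x. c x \<in> coeff_ideal R" "\<And>x. \<phi> x \<in> carrier M"
  shows "ev \<phi> c = \<one>"
  by (rule ev_trivial) (use assms sm_ideal in auto)

lemma ev_delta [simp]: "\<phi> x \<in> carrier M \<Longrightarrow> ev \<phi> (delta x) = \<phi> x"
proof -
  assume x: "\<phi> x \<in> carrier M"
  have "{y. delta x y \<noteq> 0} = {x}" by (auto simp: delta_def)
  then have "ev \<phi> (delta x) = (\<Otimes>y\<in>{x}. sm (delta x y) (\<phi> y))" by (simp add: ev_def)
  also have "\<dots> = sm (delta x x) (\<phi> x)" using x by (subst finprod_insert) (auto simp: delta_def)
  finally show ?thesis using x by (simp add: delta_def)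
qed

lemma ev_add:
  assumes "fin_supp c" "fin_supp d" "\<And>x. c x \<in> coeff_vals R" "\<And>x. d x \<in> coeff_vals R" "\<And>x. \<phi> x \<in> carrier M"
  shows "ev \<phi> (\<lambda>x. c x + d x) = ev \<phi> c \<otimes> ev \<phi> d"
proof -
  let ?S = "{x. c x \<noteq> 0} \<union> {x. d x \<noteq> 0}"
  have f: "finite ?S" using assms by (simp add: fin_supp_def)
  have "ev \<phi> (\<lambda>x. c x + d x) = (\<Otimes>x\<in>?S. sm (c x + d x) (\<phi> x))"
    by (rule ev_superset[OF f]) (use assms coeff_vals_arith in auto)
  also have "\<dots> = (\<Otimes>x\<in>?S. sm (c x) (\<phi> x) \<otimes> sm (d x) (\<phi> x))"
    using assms by (simp add: sm_add)
  also have "\<dots> = (\<Otimes>x\<in>?S. sm (c x) (\<phi> x)) \<otimes> (\<Otimes>x\<in>?S. sm (d x) (\<phi> x))"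
    by (rule finprod_multf) (use assms in auto)
  also have "(\<Otimes>x\<in>?S. sm (c x) (\<phi> x)) = ev \<phi> c"
    by (rule ev_superset[OF f, symmetric]) (use assms in auto)
  also have "(\<Otimes>x\<in>?S. sm (d x) (\<phi> x)) = ev \<phi> d"
    by (rule ev_superset[OF f, symmetric]) (use assms in auto)
  finally show ?thesis .
qed

lemma ev_diff:
  assumes "fin_supp c" "fin_supp d" "\<And>x. c x \<in> coeff_vals R" "\<And>x. d x \<in> coeff_vals R" "\<And>x. \<phi> x \<in> carrier M"
  shows "ev \<phi> (\<lambda>x. c x - d x) = ev \<phi> c \<otimes> inv (ev \<phi> d)"
proof -
  have "ev \<phi> (\<lambda>x. (c x - d x) + d x) = ev \<phi> (\<lambda>x. c x - d x) \<otimes> ev \<phi> d"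
    by (rule ev_add) (use assms coeff_vals_arith fin_supp_diff in auto)
  then have "ev \<phi> c = ev \<phi> (\<lambda>x. c x - d x) \<otimes> ev \<phi> d" by simp
  then show ?thesis using assms by (simp add: m_assoc coeff_vals_arith)
qed

lemma finprod_swap:
  assumes "finite S" "\<And>x y. F x y \<in> carrier M"
  shows "(\<Otimes>y\<in>T. \<Otimes>x\<in>S. F x y) = (\<Otimes>x\<in>S. \<Otimes>y\<in>T. F x y)"
  using assms(1) by (induction S rule: finite_induct) (use assms(2) in \<open>simp_all add: finprod_multf Pi_def\<close>)

lemma sm_finprod:
  assumes "q \<in> coeff_vals R" "\<And>y. F y \<in> carrier M"
  shows "sm q (\<Otimes>y\<in>T. F y) = (\<Otimes>y\<in>T. sm q (F y))"
  by (induction T rule: infinite_finite_induct) (use assms in \<open>simp_all add: sm_mult Pi_def\<close>)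

lemma sm_sum:
  assumes "\<And>x. h x \<in> coeff_vals R" "z \<in> carrier M"
  shows "sm (\<Sum>x\<in>S. h x) z = (\<Otimes>x\<in>S. sm (h x) z)"
  by (induction S rule: infinite_finite_induct)
    (use assms in \<open>simp_all add: sm_add coeff_vals_sum Pi_def\<close>)

text \<open>Adjointness, by exchanging a finite double product. For \<open>push\<close> it moves a
  map from chains to cochains, for \<open>bd\<close> it replaces the boundary of a chain by the
  coboundary of a cochain.\<close>

lemma ev_lin:
  assumes fc: "fin_supp c" and fg: "\<And>x. fin_supp (g x)" and c: "\<And>x. c x \<in> coeff_vals R"
    and g: "\<And>x y. g x y \<in> \<int>" and \<phi>: "\<And>x. \<phi> x \<in> carrier M"
  shows "ev \<phi> (lin c g) = ev (\<lambda>x. ev \<phi> (g x)) c"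
proof -
  let ?S = "{x. c x \<noteq> 0}"
  let ?T = "\<Union>x\<in>?S. {y. g x y \<noteq> 0}"
  have fS: "finite ?S" and fT: "finite ?T" using fc fg by (auto simp: fin_supp_def)
  have gv: "g x y \<in> coeff_vals R" for x y using g by (rule coeff_vals_Ints)
  have "ev \<phi> (lin c g) = (\<Otimes>y\<in>?T. sm (lin c g y) (\<phi> y))"
    by (rule ev_superset[OF fT lin_supp]) (auto intro!: lin_vals c g \<phi>)
  also have "\<dots> = (\<Otimes>y\<in>?T. \<Otimes>x\<in>?S. sm (c x * g x y) (\<phi> y))"
    unfolding lin_def by (subst sm_sum) (auto intro!: coeff_vals_arith(3) c gv \<phi>)
  also have "\<dots> = (\<Otimes>y\<in>?T. \<Otimes>x\<in>?S. sm (c x) (sm (g x y) (\<phi> y)))"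
  proof -
    have "sm (c x * g x y) (\<phi> y) = sm (c x) (sm (g x y) (\<phi> y))" for x y
    proof -
      obtain k where "g x y = of_int k" using g Ints_cases by blast
      then show ?thesis using sm_times_int[OF c \<phi>] by simp
    qed
    then show ?thesis by simp
  qed
  also have "\<dots> = (\<Otimes>x\<in>?S. \<Otimes>y\<in>?T. sm (c x) (sm (g x y) (\<phi> y)))"
    by (rule finprod_swap[OF fS]) (use c gv \<phi> in simp)
  also have "\<dots> = (\<Otimes>x\<in>?S. sm (c x) (ev \<phi> (g x)))"
  proof (rule finprod_cong')
    fix x assume x: "x \<in> ?S"
    have "ev \<phi> (g x) = (\<Otimes>y\<in>?T. sm (g x y) (\<phi> y))"
      by (rule ev_superset[OF fT _ gv \<phi>]) (use x in auto)
    then show "(\<Otimes>y\<in>?T. sm (c x) (sm (g x y) (\<phi> y))) = sm (c x) (ev \<phi> (g x))"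
      using c gv \<phi> by (simp add: sm_finprod)
  qed (use c gv \<phi> in auto)
  finally show ?thesis by (simp add: ev_def)
qed

lemma ev_push:
  assumes "fin_supp c" "\<And>x. c x \<in> coeff_vals R" "\<And>x. \<phi> x \<in> carrier M"
  shows "ev \<phi> (push f c) = ev (\<lambda>xs. \<phi> (map f xs)) c"
  using assms by (simp add: push_eq_lin ev_lin delta_Ints)

lemma ev_bd:
  assumes "fin_supp c" "\<And>x. c x \<in> coeff_vals R" "\<And>x. \<phi> x \<in> carrier M"
  shows "ev \<phi> (bd G c) = ev (\<lambda>xs. ev \<phi> (bd_basis G xs)) c"
  using assms by (simp add: bd_eq_lin ev_lin bd_basis_Ints)

lemma delta_vals: "delta x y \<in> coeff_vals R"
  by (simp add: delta_def)

lemma ev_bd_basis_2: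
  assumes "\<And>x. \<phi> x \<in> carrier M"
  shows "ev \<phi> (bd_basis G [a, b]) = \<phi> [b] \<otimes> inv (\<phi> [a \<otimes>\<^bsub>G\<^esub> b]) \<otimes> \<phi> [a]"
  using assms by (simp add: bd_basis_2 ev_add ev_diff fin_supp_diff delta_vals coeff_vals_arith)

lemma ev_bd_basis_3:
  assumes "\<And>x. \<phi> x \<in> carrier M"
  shows "ev \<phi> (bd_basis G [a, b, c]) = (\<phi> [b, c] \<otimes> inv (\<phi> [a \<otimes>\<^bsub>G\<^esub> b, c]))
    \<otimes> (\<phi> [a, b \<otimes>\<^bsub>G\<^esub> c] \<otimes> inv (\<phi> [a, b]))"
  using assms by (simp add: bd_basis_3 ev_add ev_diff fin_supp_diff delta_vals coeff_vals_arith)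

end

section \<open>Lifting along central extensions\<close>

text \<open>The setting is a homomorphism from \<open>B\<close> modulo \<open>lcs B n\<close> to
  \<open>E\<close> modulo the central subgroup \<open>C\<close>; \<open>s\<close> is a set-theoretic
  lift of it to \<open>E\<close>, and along \<open>f\<close> it agrees with \<open>u\<close> up to
  \<open>C\<close>. Defining \<open>s\<close> on cosets rather than on \<open>B\<close> makes the
  obstruction cocycle live on the quotient in which the cycles of \<open>Phi_cycles\<close>
  bound.\<close>

locale lifting_problem = A: group A + B: group B + E: group E
  for A :: "('a, 'x) monoid_scheme" and B :: "('b, 'y) monoid_scheme" and E :: "('e, 'z) monoid_scheme" +
  fixes R :: coeff and n :: nat and f :: "'a \<Rightarrow> 'b" and u :: "'a \<Rightarrow> 'e"
    and C :: "'e set" and sm :: "rat \<Rightarrow> 'e \<Rightarrow> 'e" and s :: "'b set \<Rightarrow> 'e"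
  assumes Dw: "Dwyer R n A B f" and u: "u \<in> hom A E" and K: "lcs B n \<lhd> B"
    and C: "subgroup C E" and central: "\<And>c e. c \<in> C \<Longrightarrow> e \<in> carrier E \<Longrightarrow> c \<otimes>\<^bsub>E\<^esub> e = e \<otimes>\<^bsub>E\<^esub> c"
    and module: "coeff_module (E\<lparr>carrier := C\<rparr>) R sm"
    and s: "\<And>U. U \<in> carrier (B Mod (lcs B n)) \<Longrightarrow> s U \<in> carrier E"
    and s_mult: "\<And>U V. U \<in> carrier (B Mod (lcs B n)) \<Longrightarrow> V \<in> carrier (B Mod (lcs B n)) \<Longrightarrow>
      s U \<otimes>\<^bsub>E\<^esub> s V \<otimes>\<^bsub>E\<^esub> inv\<^bsub>E\<^esub> (s (U \<otimes>\<^bsub>B Mod (lcs B n)\<^esub> V)) \<in> C"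
    and s_u: "\<And>a. a \<in> carrier A \<Longrightarrow> s (lcs B n #>\<^bsub>B\<^esub> f a) \<otimes>\<^bsub>E\<^esub> inv\<^bsub>E\<^esub> (u a) \<in> C"
begin

definition "M = E\<lparr>carrier := C\<rparr>"
abbreviation "Q \<equiv> B Mod (lcs B n)"
abbreviation "proj b \<equiv> lcs B n #>\<^bsub>B\<^esub> b"

lemma M_carrier: "carrier M = C" and M_mult: "monoid.mult M = monoid.mult E" and M_one: "\<one>\<^bsub>M\<^esub> = \<one>\<^bsub>E\<^esub>"
  by (simp_all add: M_def)

sublocale M: coeff_module M R sm unfolding M_def by (rule module)
sublocale K: normal "lcs B n" B by (rule K)
sublocale Q: group Q by (rule K.factorgroup_is_group)

lemma C_sub: "c \<in> C \<Longrightarrow> c \<in> carrier E"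
  using subgroup.subset[OF C] by blast

lemma f_hom: "f \<in> hom A B" using Dw by (simp add: Dwyer_def)

lemma f_closed: "a \<in> carrier A \<Longrightarrow> f a \<in> carrier B" using f_hom by (auto simp: hom_def)
lemma u_closed: "a \<in> carrier A \<Longrightarrow> u a \<in> carrier E" using u by (auto simp: hom_def)

lemma proj_hom: "proj \<in> hom B Q" by (rule K.r_coset_hom_Mod)
lemma proj_closed: "b \<in> carrier B \<Longrightarrow> proj b \<in> carrier Q" using proj_hom by (rule hom_in_carrier)
lemma proj_mult: "b \<in> carrier B \<Longrightarrow> c \<in> carrier B \<Longrightarrow> proj (b \<otimes>\<^bsub>B\<^esub> c) = proj b \<otimes>\<^bsub>Q\<^esub> proj c"
  using proj_hom by (rule hom_mult)

text \<open>The obstruction cocycle of \<open>s\<close>. The value \<open>\<one>\<close> elsewhere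
  keeps all values in \<open>C\<close>, so that the pairing needs no side conditions on
  lists.\<close>

definition \<psi> :: "'b set list \<Rightarrow> 'e" where
  "\<psi> xs = (case xs of [U, V] \<Rightarrow> if U \<in> carrier Q \<and> V \<in> carrier Q
      then s U \<otimes>\<^bsub>E\<^esub> s V \<otimes>\<^bsub>E\<^esub> inv\<^bsub>E\<^esub> (s (U \<otimes>\<^bsub>Q\<^esub> V)) else \<one>\<^bsub>E\<^esub> | _ \<Rightarrow> \<one>\<^bsub>E\<^esub>)"

text \<open>The 1-cochain on \<open>A\<close> that compares the lift \<open>s\<close> with the
  homomorphism \<open>u\<close>.\<close>

definition \<tau> :: "'a list \<Rightarrow> 'e" where
  "\<tau> xs = (case xs of [a] \<Rightarrow> if a \<in> carrier A
      then s (proj (f a)) \<otimes>\<^bsub>E\<^esub> inv\<^bsub>E\<^esub> (u a) else \<one>\<^bsub>E\<^esub> | _ \<Rightarrow> \<one>\<^bsub>E\<^esub>)"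

abbreviation "\<phi> xs \<equiv> \<psi> (map proj xs)"

lemma \<psi>_C: "\<psi> xs \<in> carrier M"
  using s_mult subgroup.one_closed[OF C] by (auto simp: M_carrier \<psi>_def split: list.splits)

lemma \<tau>_C: "\<tau> xs \<in> carrier M"
  using s_u subgroup.one_closed[OF C] by (auto simp: M_carrier \<tau>_def split: list.splits)

lemma \<psi>_eq: "U \<in> carrier Q \<Longrightarrow> V \<in> carrier Q \<Longrightarrow> s U \<otimes>\<^bsub>E\<^esub> s V = \<psi> [U, V] \<otimes>\<^bsub>E\<^esub> s (U \<otimes>\<^bsub>Q\<^esub> V)"
  using s Q.m_closed by (simp add: \<psi>_def E.m_assoc del: mult_FactGroup)

lemma \<tau>_eq: "a \<in> carrier A \<Longrightarrow> s (proj (f a)) = \<tau> [a] \<otimes>\<^bsub>E\<^esub> u a"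
  using s[OF proj_closed[OF f_closed]] u_closed by (simp add: \<tau>_def E.m_assoc)

text \<open>The two bracketings of the product of \<open>s U\<close>, \<open>s V\<close> and
  \<open>s W\<close> are compared. Centrality enters when \<open>\<psi> [V, W]\<close> is moved past
  \<open>s U\<close>.\<close>

lemma cocycle:
  assumes "U \<in> carrier Q" "V \<in> carrier Q" "W \<in> carrier Q"
  shows "\<psi> [V, W] \<otimes>\<^bsub>E\<^esub> \<psi> [U, V \<otimes>\<^bsub>Q\<^esub> W] = \<psi> [U, V] \<otimes>\<^bsub>E\<^esub> \<psi> [U \<otimes>\<^bsub>Q\<^esub> V, W]"
proof -
  note cl = assms Q.m_closed[OF assms(1,2)] Q.m_closed[OF assms(2,3)]
    Q.m_closed[OF Q.m_closed[OF assms(1,2)] assms(3)]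
  have c: "\<psi> xs \<in> C" "\<psi> xs \<in> carrier E" for xs using \<psi>_C[of xs] C_sub by (auto simp: M_carrier)
  define r where "r = s (U \<otimes>\<^bsub>Q\<^esub> V \<otimes>\<^bsub>Q\<^esub> W)"
  have r: "r \<in> carrier E" using s cl by (simp add: r_def)
  have "s U \<otimes>\<^bsub>E\<^esub> (s V \<otimes>\<^bsub>E\<^esub> s W) = s U \<otimes>\<^bsub>E\<^esub> \<psi> [V, W] \<otimes>\<^bsub>E\<^esub> s (V \<otimes>\<^bsub>Q\<^esub> W)"
    using \<psi>_eq[OF assms(2,3)] s cl c by (simp add: E.m_assoc)
  also have "s U \<otimes>\<^bsub>E\<^esub> \<psi> [V, W] = \<psi> [V, W] \<otimes>\<^bsub>E\<^esub> s U" using central[OF c(1)] s cl by simp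
  also have "\<dots> \<otimes>\<^bsub>E\<^esub> s (V \<otimes>\<^bsub>Q\<^esub> W) = \<psi> [V, W] \<otimes>\<^bsub>E\<^esub> \<psi> [U, V \<otimes>\<^bsub>Q\<^esub> W] \<otimes>\<^bsub>E\<^esub> r"
    using \<psi>_eq[of U "V \<otimes>\<^bsub>Q\<^esub> W"] s cl c r
    by (simp add: r_def E.m_assoc Q.m_assoc del: mult_FactGroup)
  finally have 1: "s U \<otimes>\<^bsub>E\<^esub> (s V \<otimes>\<^bsub>E\<^esub> s W) = \<dots>" .
  have "s U \<otimes>\<^bsub>E\<^esub> s V \<otimes>\<^bsub>E\<^esub> s W = \<psi> [U, V] \<otimes>\<^bsub>E\<^esub> (s (U \<otimes>\<^bsub>Q\<^esub> V) \<otimes>\<^bsub>E\<^esub> s W)"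
    using \<psi>_eq[OF assms(1,2)] s cl c by (simp add: E.m_assoc del: mult_FactGroup)
  also have "\<dots> = \<psi> [U, V] \<otimes>\<^bsub>E\<^esub> \<psi> [U \<otimes>\<^bsub>Q\<^esub> V, W] \<otimes>\<^bsub>E\<^esub> r"
    using \<psi>_eq[of "U \<otimes>\<^bsub>Q\<^esub> V" W] cl c r s by (simp add: r_def E.m_assoc del: mult_FactGroup)
  finally have 2: "s U \<otimes>\<^bsub>E\<^esub> s V \<otimes>\<^bsub>E\<^esub> s W = \<dots>" .
  have "\<psi> [V, W] \<otimes>\<^bsub>E\<^esub> \<psi> [U, V \<otimes>\<^bsub>Q\<^esub> W] \<otimes>\<^bsub>E\<^esub> r = \<psi> [U, V] \<otimes>\<^bsub>E\<^esub> \<psi> [U \<otimes>\<^bsub>Q\<^esub> V, W] \<otimes>\<^bsub>E\<^esub> r"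
    using 1 2 s cl by (simp add: E.m_assoc del: mult_FactGroup)
  then show ?thesis using c r E.m_closed by (simp only: E.right_cancel)
qed

lemma ev_bd_3:
  assumes d: "d \<in> chains R 3 Q"
  shows "M.ev \<psi> (bd Q d) = \<one>\<^bsub>M\<^esub>"
proof -
  have "M.ev \<psi> (bd Q d) = M.ev (\<lambda>xs. M.ev \<psi> (bd_basis Q xs)) d"
    by (rule M.ev_bd[OF chainsD(1,2)[OF d] \<psi>_C])
  also have "\<dots> = \<one>\<^bsub>M\<^esub>"
  proof (rule M.ev_trivial)
    fix xs assume nz: "d xs \<noteq> 0"
    then have "length xs = 3" "set xs \<subseteq> carrier Q" using chainsD(3,4)[OF d] by auto
    then obtain U V W where xs: "xs = [U, V, W]" and XYZ: "U \<in> carrier Q" "V \<in> carrier Q" "W \<in> carrier Q"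
      by (auto simp: numeral_3_eq_3 length_Suc_conv)
    note coc = cocycle[OF XYZ]
    have ac: "a \<otimes>\<^bsub>M\<^esub> inv\<^bsub>M\<^esub> b \<otimes>\<^bsub>M\<^esub> (c \<otimes>\<^bsub>M\<^esub> inv\<^bsub>M\<^esub> d) = \<one>\<^bsub>M\<^esub>"
      if "a \<otimes>\<^bsub>M\<^esub> c = d \<otimes>\<^bsub>M\<^esub> b" "a \<in> carrier M" "b \<in> carrier M" "c \<in> carrier M" "d \<in> carrier M" for a b c d
    proof -
      have "a \<otimes>\<^bsub>M\<^esub> inv\<^bsub>M\<^esub> b \<otimes>\<^bsub>M\<^esub> (c \<otimes>\<^bsub>M\<^esub> inv\<^bsub>M\<^esub> d) = (a \<otimes>\<^bsub>M\<^esub> c) \<otimes>\<^bsub>M\<^esub> inv\<^bsub>M\<^esub> (d \<otimes>\<^bsub>M\<^esub> b)"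
        using that(2-) by (simp add: M.inv_mult M.m_ac)
      then show ?thesis using M.r_inv[OF M.m_closed[OF that(5,3)]] unfolding that(1) by simp
    qed
    have "M.ev \<psi> (bd_basis Q xs) = \<one>\<^bsub>M\<^esub>"
      unfolding xs M.ev_bd_basis_3[of \<psi>, OF \<psi>_C]
      by (rule ac) (use coc \<psi>_C in \<open>simp_all add: M_mult del: mult_FactGroup\<close>)
    then show "sm (d xs) (M.ev \<psi> (bd_basis Q xs)) = \<one>\<^bsub>M\<^esub>"
      using M.sm_unit[OF chainsD(2)[OF d]] by simp
  qed
  finally show ?thesis .
qed

lemma ev_\<phi>_push:
  assumes "c \<in> chains R k B"
  shows "M.ev \<phi> c = M.ev \<psi> (push proj c)"
  by (rule M.ev_push[where f = proj and \<phi> = \<psi>, OF chainsD(1,2)[OF assms] \<psi>_C, symmetric])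

text \<open>After projection such a cycle is a boundary plus an ideal chain. The cocycle
  \<open>\<psi>\<close> pairs trivially with both.\<close>

lemma ev_Phi:
  assumes "z \<in> Phi_cycles R n B"
  shows "M.ev \<phi> z = \<one>\<^bsub>M\<^esub>"
proof -
  have z: "z \<in> chains R 2 B" using assms by (auto simp: Phi_cycles_def cycles_def)
  obtain d e where d: "d \<in> chains R 3 Q" and e: "e \<in> ideal_chains R 2 Q"
    and eq: "push proj z = (\<lambda>xs. bd Q d xs + e xs)"
    using assms by (auto simp: Phi_cycles_def boundaries_def)
  have "M.ev \<phi> z = M.ev \<psi> (\<lambda>xs. bd Q d xs + e xs)"
    using ev_\<phi>_push[OF z] eq by simp
  also have "\<dots> = M.ev \<psi> (bd Q d) \<otimes>\<^bsub>M\<^esub> M.ev \<psi> e"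
    by (rule M.ev_add[OF fin_supp_bd[OF chainsD(1)[OF d]] chainsD(1)[OF ideal_chainsD(1)[OF e]]
        bd_vals[OF d] chainsD(2)[OF ideal_chainsD(1)[OF e]] \<psi>_C])
  also have "M.ev \<psi> e = \<one>\<^bsub>M\<^esub>" by (rule M.ev_ideal[OF ideal_chainsD(2)[OF e] \<psi>_C])
  finally show ?thesis unfolding ev_bd_3[OF d] by simp
qed

text \<open>On \<open>A\<close> the pulled back cocycle is the coboundary of \<open>\<tau>\<close>:
  since \<open>u\<close> is multiplicative, the failure of \<open>s\<close> to be so is carried by
  \<open>\<tau>\<close> alone.\<close>

lemma ev_\<tau>_bd:
  assumes x: "x \<in> chains R 2 A"
  shows "M.ev \<tau> (bd A x) = M.ev \<phi> (push f x)"
proof -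
  have "M.ev \<tau> (bd A x) = M.ev (\<lambda>xs. M.ev \<tau> (bd_basis A xs)) x"
    by (rule M.ev_bd[OF chainsD(1,2)[OF x] \<tau>_C])
  also have "\<dots> = M.ev (\<lambda>xs. \<phi> (map f xs)) x"
  proof (rule M.ev_cong[OF _ chainsD(2)[OF x] \<psi>_C])
    fix xs assume nz: "x xs \<noteq> 0"
    then have "length xs = 2" "set xs \<subseteq> carrier A" using chainsD(3,4)[OF x] by auto
    then obtain a b where xs: "xs = [a, b]" and ab: "a \<in> carrier A" "b \<in> carrier A"
      by (auto simp: numeral_2_eq_2 length_Suc_conv)
    have pc: "proj (f a) \<in> carrier Q" "proj (f b) \<in> carrier Q"
      using ab proj_closed f_closed by blast+
    have t: "\<tau> xs \<in> C" "\<tau> xs \<in> carrier E" "\<psi> ys \<in> C" "\<psi> ys \<in> carrier E" for xs ys using \<tau>_C[of xs] \<psi>_C[of ys] C_sub by (auto simp: M_carrier)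
    have ua: "u a \<in> carrier E" "u b \<in> carrier E" using u_closed ab by auto
    have uab: "u (a \<otimes>\<^bsub>A\<^esub> b) = u a \<otimes>\<^bsub>E\<^esub> u b" using hom_mult[OF u ab] .
    have sab: "s (proj (f a) \<otimes>\<^bsub>Q\<^esub> proj (f b)) = \<tau> [a \<otimes>\<^bsub>A\<^esub> b] \<otimes>\<^bsub>E\<^esub> u (a \<otimes>\<^bsub>A\<^esub> b)"
      using \<tau>_eq[OF A.m_closed[OF ab]] proj_mult[OF f_closed[OF ab(1)] f_closed[OF ab(2)]]
        hom_mult[OF f_hom ab] by simp
    have "\<tau> [a] \<otimes>\<^bsub>E\<^esub> \<tau> [b] \<otimes>\<^bsub>E\<^esub> (u a \<otimes>\<^bsub>E\<^esub> u b) = \<tau> [a] \<otimes>\<^bsub>E\<^esub> (\<tau> [b] \<otimes>\<^bsub>E\<^esub> u a) \<otimes>\<^bsub>E\<^esub> u b"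
      using t ua by (simp add: E.m_assoc)
    also have "\<tau> [b] \<otimes>\<^bsub>E\<^esub> u a = u a \<otimes>\<^bsub>E\<^esub> \<tau> [b]" using central t ua by simp
    also have "\<tau> [a] \<otimes>\<^bsub>E\<^esub> (u a \<otimes>\<^bsub>E\<^esub> \<tau> [b]) \<otimes>\<^bsub>E\<^esub> u b = s (proj (f a)) \<otimes>\<^bsub>E\<^esub> s (proj (f b))"
      using \<tau>_eq ab t ua by (simp add: E.m_assoc)
    also have "\<dots> = \<psi> [proj (f a), proj (f b)] \<otimes>\<^bsub>E\<^esub> \<tau> [a \<otimes>\<^bsub>A\<^esub> b] \<otimes>\<^bsub>E\<^esub> (u a \<otimes>\<^bsub>E\<^esub> u b)"
      unfolding \<psi>_eq[OF pc] sab uab using t ua by (simp add: E.m_assoc)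
    finally have "\<tau> [a] \<otimes>\<^bsub>E\<^esub> \<tau> [b] = \<psi> [proj (f a), proj (f b)] \<otimes>\<^bsub>E\<^esub> \<tau> [a \<otimes>\<^bsub>A\<^esub> b]"
      using t ua E.m_closed by (simp only: E.right_cancel)
    then have eq: "\<tau> [a] \<otimes>\<^bsub>M\<^esub> \<tau> [b] = \<psi> [proj (f a), proj (f b)] \<otimes>\<^bsub>M\<^esub> \<tau> [a \<otimes>\<^bsub>A\<^esub> b]" by (simp add: M_mult)
    have "\<tau> [b] \<otimes>\<^bsub>M\<^esub> inv\<^bsub>M\<^esub> \<tau> [a \<otimes>\<^bsub>A\<^esub> b] \<otimes>\<^bsub>M\<^esub> \<tau> [a] = (\<tau> [a] \<otimes>\<^bsub>M\<^esub> \<tau> [b]) \<otimes>\<^bsub>M\<^esub> inv\<^bsub>M\<^esub> \<tau> [a \<otimes>\<^bsub>A\<^esub> b]"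
      using \<tau>_C by (simp add: M.m_ac)
    also have "\<dots> = \<psi> [proj (f a), proj (f b)]"
      unfolding eq using \<tau>_C \<psi>_C by (simp add: M.m_assoc)
    finally show "M.ev \<tau> (bd_basis A xs) = \<phi> (map f xs)"
      unfolding xs M.ev_bd_basis_2[of \<tau>, OF \<tau>_C] by simp
  qed
  also have "\<dots> = M.ev \<phi> (push f x)"
    by (rule M.ev_push[OF chainsD(1,2)[OF x] \<psi>_C, symmetric])
  finally show ?thesis .
qed

lemma ev_ideal_chain:
  "c \<in> ideal_chains R k G \<Longrightarrow> (\<And>x. \<theta> x \<in> carrier M) \<Longrightarrow> M.ev \<theta> c = \<one>\<^bsub>M\<^esub>"
  by (rule M.ev_ideal) (use ideal_chainsD(2) in auto)

lemma push_f_chains: "x \<in> chains R k A \<Longrightarrow> push f x \<in> chains R k B"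
  by (rule push_chains) (use f_closed in auto)

text \<open>Modulo \<open>Phi_cycles\<close> the cycle \<open>y\<close> comes from a cycle
  \<open>x\<close> of \<open>A\<close>. On its image the cocycle evaluates to the value of
  \<open>\<tau>\<close> on \<open>bd A x\<close>, an ideal chain.\<close>

lemma ev_cycle:
  assumes y: "y \<in> cycles R 2 B"
  shows "M.ev \<phi> y = \<one>\<^bsub>M\<^esub>"
proof -
  obtain x where x: "x \<in> cycles R 2 A" and P: "(\<lambda>xs. push f x xs - y xs) \<in> Phi_cycles R n B"
    using Dw y unfolding Dwyer_def by blast
  have xc: "x \<in> chains R 2 A" and bx: "bd A x \<in> ideal_chains R 1 A" using x by (auto simp: cycles_def)
  have yc: "y \<in> chains R 2 B" using y by (auto simp: cycles_def)
  have "M.ev \<phi> (push f x) = M.ev \<tau> (bd A x)" using ev_\<tau>_bd[OF xc] by simp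
  also have "\<dots> = \<one>\<^bsub>M\<^esub>" by (rule ev_ideal_chain[OF bx \<tau>_C])
  finally have 1: "M.ev \<phi> (push f x) = \<one>\<^bsub>M\<^esub>" .
  have "\<one>\<^bsub>M\<^esub> = M.ev \<phi> (\<lambda>xs. push f x xs - y xs)" using ev_Phi[OF P] by simp
  also have "\<dots> = M.ev \<phi> (push f x) \<otimes>\<^bsub>M\<^esub> inv\<^bsub>M\<^esub> (M.ev \<phi> y)"
    by (rule M.ev_diff[OF chainsD(1)[OF push_f_chains[OF xc]] chainsD(1)[OF yc]
        chainsD(2)[OF push_f_chains[OF xc]] chainsD(2)[OF yc] \<psi>_C])
  finally have "inv\<^bsub>M\<^esub> (M.ev \<phi> y) = \<one>\<^bsub>M\<^esub>"
    unfolding 1 using M.ev_closed[OF chainsD(2)[OF yc] \<psi>_C, of "\<lambda>x. map proj x"]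
    by (simp)
  moreover have "M.ev \<phi> y \<in> carrier M"
    by (rule M.ev_closed[OF chainsD(2)[OF yc] \<psi>_C])
  ultimately show ?thesis by (simp only: M.inv_eq_1_iff)
qed

text \<open>Injectivity on \<open>H_1\<close> makes \<open>x\<close> bound already in
  \<open>A\<close>, say by \<open>d'\<close> up to an ideal chain. Then \<open>push f d'\<close> and
  \<open>d\<close> differ by a 2-cycle of \<open>B\<close>, which \<open>ev_cycle\<close> kills.
  This gives the independence of choices in the extension of \<open>\<tau>\<close> to
  \<open>B\<close>.\<close>

lemma boundary_relation:
  assumes x: "x \<in> chains R 1 A" and d: "d \<in> chains R 2 B" and e: "e \<in> ideal_chains R 1 B"
    and eq: "push f x = (\<lambda>xs. bd B d xs + e xs)"
  shows "M.ev \<tau> x = M.ev \<phi> d"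
proof -
  have "push f x \<in> boundaries R 1 B"
    using push_f_chains[OF x] d e eq unfolding boundaries_def by (auto simp: numeral_2_eq_2)
  then have "x \<in> boundaries R 1 A"
    using Dw x unfolding Dwyer_def H_iso_def cycles_1 by blast
  then obtain d' e' where d': "d' \<in> chains R 2 A" and e': "e' \<in> ideal_chains R 1 A"
    and x_eq: "x = (\<lambda>xs. bd A d' xs + e' xs)"
    by (auto simp: boundaries_def numeral_2_eq_2)
  note e'c = ideal_chainsD(1)[OF e']
  have "M.ev \<tau> x = M.ev \<tau> (bd A d') \<otimes>\<^bsub>M\<^esub> M.ev \<tau> e'"
    unfolding x_eq
    by (rule M.ev_add[OF fin_supp_bd[OF chainsD(1)[OF d']] chainsD(1)[OF e'c] bd_vals[OF d'] chainsD(2)[OF e'c] \<tau>_C])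
  then have 1: "M.ev \<tau> x = M.ev \<phi> (push f d')"
    unfolding ev_\<tau>_bd[OF d'] ev_ideal_chain[OF e' \<tau>_C]
    by (simp add: M.ev_closed[OF chainsD(2)[OF push_f_chains[OF d']] \<psi>_C])
  let ?z = "\<lambda>xs. push f d' xs - d xs"
  note pd = push_f_chains[OF d']
  have "bd B ?z = (\<lambda>xs. push f (bd A d') xs - bd B d xs)"
    by (simp only: bd_diff[OF chainsD(1)[OF pd] chainsD(1)[OF d]] bd_push_2[OF d' f_hom])
  also have "\<dots> = (\<lambda>xs. e xs - push f e' xs)"
  proof -
    have "push f x = (\<lambda>xs. push f (bd A d') xs + push f e' xs)"
      unfolding x_eq by (rule push_add[OF fin_supp_bd[OF chainsD(1)[OF d']] chainsD(1)[OF e'c]])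
    then have "push f (bd A d') xs + push f e' xs = bd B d xs + e xs" for xs
      using fun_cong[OF eq] by simp
    then show ?thesis by (simp add: fun_eq_iff algebra_simps)
  qed
  finally have "bd B ?z \<in> ideal_chains R 1 B"
    using ideal_chains_diff[OF e push_ideal[OF e', of f B]] f_closed by auto
  then have "?z \<in> cycles R 2 B"
    using chains_diff[OF pd d] by (simp add: cycles_def)
  then have "\<one>\<^bsub>M\<^esub> = M.ev \<phi> ?z" using ev_cycle by simp
  also have "\<dots> = M.ev \<phi> (push f d') \<otimes>\<^bsub>M\<^esub> inv\<^bsub>M\<^esub> (M.ev \<phi> d)"
    by (rule M.ev_diff[OF chainsD(1)[OF pd] chainsD(1)[OF d] chainsD(2)[OF pd] chainsD(2)[OF d] \<psi>_C])
  finally have 2: "M.ev \<phi> (push f d') \<otimes>\<^bsub>M\<^esub> inv\<^bsub>M\<^esub> (M.ev \<phi> d) = \<one>\<^bsub>M\<^esub>" by simp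
  have c: "M.ev \<phi> (push f d') \<in> carrier M" "M.ev \<phi> d \<in> carrier M"
    by (rule M.ev_closed[OF chainsD(2)[OF pd] \<psi>_C], rule M.ev_closed[OF chainsD(2)[OF d] \<psi>_C])
  show ?thesis
    unfolding 1 using M.inv_solve_right'[OF M.one_closed c] 2 c by (simp)
qed

text \<open>Surjectivity on \<open>H_1\<close> expresses each \<open>[b]\<close> by the image of a
  1-chain \<open>x\<close> of \<open>A\<close>, up to the boundary of some \<open>d\<close> and an
  ideal chain. Any two expressions agree by \<open>boundary_relation\<close>, so arbitrary choices
  of \<open>x\<close> and \<open>d\<close> yield a 1-cochain that extends \<open>\<tau>\<close> and
  has coboundary \<open>\<phi>\<close>.\<close>

lemma potential_exists:
  "\<exists>t. (\<forall>b\<in>carrier B. t b \<in> C) \<and> (\<forall>a\<in>carrier A. t (f a) = \<tau> [a]) \<and>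
     (\<forall>b\<in>carrier B. \<forall>c\<in>carrier B. t b \<otimes>\<^bsub>E\<^esub> t c = \<phi> [b, c] \<otimes>\<^bsub>E\<^esub> t (b \<otimes>\<^bsub>B\<^esub> c))"
proof -
  have "\<forall>b\<in>carrier B. \<exists>x d e. x \<in> chains R 1 A \<and> d \<in> chains R 2 B \<and> e \<in> ideal_chains R 1 B \<and>
      push f x = (\<lambda>xs. delta [b] xs + bd B d xs + e xs)"
  proof
    fix b assume b: "b \<in> carrier B"
    then obtain x where x: "x \<in> chains R 1 A" "(\<lambda>xs. push f x xs - delta [b] xs) \<in> boundaries R 1 B"
      using Dw chains_delta_1[OF b] unfolding Dwyer_def H_iso_def cycles_1 by blast
    then obtain d e where "d \<in> chains R 2 B" "e \<in> ideal_chains R 1 B"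
      "(\<lambda>xs. push f x xs - delta [b] xs) = (\<lambda>xs. bd B d xs + e xs)"
      by (auto simp: boundaries_def numeral_2_eq_2)
    moreover from this(3) have "push f x = (\<lambda>xs. delta [b] xs + bd B d xs + e xs)"
      by (simp add: fun_eq_iff algebra_simps)
    ultimately show "\<exists>x d e. x \<in> chains R 1 A \<and> d \<in> chains R 2 B \<and> e \<in> ideal_chains R 1 B \<and>
      push f x = (\<lambda>xs. delta [b] xs + bd B d xs + e xs)" using x(1) by blast
  qed
  then obtain x where "\<forall>b\<in>carrier B. \<exists>d e. x b \<in> chains R 1 A \<and> d \<in> chains R 2 B \<and> e \<in> ideal_chains R 1 B \<and>
      push f (x b) = (\<lambda>xs. delta [b] xs + bd B d xs + e xs)"
    by (rule bchoice[THEN exE])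
  then obtain d where "\<forall>b\<in>carrier B. \<exists>e. x b \<in> chains R 1 A \<and> d b \<in> chains R 2 B \<and> e \<in> ideal_chains R 1 B \<and>
      push f (x b) = (\<lambda>xs. delta [b] xs + bd B (d b) xs + e xs)"
    by (rule bchoice[THEN exE])
  then obtain e where "\<forall>b\<in>carrier B. x b \<in> chains R 1 A \<and> d b \<in> chains R 2 B \<and> e b \<in> ideal_chains R 1 B \<and>
      push f (x b) = (\<lambda>xs. delta [b] xs + bd B (d b) xs + e b xs)"
    by (rule bchoice[THEN exE])
  then have xde: "\<And>b. b \<in> carrier B \<Longrightarrow> x b \<in> chains R 1 A"
      "\<And>b. b \<in> carrier B \<Longrightarrow> d b \<in> chains R 2 B"
      "\<And>b. b \<in> carrier B \<Longrightarrow> e b \<in> ideal_chains R 1 B"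
      "\<And>b. b \<in> carrier B \<Longrightarrow> push f (x b) = (\<lambda>xs. delta [b] xs + bd B (d b) xs + e b xs)"
    by blast+
  note fx = chainsD(1)[OF xde(1)] and fd = chainsD(1)[OF xde(2)]
  note vx = chainsD(2)[OF xde(1)] and vd = chainsD(2)[OF xde(2)]
  have X: "M.ev \<tau> (x b) \<in> carrier M" "M.ev \<phi> (d b) \<in> carrier M" if b: "b \<in> carrier B" for b
    by (rule M.ev_closed[OF vx[OF b] \<tau>_C], rule M.ev_closed[OF vd[OF b] \<psi>_C])
  \<comment> \<open>The only possible value: pairing a cochain that extends \<open>\<tau>\<close>
    and has coboundary \<open>\<phi>\<close> with
    \<open>push f (x b) = [b] + bd B (d b) + e b\<close> gives this formula.\<close>
  define t where "t b = M.ev \<tau> (x b) \<otimes>\<^bsub>M\<^esub> inv\<^bsub>M\<^esub> (M.ev \<phi> (d b))" for b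
  have tM: "t b \<in> carrier M" if "b \<in> carrier B" for b
    using X[OF that] by (simp add: t_def)
  have t_f: "t (f a) = \<tau> [a]" if a: "a \<in> carrier A" for a
  proof -
    have b: "f a \<in> carrier B" using a by (rule f_closed)
    have da: "delta [a] \<in> chains R 1 A" using a by (rule chains_delta_1)
    let ?x = "\<lambda>xs. x (f a) xs - delta [a] xs"
    have "push f ?x = (\<lambda>xs. push f (x (f a)) xs - delta [f a] xs)"
      by (simp only: push_diff[OF fx[OF b] chainsD(1)[OF da]] push_delta list.map)
    also have "\<dots> = (\<lambda>xs. bd B (d (f a)) xs + e (f a) xs)"
      unfolding xde(4)[OF b] by (simp add: fun_eq_iff)
    finally have "M.ev \<tau> ?x = M.ev \<phi> (d (f a))"
      by (rule boundary_relation[OF chains_diff[OF xde(1)[OF b] da] xde(2)[OF b] xde(3)[OF b]])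
    moreover have "M.ev \<tau> ?x = M.ev \<tau> (x (f a)) \<otimes>\<^bsub>M\<^esub> inv\<^bsub>M\<^esub> (M.ev \<tau> (delta [a]))"
      by (rule M.ev_diff[OF fx[OF b] chainsD(1)[OF da] vx[OF b] chainsD(2)[OF da] \<tau>_C])
    ultimately have *: "M.ev \<tau> (x (f a)) \<otimes>\<^bsub>M\<^esub> inv\<^bsub>M\<^esub> (\<tau> [a]) = M.ev \<phi> (d (f a))"
      using \<tau>_C by simp
    have "M.ev \<tau> (x (f a)) = M.ev \<phi> (d (f a)) \<otimes>\<^bsub>M\<^esub> \<tau> [a]"
      by (rule M.inv_solve_right[OF X(2)[OF b] X(1)[OF b] \<tau>_C, THEN iffD1, OF *[symmetric]])
    then show ?thesis
      using X[OF b] \<tau>_C[of "[a]"] by (simp add: t_def M.m_ac)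
  qed
  have t_mult: "t b \<otimes>\<^bsub>M\<^esub> t c = \<phi> [b, c] \<otimes>\<^bsub>M\<^esub> t (b \<otimes>\<^bsub>B\<^esub> c)" if bc: "b \<in> carrier B" "c \<in> carrier B" for b c
  proof -
    have p: "b \<otimes>\<^bsub>B\<^esub> c \<in> carrier B" using bc by simp
    let ?p = "b \<otimes>\<^bsub>B\<^esub> c"
    let ?x = "\<lambda>xs. (x b xs + x c xs) - x ?p xs"
    \<comment> \<open>The simplex \<open>[b, c]\<close> has boundary
      \<open>[c] - [?p] + [b]\<close>, just what remains of the three equations for
      \<open>push f\<close>.\<close>
    let ?d = "\<lambda>xs. ((d b xs + d c xs) - d ?p xs) + delta [b, c] xs"
    let ?e = "\<lambda>xs. (e b xs + e c xs) - e ?p xs"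
    have dbc: "delta [b, c] \<in> chains R 2 B" using bc by (intro chains_delta) auto
    note xs = chains_add[OF xde(1)[OF bc(1)] xde(1)[OF bc(2)]]
    note ds = chains_add[OF xde(2)[OF bc(1)] xde(2)[OF bc(2)]]
    note ds' = chains_diff[OF ds xde(2)[OF p]]
    have x': "?x \<in> chains R 1 A" by (rule chains_diff[OF xs xde(1)[OF p]])
    have d': "?d \<in> chains R 2 B" by (rule chains_add[OF ds' dbc])
    have e': "?e \<in> ideal_chains R 1 B"
      by (rule ideal_chains_diff[OF ideal_chains_add[OF xde(3)[OF bc(1)] xde(3)[OF bc(2)]] xde(3)[OF p]])
    have 1: "push f ?x = (\<lambda>xs. (push f (x b) xs + push f (x c) xs) - push f (x ?p) xs)"
      by (simp only: push_diff[OF chainsD(1)[OF xs] fx[OF p]] push_add[OF fx[OF bc(1)] fx[OF bc(2)]])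
    have 2: "bd B ?d = (\<lambda>xs. ((bd B (d b) xs + bd B (d c) xs) - bd B (d ?p) xs)
        + (delta [c] xs - delta [?p] xs + delta [b] xs))"
      by (simp only: bd_add[OF chainsD(1)[OF ds'] chainsD(1)[OF dbc]] bd_diff[OF chainsD(1)[OF ds] fd[OF p]]
          bd_add[OF fd[OF bc(1)] fd[OF bc(2)]] bd_delta bd_basis_2)
    have "push f ?x = (\<lambda>xs. bd B ?d xs + ?e xs)"
      unfolding 1 2 xde(4)[OF bc(1)] xde(4)[OF bc(2)] xde(4)[OF p] by (simp add: fun_eq_iff)
    then have ev: "M.ev \<tau> ?x = M.ev \<phi> ?d" by (rule boundary_relation[OF x' d' e'])
    have ev1: "M.ev \<tau> ?x = M.ev \<tau> (x b) \<otimes>\<^bsub>M\<^esub> M.ev \<tau> (x c) \<otimes>\<^bsub>M\<^esub> inv\<^bsub>M\<^esub> M.ev \<tau> (x ?p)"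
      by (simp only: M.ev_diff[OF chainsD(1)[OF xs] fx[OF p] chainsD(2)[OF xs] vx[OF p] \<tau>_C]
          M.ev_add[OF fx[OF bc(1)] fx[OF bc(2)] vx[OF bc(1)] vx[OF bc(2)] \<tau>_C])
    have ev2: "M.ev \<phi> ?d = M.ev \<phi> (d b) \<otimes>\<^bsub>M\<^esub> M.ev \<phi> (d c) \<otimes>\<^bsub>M\<^esub> inv\<^bsub>M\<^esub> M.ev \<phi> (d ?p) \<otimes>\<^bsub>M\<^esub> \<phi> [b, c]"
      by (simp only: M.ev_add[OF chainsD(1)[OF ds'] chainsD(1)[OF dbc] chainsD(2)[OF ds'] chainsD(2)[OF dbc] \<psi>_C]
          M.ev_diff[OF chainsD(1)[OF ds] fd[OF p] chainsD(2)[OF ds] vd[OF p] \<psi>_C]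
          M.ev_add[OF fd[OF bc(1)] fd[OF bc(2)] vd[OF bc(1)] vd[OF bc(2)] \<psi>_C] M.ev_delta[where \<phi> = \<phi>, OF \<psi>_C])
    have rearrange: "(a1 \<otimes>\<^bsub>M\<^esub> inv\<^bsub>M\<^esub> b1) \<otimes>\<^bsub>M\<^esub> (a2 \<otimes>\<^bsub>M\<^esub> inv\<^bsub>M\<^esub> b2) = k \<otimes>\<^bsub>M\<^esub> (a3 \<otimes>\<^bsub>M\<^esub> inv\<^bsub>M\<^esub> b3)"
      if eq: "a1 \<otimes>\<^bsub>M\<^esub> a2 \<otimes>\<^bsub>M\<^esub> inv\<^bsub>M\<^esub> a3 = b1 \<otimes>\<^bsub>M\<^esub> b2 \<otimes>\<^bsub>M\<^esub> inv\<^bsub>M\<^esub> b3 \<otimes>\<^bsub>M\<^esub> k"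
        and cl: "a1 \<in> carrier M" "a2 \<in> carrier M" "a3 \<in> carrier M"
          "b1 \<in> carrier M" "b2 \<in> carrier M" "b3 \<in> carrier M" "k \<in> carrier M" for a1 a2 a3 b1 b2 b3 k
    proof -
      have "a1 \<otimes>\<^bsub>M\<^esub> a2 = (b1 \<otimes>\<^bsub>M\<^esub> b2 \<otimes>\<^bsub>M\<^esub> inv\<^bsub>M\<^esub> b3 \<otimes>\<^bsub>M\<^esub> k) \<otimes>\<^bsub>M\<^esub> a3"
        unfolding eq[symmetric] using cl by (simp add: M.m_assoc)
      then have "(a1 \<otimes>\<^bsub>M\<^esub> a2) \<otimes>\<^bsub>M\<^esub> (inv\<^bsub>M\<^esub> b1 \<otimes>\<^bsub>M\<^esub> inv\<^bsub>M\<^esub> b2) =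
        (b1 \<otimes>\<^bsub>M\<^esub> inv\<^bsub>M\<^esub> b1) \<otimes>\<^bsub>M\<^esub> ((b2 \<otimes>\<^bsub>M\<^esub> inv\<^bsub>M\<^esub> b2) \<otimes>\<^bsub>M\<^esub> (k \<otimes>\<^bsub>M\<^esub> (a3 \<otimes>\<^bsub>M\<^esub> inv\<^bsub>M\<^esub> b3)))"
        using cl by (simp add: M.m_ac del: M.r_inv M.l_inv M.Units_r_inv M.Units_l_inv)
      then show ?thesis using cl by (simp add: M.m_ac)
    qed
    show ?thesis unfolding t_def
      by (rule rearrange[OF _ X(1)[OF bc(1)] X(1)[OF bc(2)] X(1)[OF p] X(2)[OF bc(1)] X(2)[OF bc(2)] X(2)[OF p] \<psi>_C])
        (use ev ev1 ev2 in simp)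
  qed
  show ?thesis
  proof (intro exI conjI ballI)
    show "t b \<in> C" if "b \<in> carrier B" for b using tM[OF that] by (simp add: M_carrier)
    show "t (f a) = \<tau> [a]" if "a \<in> carrier A" for a using that by (rule t_f)
    show "t b \<otimes>\<^bsub>E\<^esub> t c = \<phi> [b, c] \<otimes>\<^bsub>E\<^esub> t (b \<otimes>\<^bsub>B\<^esub> c)" if "b \<in> carrier B" "c \<in> carrier B" for b c
      using t_mult[OF that] by (simp add: M_mult)
  qed
qed

text \<open>Dividing \<open>s\<close> by the potential \<open>t\<close> absorbs the cocycle and
  leaves a homomorphism. Along \<open>f\<close> the divisor is \<open>\<tau>\<close>, so the
  quotient is \<open>u\<close>.\<close>

theorem lift_exists:
  "\<exists>v\<in>hom B E. (\<forall>b\<in>carrier B. v b \<otimes>\<^bsub>E\<^esub> inv\<^bsub>E\<^esub> (s (proj b)) \<in> C) \<and> (\<forall>a\<in>carrier A. v (f a) = u a)"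
proof -
  obtain t where tC: "\<And>b. b \<in> carrier B \<Longrightarrow> t b \<in> C" and tf: "\<And>a. a \<in> carrier A \<Longrightarrow> t (f a) = \<tau> [a]"
    and t_mult: "\<And>b c. b \<in> carrier B \<Longrightarrow> c \<in> carrier B \<Longrightarrow> t b \<otimes>\<^bsub>E\<^esub> t c = \<phi> [b, c] \<otimes>\<^bsub>E\<^esub> t (b \<otimes>\<^bsub>B\<^esub> c)"
    using potential_exists by metis
  note tE = C_sub[OF tC]
  have iC: "inv\<^bsub>E\<^esub> c \<in> C" if "c \<in> C" for c using subgroup.m_inv_closed[OF C that] .
  have sp: "s (proj b) \<in> carrier E" if "b \<in> carrier B" for b using s[OF proj_closed[OF that]] .
  have pC: "\<psi> xs \<in> C" for xs using \<psi>_C by (simp add: M_carrier)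
  define v where "v b = inv\<^bsub>E\<^esub> (t b) \<otimes>\<^bsub>E\<^esub> s (proj b)" for b
  have vE: "v b \<in> carrier E" if "b \<in> carrier B" for b using tE[OF that] sp[OF that] by (simp add: v_def)
  have v_s: "t b \<otimes>\<^bsub>E\<^esub> v b = s (proj b)" if "b \<in> carrier B" for b
    using tE[OF that] sp[OF that] by (simp add: v_def E.m_assoc[symmetric])
  have hom: "v (b \<otimes>\<^bsub>B\<^esub> c) = v b \<otimes>\<^bsub>E\<^esub> v c" if bc: "b \<in> carrier B" "c \<in> carrier B" for b c
  proof -
    have p: "b \<otimes>\<^bsub>B\<^esub> c \<in> carrier B" using bc by simp
    note cl = tE[OF bc(1)] tE[OF bc(2)] tE[OF p] vE[OF bc(1)] vE[OF bc(2)] vE[OF p] C_sub[OF pC]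
    have "t b \<otimes>\<^bsub>E\<^esub> t c \<otimes>\<^bsub>E\<^esub> (v b \<otimes>\<^bsub>E\<^esub> v c) = t b \<otimes>\<^bsub>E\<^esub> (t c \<otimes>\<^bsub>E\<^esub> v b) \<otimes>\<^bsub>E\<^esub> v c"
      using cl by (simp add: E.m_assoc)
    also have "\<dots> = t b \<otimes>\<^bsub>E\<^esub> (v b \<otimes>\<^bsub>E\<^esub> t c) \<otimes>\<^bsub>E\<^esub> v c"
      using central[OF tC[OF bc(2)] vE[OF bc(1)]] by simp
    also have "\<dots> = s (proj b) \<otimes>\<^bsub>E\<^esub> s (proj c)"
      unfolding v_s[OF bc(1), symmetric] v_s[OF bc(2), symmetric] using cl by (simp add: E.m_assoc)
    also have "\<dots> = \<phi> [b, c] \<otimes>\<^bsub>E\<^esub> s (proj (b \<otimes>\<^bsub>B\<^esub> c))"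
      using \<psi>_eq[OF proj_closed[OF bc(1)] proj_closed[OF bc(2)]] proj_mult[OF bc] by simp
    also have "\<dots> = t b \<otimes>\<^bsub>E\<^esub> t c \<otimes>\<^bsub>E\<^esub> v (b \<otimes>\<^bsub>B\<^esub> c)"
      unfolding v_s[OF p, symmetric] t_mult[OF bc] using cl by (simp add: E.m_assoc)
    finally show ?thesis using cl by (simp add: E.m_assoc)
  qed
  show ?thesis
  proof (intro bexI conjI ballI)
    show "v \<in> hom B E" using vE hom by (auto simp: hom_def)
    show "v b \<otimes>\<^bsub>E\<^esub> inv\<^bsub>E\<^esub> (s (proj b)) \<in> C" if b: "b \<in> carrier B" for b
      using iC[OF tC[OF b]] tE[OF b] sp[OF b] by (simp add: v_def E.m_assoc)
    show "v (f a) = u a" if a: "a \<in> carrier A" for a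
    proof -
      have "t (f a) \<otimes>\<^bsub>E\<^esub> v (f a) = t (f a) \<otimes>\<^bsub>E\<^esub> u a"
        using v_s[OF f_closed[OF a]] \<tau>_eq[OF a] tf[OF a] by simp
      then show ?thesis using tE[OF f_closed[OF a]] vE[OF f_closed[OF a]] u_closed[OF a] by simp
    qed
  qed
qed

end

section \<open>Cosets\<close>

lemma (in group) cancel_left:
  assumes "x \<in> carrier G" "y \<in> carrier G"
  shows "inv x \<otimes> (x \<otimes> y) = y" "x \<otimes> (inv x \<otimes> y) = y"
  using assms by (simp_all add: m_assoc[symmetric])

context normal
begin

lemma rcos_eq_iff:
  assumes "x \<in> carrier G" "y \<in> carrier G"
  shows "H #> x = H #> y \<longleftrightarrow> x \<otimes> inv y \<in> H"
proof
  assume "H #> x = H #> y"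
  then show "x \<otimes> inv y \<in> H"
    using coset_mult_inv2[OF _ assms subset] coset_join1[OF _ _ subgroup_axioms] assms by simp
next
  assume "x \<otimes> inv y \<in> H"
  then show "H #> x = H #> y"
    using coset_mult_inv1[OF _ assms subset] coset_join2[OF _ subgroup_axioms] assms by simp
qed

lemma rcos_self_iff: "x \<in> carrier G \<Longrightarrow> H #> x = H \<longleftrightarrow> x \<in> H"
  using coset_join1[OF _ _ subgroup_axioms] coset_join2[OF _ subgroup_axioms] by blast

lemma rcos_mult: "x \<in> carrier G \<Longrightarrow> y \<in> carrier G \<Longrightarrow> (H #> x) \<otimes>\<^bsub>G Mod H\<^esub> (H #> y) = H #> (x \<otimes> y)"
  by (simp add: rcos_sum)

lemma rcos_in_Mod: "x \<in> carrier G \<Longrightarrow> H #> x \<in> carrier (G Mod H)"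
  by (simp add: carrier_FactGroup)

lemma inv_rcos: "x \<in> carrier G \<Longrightarrow> inv\<^bsub>G Mod H\<^esub> (H #> x) = H #> inv x"
  by (simp add: inv_FactGroup rcos_in_Mod rcos_inv)

lemma Mod_cases:
  assumes "X' \<in> carrier (G Mod H)"
  obtains x where "x \<in> carrier G" "X' = H #> x"
  using assms by (auto simp: carrier_FactGroup)

lemma nat_pow_rcos: "x \<in> carrier G \<Longrightarrow> (H #> x) [^]\<^bsub>G Mod H\<^esub> (k::nat) = H #> (x [^] k)"
  by (simp add: FactGroup_pow rcos_in_Mod)

lemma subgroup_image_Mod: "subgroup K G \<Longrightarrow> subgroup ((#>) H ` K) (G Mod H)"
  by (rule group_hom.subgroup_img_is_subgroup)
    (auto simp: group_hom_def group_hom_axioms_def factorgroup_is_group r_coset_hom_Mod)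

end

section \<open>The R-lower central series\<close>

lemma (in group) commutators_carrier:
  "H \<subseteq> carrier G \<Longrightarrow> K \<subseteq> carrier G \<Longrightarrow> commutators G H K \<subseteq> carrier G"
  unfolding commutators_def by (blast intro: m_closed inv_closed)

lemma Rlcs_ZZ: "Rlcs ZZ G n = lcs G n"
  by (induction n) auto

text \<open>Each step of the series adds only what the closure properties of \<open>D\<close> force
  into the next term. With \<open>D\<close> a preimage of a series in another group, this transports
  membership along homomorphisms. The bound \<open>m\<close> allows for series whose factors are
  controlled only up to some index.\<close>

lemma (in group) Rlcs_least:
  assumes D1: "D (Suc 0) = carrier G"
    and Dsub: "\<And>j. 1 \<le> j \<Longrightarrow> j \<le> m \<Longrightarrow> subgroup (D j) G"
    and Dcomm: "\<And>j x y. 1 \<le> j \<Longrightarrow> j < m \<Longrightarrow> x \<in> carrier G \<Longrightarrow> y \<in> D j \<Longrightarrow> x \<otimes> y \<otimes> inv x \<otimes> inv y \<in> D (Suc j)"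
    and DQ: "\<And>j x k. R = QQ \<Longrightarrow> 1 \<le> j \<Longrightarrow> j < m \<Longrightarrow> x \<in> carrier G \<Longrightarrow> 0 < (k::nat) \<Longrightarrow> x [^] k \<in> D (Suc j) \<Longrightarrow> x \<in> D (Suc j)"
    and DP: "\<And>j x p. R = ZZp p \<Longrightarrow> 1 \<le> j \<Longrightarrow> j < m \<Longrightarrow> x \<in> D j \<Longrightarrow> x [^] p \<in> D (Suc j)"
    and j: "1 \<le> j" "j \<le> m"
  shows "Rlcs R G j \<subseteq> D j"
  using j
proof (induction j)
  case (Suc j)
  show ?case
  proof (cases "j = 0")
    case False
    then have j: "1 \<le> j" "j < m" using Suc.prems by auto
    have IH: "Rlcs R G j \<subseteq> D j" using Suc.IH j by simp
    have sub: "subgroup (D (Suc j)) G" using Dsub j by simp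
    have Dj: "D j \<subseteq> carrier G" using Dsub[of j] j subgroup.subset by auto
    have c1: "generate G (commutators G (carrier G) (Rlcs R G j)) \<subseteq> D (Suc j)"
      by (rule generate_subgroup_incl[OF _ sub]) (use IH Dcomm j in \<open>auto simp: commutators_def\<close>)
    show ?thesis
    proof (cases R)
      case ZZ then show ?thesis using c1 False by simp
    next
      case QQ then show ?thesis using c1 False DQ[OF QQ j] by auto
    next
      case (ZZp p)
      have "y \<otimes> x \<otimes> inv y \<otimes> inv x \<in> D (Suc j)" if "y \<in> Rlcs R G j" "x \<in> carrier G" for x y
      proof -
        have y: "y \<in> D j" "y \<in> carrier G" using IH Dj that by auto
        have "inv (x \<otimes> y \<otimes> inv x \<otimes> inv y) \<in> D (Suc j)"
          using subgroup.m_inv_closed[OF sub Dcomm[OF j that(2) y(1)]] .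
        then show ?thesis using that y by (simp add: inv_mult_group m_assoc)
      qed
      then have "generate G ({x [^] p | x. x \<in> Rlcs R G j} \<union> commutators G (Rlcs R G j) (carrier G)) \<subseteq> D (Suc j)"
        by (intro generate_subgroup_incl[OF _ sub]) (use IH DP[OF ZZp j] in \<open>auto simp: commutators_def\<close>)
      then show ?thesis using False ZZp by simp
    qed
  qed (simp add: D1)
qed simp

lemma (in group) normal_generate_commutators:
  assumes "K \<lhd> G"
  shows "generate G (commutators G (carrier G) K) \<lhd> G"
proof (rule normal_generateI)
  have K: "K \<subseteq> carrier G" using normal_imp_subgroup[OF assms] subgroup.subset by blast
  then show "commutators G (carrier G) K \<subseteq> carrier G" by (simp add: commutators_carrier)
  fix h g assume h: "h \<in> commutators G (carrier G) K" and g: "g \<in> carrier G"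
  then obtain x k where hx: "h = x \<otimes> k \<otimes> inv x \<otimes> inv k" "x \<in> carrier G" "k \<in> K"
    by (auto simp: commutators_def)
  have k: "k \<in> carrier G" using K hx by blast
  let ?x = "g \<otimes> x \<otimes> inv g" and ?k = "g \<otimes> k \<otimes> inv g"
  have "g \<otimes> h \<otimes> inv g = ?x \<otimes> ?k \<otimes> inv ?x \<otimes> inv ?k"
    using hx k g by (simp add: inv_mult_group m_assoc cancel_left)
  moreover have "?k \<in> K" using normal.inv_op_closed2[OF assms g hx(3)] .
  moreover have "?x \<in> carrier G" using g hx by simp
  ultimately show "g \<otimes> h \<otimes> inv g \<in> commutators G (carrier G) K"
    unfolding commutators_def by blast
qed

context group
begin

lemma conj_nat_pow:
  assumes "g \<in> carrier G" "x \<in> carrier G"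
  shows "(g \<otimes> x \<otimes> inv g) [^] (k::nat) = g \<otimes> x [^] k \<otimes> inv g"
  by (induction k) (use assms in \<open>simp_all add: m_assoc cancel_left\<close>)

lemma commutator_in_normal:
  assumes "K \<lhd> G" "x \<in> carrier G" "y \<in> K"
  shows "x \<otimes> y \<otimes> inv x \<otimes> inv y \<in> K"
proof -
  have sub: "subgroup K G" using assms(1) by (rule normal_imp_subgroup)
  show ?thesis
    by (rule subgroup.m_closed[OF sub normal.inv_op_closed2[OF assms] subgroup.m_inv_closed[OF sub assms(3)]])
qed

lemma commutator_flip:
  assumes "x \<in> carrier G" "y \<in> carrier G"
  shows "inv (x \<otimes> y \<otimes> inv x \<otimes> inv y) = y \<otimes> x \<otimes> inv y \<otimes> inv x"
  using assms by (simp add: inv_mult_group m_assoc)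

lemma rcos_commute_iff:
  assumes "N \<lhd> G" "x \<in> carrier G" "y \<in> carrier G"
  shows "(N #> x) \<otimes>\<^bsub>G Mod N\<^esub> (N #> y) = (N #> y) \<otimes>\<^bsub>G Mod N\<^esub> (N #> x) \<longleftrightarrow>
    x \<otimes> y \<otimes> inv x \<otimes> inv y \<in> N"
proof -
  interpret N: normal N G by (rule assms(1))
  have "(N #> x) \<otimes>\<^bsub>G Mod N\<^esub> (N #> y) = (N #> y) \<otimes>\<^bsub>G Mod N\<^esub> (N #> x) \<longleftrightarrow> N #> (x \<otimes> y) = N #> (y \<otimes> x)"
    using assms by (simp only: N.rcos_mult)
  also have "\<dots> \<longleftrightarrow> x \<otimes> y \<otimes> inv x \<otimes> inv y \<in> N"
    using N.rcos_eq_iff[of "x \<otimes> y" "y \<otimes> x"] assms by (simp add: inv_mult_group m_assoc)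
  finally show ?thesis .
qed

lemma generate_powers_commutators_normal:
  assumes K: "K \<lhd> G"
  shows "generate G ({x [^] (p::nat) | x. x \<in> K} \<union> commutators G K (carrier G)) \<lhd> G"
proof (rule normal_generateI)
  have KG: "K \<subseteq> carrier G" using normal_imp_subgroup[OF K] subgroup.subset by blast
  then show "{x [^] p | x. x \<in> K} \<union> commutators G K (carrier G) \<subseteq> carrier G"
    using commutators_carrier[of K "carrier G"] by auto
  fix h g assume h: "h \<in> {x [^] p | x. x \<in> K} \<union> commutators G K (carrier G)" and g: "g \<in> carrier G"
  have conj: "g \<otimes> k \<otimes> inv g \<in> K" if "k \<in> K" for k
    using normal.inv_op_closed2[OF K g that] .
  from h consider x where "x \<in> K" "h = x [^] p"
    | k x where "k \<in> K" "x \<in> carrier G" "h = k \<otimes> x \<otimes> inv k \<otimes> inv x"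
    by (auto simp: commutators_def)
  then show "g \<otimes> h \<otimes> inv g \<in> {x [^] p | x. x \<in> K} \<union> commutators G K (carrier G)"
  proof cases
    case 1
    then have "g \<otimes> h \<otimes> inv g = (g \<otimes> x \<otimes> inv g) [^] p" using conj_nat_pow[OF g] KG by auto
    then show ?thesis using conj[OF 1(1)] by auto
  next
    case 2
    have k: "k \<in> carrier G" using KG 2 by blast
    have "g \<otimes> h \<otimes> inv g = (g \<otimes> k \<otimes> inv g) \<otimes> (g \<otimes> x \<otimes> inv g) \<otimes> inv (g \<otimes> k \<otimes> inv g) \<otimes> inv (g \<otimes> x \<otimes> inv g)"
      using 2 k g by (simp add: inv_mult_group m_assoc cancel_left)
    moreover have "g \<otimes> x \<otimes> inv g \<in> carrier G" using g 2 by simp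
    ultimately show ?thesis using conj[OF 2(1)] unfolding commutators_def by blast
  qed
qed

text \<open>The point is closure under products. By isolation of \<open>K\<close> the roots of
  elements of \<open>N\<close> lie in \<open>K\<close>, and \<open>K\<close> is central modulo
  \<open>N\<close>. So \<open>x\<close> and \<open>y\<close> commute modulo \<open>N\<close>, and
  the power \<open>k * l\<close> of their product splits.\<close>

lemma isolator_of_commutators_normal:
  assumes K: "K \<lhd> G" and iso: "\<And>x k. x \<in> carrier G \<Longrightarrow> 0 < (k::nat) \<Longrightarrow> x [^] k \<in> K \<Longrightarrow> x \<in> K"
  defines "N \<equiv> generate G (commutators G (carrier G) K)"
  shows "{x \<in> carrier G. \<exists>k::nat. k > 0 \<and> x [^] k \<in> N} \<lhd> G"
    and "{x \<in> carrier G. \<exists>k::nat. k > 0 \<and> x [^] k \<in> N} \<subseteq> K"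
proof -
  let ?I = "{x \<in> carrier G. \<exists>k::nat. k > 0 \<and> x [^] k \<in> N}"
  have N: "N \<lhd> G" unfolding N_def by (rule normal_generate_commutators[OF K])
  interpret N: normal N G by (rule N)
  interpret Q: group "G Mod N" by (rule N.factorgroup_is_group)
  have "commutators G (carrier G) K \<subseteq> K"
    unfolding commutators_def using commutator_in_normal[OF K] by blast
  then have NK: "N \<subseteq> K"
    unfolding N_def by (rule generate_subgroup_incl[OF _ normal_imp_subgroup[OF K]])
  then show IK: "?I \<subseteq> K" using iso by blast
  have comm: "y \<otimes> x \<otimes> inv y \<otimes> inv x \<in> N" if "x \<in> K" "y \<in> carrier G" for x y
    unfolding N_def by (rule generate.incl) (use that in \<open>auto simp: commutators_def\<close>)
  have "subgroup ?I G"
  proof (rule subgroupI)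
    have "\<one> [^] (1::nat) \<in> N" by simp
    then show "?I \<noteq> {}" using zero_less_one one_closed by blast
  next
    fix x assume "x \<in> ?I"
    then obtain k where k: "x \<in> carrier G" "0 < (k::nat)" "x [^] k \<in> N" by blast
    then have "inv x [^] k \<in> N" using nat_pow_inv by simp
    then show "inv x \<in> ?I" using k by auto
  next
    fix x y assume "x \<in> ?I" "y \<in> ?I"
    then obtain k l where k: "x \<in> carrier G" "0 < (k::nat)" "x [^] k \<in> N"
      and l: "y \<in> carrier G" "0 < (l::nat)" "y [^] l \<in> N" by blast
    have xK: "x \<in> K" using IK \<open>x \<in> ?I\<close> by blast
    have c: "(N #> y) \<otimes>\<^bsub>G Mod N\<^esub> (N #> x) = (N #> x) \<otimes>\<^bsub>G Mod N\<^esub> (N #> y)"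
      using rcos_commute_iff[OF N l(1) k(1)] comm[OF xK l(1)] by simp
    have "N #> (x \<otimes> y) [^] (k * l) = (N #> (x \<otimes> y)) [^]\<^bsub>G Mod N\<^esub> (k * l)"
      using k l by (simp add: N.nat_pow_rcos)
    also have "N #> (x \<otimes> y) = (N #> x) \<otimes>\<^bsub>G Mod N\<^esub> (N #> y)" using k l by (simp only: N.rcos_mult)
    also have "\<dots> [^]\<^bsub>G Mod N\<^esub> (k * l) = (N #> x) [^]\<^bsub>G Mod N\<^esub> (k * l) \<otimes>\<^bsub>G Mod N\<^esub> (N #> y) [^]\<^bsub>G Mod N\<^esub> (k * l)"
      by (rule Q.pow_mult_distrib[OF c[symmetric]]) (use k l N.rcos_in_Mod in auto)
    also have "(N #> x) [^]\<^bsub>G Mod N\<^esub> (k * l) = \<one>\<^bsub>G Mod N\<^esub>"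
    proof -
      have "x [^] (k * l) \<in> N" using k subgroup.m_closed[OF N.subgroup_axioms]
        by (metis N.subgroup_axioms group_l_invI int_pow_int nat_pow_pow subgroup_int_pow_closed)
      then show ?thesis using k N.nat_pow_rcos N.rcos_self_iff by simp
    qed
    also have "(N #> y) [^]\<^bsub>G Mod N\<^esub> (k * l) = \<one>\<^bsub>G Mod N\<^esub>"
    proof -
      have "y [^] (l * k) \<in> N" using l
        by (metis N.subgroup_axioms int_pow_int nat_pow_pow subgroup_int_pow_closed)
      then show ?thesis using l N.nat_pow_rcos N.rcos_self_iff by (simp add: mult.commute)
    qed
    also have "\<one>\<^bsub>G Mod N\<^esub> \<otimes>\<^bsub>G Mod N\<^esub> \<one>\<^bsub>G Mod N\<^esub> = N" using Q.l_one[OF Q.one_closed] by simp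
    finally have "(x \<otimes> y) [^] (k * l) \<in> N" using N.rcos_self_iff k l by simp
    moreover have "0 < k * l" using k l by simp
    ultimately show "x \<otimes> y \<in> ?I" using m_closed[OF k(1) l(1)] by blast
  qed auto
  then show "?I \<lhd> G"
  proof (rule normal_invI)
    fix g x assume g: "g \<in> carrier G" and x: "x \<in> ?I"
    then obtain k where k: "x \<in> carrier G" "0 < (k::nat)" "x [^] k \<in> N" by blast
    have "(g \<otimes> x \<otimes> inv g) [^] k \<in> N"
      using conj_nat_pow[OF g k(1)] N.inv_op_closed2[OF g k(3)] by simp
    then show "g \<otimes> x \<otimes> inv g \<in> ?I" using g k by auto
  qed
qed

text \<open>The properties are proved together because over Q the normality of a term rests on the
  isolation of the one before it.\<close>

lemma Rlcs_normal_isolated: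
  "Rlcs R G i \<lhd> G \<and> Rlcs R G (Suc i) \<lhd> G \<and> Rlcs R G (Suc i) \<subseteq> Rlcs R G i \<and>
   (R = QQ \<longrightarrow> (\<forall>x\<in>carrier G. \<forall>k::nat. 0 < k \<longrightarrow> x [^] k \<in> Rlcs R G i \<longrightarrow> x \<in> Rlcs R G i))"
proof (induction i)
  case 0 show ?case using normal_self by simp
next
  case (Suc i)
  let ?K = "Rlcs R G (Suc i)"
  have K: "?K \<lhd> G" using Suc by blast
  have subK: "subgroup ?K G" using K by (rule normal_imp_subgroup)
  have KG: "?K \<subseteq> carrier G" using subK subgroup.subset by blast
  show ?case
  proof (cases R)
    case ZZ
    have "commutators G (carrier G) ?K \<subseteq> ?K"
      unfolding commutators_def using commutator_in_normal[OF K] by blast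
    then have "generate G (commutators G (carrier G) ?K) \<subseteq> ?K"
      by (rule generate_subgroup_incl[OF _ subK])
    then show ?thesis using K normal_generate_commutators[OF K] ZZ by simp
  next
    case QQ
    have iso: "x \<in> ?K" if x: "x \<in> carrier G" and k: "0 < (k::nat)" and xk: "x [^] k \<in> ?K" for x k
    proof (cases "i = 0")
      case False
      obtain l where l: "0 < (l::nat)" "(x [^] k) [^] l \<in> generate G (commutators G (carrier G) (Rlcs QQ G i))"
        using xk False QQ by auto
      then have "0 < k * l \<and> x [^] (k * l) \<in> generate G (commutators G (carrier G) (Rlcs QQ G i))"
        using k x by (simp add: nat_pow_pow)
      then have "\<exists>m::nat. 0 < m \<and> x [^] m \<in> generate G (commutators G (carrier G) (Rlcs QQ G i))" by blast
      then show ?thesis using x False QQ by simp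
    qed (use x in simp)
    note I = isolator_of_commutators_normal[OF K iso]
    have "Rlcs R G (Suc (Suc i)) = {x \<in> carrier G. \<exists>k::nat. k > 0 \<and>
        x [^] k \<in> generate G (commutators G (carrier G) ?K)}"
      using QQ by simp
    then show ?thesis using K I iso by (simp only:) blast
  next
    case (ZZp p)
    let ?S = "{x [^] p | x. x \<in> ?K} \<union> commutators G ?K (carrier G)"
    have "?S \<subseteq> ?K"
    proof -
      have "x [^] p \<in> ?K" if "x \<in> ?K" for x
        using subgroup_int_pow_closed[OF subK that, of "int p"] by (simp add: int_pow_int)
      moreover have "y \<otimes> x \<otimes> inv y \<otimes> inv x \<in> ?K" if "y \<in> ?K" "x \<in> carrier G" for x y
        using commutator_flip[of x y] subgroup.m_inv_closed[OF subK commutator_in_normal[OF K that(2,1)]] that KG by auto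
      ultimately show ?thesis unfolding commutators_def by blast
    qed
    then have "generate G ?S \<subseteq> ?K" by (rule generate_subgroup_incl[OF _ subK])
    then show ?thesis using K generate_powers_commutators_normal[OF K, of p] ZZp by simp
  qed
qed

lemma Rlcs_normal: "Rlcs R G i \<lhd> G"
  and Rlcs_decr: "Rlcs R G (Suc i) \<subseteq> Rlcs R G i"
  using Rlcs_normal_isolated by blast+

lemma Rlcs_isolated: "x \<in> carrier G \<Longrightarrow> 0 < (k::nat) \<Longrightarrow> x [^] k \<in> Rlcs QQ G i \<Longrightarrow> x \<in> Rlcs QQ G i"
  using Rlcs_normal_isolated by blast

lemma Rlcs_sub: "subgroup (Rlcs R G i) G"
  using Rlcs_normal normal_imp_subgroup by blast

lemma Rlcs_carrier: "x \<in> Rlcs R G i \<Longrightarrow> x \<in> carrier G"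
  using subgroup.subset[OF Rlcs_sub] by blast

lemma Rlcs_antimono: "i \<le> j \<Longrightarrow> Rlcs R G j \<subseteq> Rlcs R G i"
  by (rule lift_Suc_antimono_le[of "Rlcs R G", OF Rlcs_decr])

lemma Rlcs_comm:
  assumes i: "1 \<le> i" and x: "x \<in> carrier G" and y: "y \<in> Rlcs R G i"
  shows "x \<otimes> y \<otimes> inv x \<otimes> inv y \<in> Rlcs R G (Suc i)"
proof -
  have c: "x \<otimes> y \<otimes> inv x \<otimes> inv y \<in> commutators G (carrier G) (Rlcs R G i)"
    using x y by (auto simp: commutators_def)
  have yG: "y \<in> carrier G" using y Rlcs_carrier by blast
  show ?thesis
  proof (cases R)
    case ZZ then show ?thesis using i generate.incl[OF c] by simp
  next
    case QQ
    have "(x \<otimes> y \<otimes> inv x \<otimes> inv y) [^] (1::nat) \<in> generate G (commutators G (carrier G) (Rlcs R G i))"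
      using generate.incl[OF c] x yG by simp
    then show ?thesis using i QQ x yG by (auto simp del: One_nat_def)
  next
    case (ZZp p)
    let ?S = "{x [^] p | x. x \<in> Rlcs R G i} \<union> commutators G (Rlcs R G i) (carrier G)"
    \<comment> \<open>The generators for \<open>ZZp\<close> are commutators with the entries in the
      other order, hence the passage to the inverse.\<close>
    have "y \<otimes> x \<otimes> inv y \<otimes> inv x \<in> ?S" using x y by (auto simp: commutators_def)
    moreover have "?S \<subseteq> carrier G" using commutators_carrier[of "Rlcs R G i" "carrier G"] Rlcs_carrier by auto
    ultimately have "inv (y \<otimes> x \<otimes> inv y \<otimes> inv x) \<in> generate G ?S"
      by (intro generate_m_inv_closed generate.incl)
    then show ?thesis using i ZZp commutator_flip[OF yG x] by simp
  qed
qed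

end

lemma (in group) lcs_normal: "lcs G n \<lhd> G"
  using Rlcs_normal[of ZZ n] by (simp add: Rlcs_ZZ)

lemma (in group) quotient_comm_group:
  assumes N: "N \<lhd> G" and K: "subgroup K G"
    and comm: "\<And>x y. x \<in> K \<Longrightarrow> y \<in> K \<Longrightarrow> x \<otimes> y \<otimes> inv x \<otimes> inv y \<in> N"
  shows "comm_group ((G Mod N)\<lparr>carrier := (#>) N ` K\<rparr>)"
proof -
  interpret N: normal N G by (rule N)
  interpret Q: group "G Mod N" by (rule N.factorgroup_is_group)
  define M where "M = (G Mod N)\<lparr>carrier := (#>) N ` K\<rparr>"
  interpret M: group M unfolding M_def by (rule Q.subgroup_imp_group[OF N.subgroup_image_Mod[OF K]])
  have "comm_group M"
  proof (rule M.group_comm_groupI)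
    fix x y assume "x \<in> carrier M" "y \<in> carrier M"
    then obtain a b where ab: "a \<in> K" "b \<in> K" "x = N #> a" "y = N #> b" by (auto simp: M_def)
    then show "x \<otimes>\<^bsub>M\<^esub> y = y \<otimes>\<^bsub>M\<^esub> x"
      using rcos_commute_iff[OF N subgroup.mem_carrier[OF K ab(1)] subgroup.mem_carrier[OF K ab(2)]] comm[OF ab(1,2)]
      by (simp add: M_def)
  qed
  then show ?thesis by (simp add: M_def)
qed

section \<open>Lifting to a central series\<close>

text \<open>The target of the lifting: a central series whose first \<open>n\<close> factors admit
  \<open>R\<close>-module structures. Their existence is enough, since the lifts are made one layer
  at a time, each with its own scalar multiplication.\<close>

locale R_series = group E for E (structure) +
  fixes R :: coeff and n :: nat and F :: "nat \<Rightarrow> 'a set"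
  assumes F_normal: "F i \<lhd> E"
    and F_1: "F (Suc 0) = carrier E"
    and F_decr: "F (Suc i) \<subseteq> F i"
    and F_comm: "1 \<le> i \<Longrightarrow> x \<in> carrier E \<Longrightarrow> y \<in> F i \<Longrightarrow> x \<otimes> y \<otimes> inv x \<otimes> inv y \<in> F (Suc i)"
    and F_module: "1 \<le> i \<Longrightarrow> i \<le> n \<Longrightarrow>
      \<exists>sm. coeff_module ((E Mod (F (Suc i)))\<lparr>carrier := (#>) (F (Suc i)) ` F i\<rparr>) R sm"
begin

lemma F_sub: "subgroup (F i) E"
  using F_normal normal_imp_subgroup by blast

lemma F_carrier: "x \<in> F i \<Longrightarrow> x \<in> carrier E"
  using subgroup.subset[OF F_sub] by blast

lemma F_antimono: "i \<le> j \<Longrightarrow> F j \<subseteq> F i"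
  by (rule lift_Suc_antimono_le[of F, OF F_decr])

text \<open>In the factor, a rational vector space, the class of \<open>z\<close> is recovered from
  its multiple by \<open>k\<close> through the scalar \<open>1 / k\<close>.\<close>

lemma F_root:
  assumes R: "R = QQ" and i: "1 \<le> i" "i \<le> n" and z: "z \<in> F i" and k: "0 < (k::nat)" and zk: "z [^] k \<in> F (Suc i)"
  shows "z \<in> F (Suc i)"
proof -
  obtain sm where sm: "coeff_module ((E Mod (F (Suc i)))\<lparr>carrier := (#>) (F (Suc i)) ` F i\<rparr>) R sm"
    using F_module[OF i] by blast
  define M where "M = (E Mod (F (Suc i)))\<lparr>carrier := (#>) (F (Suc i)) ` F i\<rparr>"
  interpret N: normal "F (Suc i)" E by (rule F_normal)
  interpret M: coeff_module M R sm unfolding M_def by (rule sm)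
  let ?z = "F (Suc i) #> z"
  have zM: "?z \<in> carrier M" using z by (simp add: M_def)
  have zc: "z \<in> carrier E" using z F_carrier by blast
  have "sm (of_nat m) ?z = F (Suc i) #> z [^] m" for m
    using M.sm_of_nat[OF zM] N.nat_pow_rcos[OF zc] group.is_monoid[OF N.factorgroup_is_group]
    by (simp add: M_def monoid.nat_pow_consistent[symmetric])
  then have "sm (of_nat k) ?z = \<one>\<^bsub>M\<^esub>"
    using zk zc N.rcos_self_iff by (simp add: M_def)
  moreover have "sm (1 / of_nat k) (sm (of_nat k) ?z) = sm (1 / of_nat k * of_nat k) ?z"
    using M.sm_times_int[of "1 / of_nat k" ?z "int k"] zM R by (simp add: coeff_vals_def)
  ultimately have "?z = \<one>\<^bsub>M\<^esub>"
    using k zM R M.sm_unit[of "1 / of_nat k"] by (simp add: coeff_vals_def)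
  then show ?thesis using N.rcos_self_iff zc by (simp add: M_def)
qed

lemma F_pow_p:
  assumes R: "R = ZZp p" and i: "1 \<le> i" "i \<le> n" and z: "z \<in> F i"
  shows "z [^] p \<in> F (Suc i)"
proof -
  obtain sm where sm: "coeff_module ((E Mod (F (Suc i)))\<lparr>carrier := (#>) (F (Suc i)) ` F i\<rparr>) R sm"
    using F_module[OF i] by blast
  define M where "M = (E Mod (F (Suc i)))\<lparr>carrier := (#>) (F (Suc i)) ` F i\<rparr>"
  interpret N: normal "F (Suc i)" E by (rule F_normal)
  interpret M: coeff_module M R sm unfolding M_def by (rule sm)
  let ?z = "F (Suc i) #> z"
  have zM: "?z \<in> carrier M" using z by (simp add: M_def)
  have zc: "z \<in> carrier E" using z F_carrier by blast
  have "sm (of_nat m) ?z = F (Suc i) #> z [^] m" for m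
    using M.sm_of_nat[OF zM] N.nat_pow_rcos[OF zc] group.is_monoid[OF N.factorgroup_is_group]
    by (simp add: M_def monoid.nat_pow_consistent[symmetric])
  moreover have "(of_nat p :: rat) \<in> coeff_ideal R"
    using R by (auto simp: coeff_ideal_def intro!: exI[of _ 1])
  ultimately have "F (Suc i) #> z [^] p = \<one>\<^bsub>M\<^esub>"
    using M.sm_ideal[of "of_nat p" ?z] zM by simp
  then show ?thesis using N.rcos_self_iff[of "z [^] p"] zc by (simp add: M_def)
qed

text \<open>The preimages under \<open>h\<close> of the images of \<open>F j\<close> satisfy the
  closure conditions of \<open>Rlcs_least\<close>. The case \<open>R' = ZZ\<close> shows that a lift
  kills \<open>lcs B n\<close>, the case \<open>R' = R\<close> gives the final conclusion.\<close>

lemma hom_Rlcs: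
  assumes B: "group B" and h: "h \<in> hom B (E Mod (F (Suc i)))" and i: "i \<le> n"
    and R': "R' = ZZ \<or> R' = R" and j: "1 \<le> j" "j \<le> Suc i" and b: "b \<in> Rlcs R' B j"
  shows "\<exists>x\<in>F j. h b = F (Suc i) #> x"
proof -
  interpret B: group B by (rule B)
  interpret N: normal "F (Suc i)" E by (rule F_normal)
  interpret Q: group "E Mod (F (Suc i))" by (rule N.factorgroup_is_group)
  interpret h: group_hom B "E Mod (F (Suc i))" h using h by unfold_locales
  define D where "D j = {b \<in> carrier B. h b \<in> (#>) (F (Suc i)) ` F j}" for j
  have hB: "\<exists>x\<in>carrier E. h b = F (Suc i) #> x" if "b \<in> carrier B" for b
    using h.hom_closed[OF that] by (auto simp: carrier_FactGroup)
  have D_root: "x \<in> D (Suc l)"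
    if R'Q: "R' = QQ" and l: "1 \<le> l" "l < Suc i" and x: "x \<in> carrier B" and k: "0 < (k::nat)" and xk: "x [^]\<^bsub>B\<^esub> k \<in> D (Suc l)" for l x k
  proof -
    obtain z where z: "z \<in> carrier E" "h x = F (Suc i) #> z" using hB[OF x] by blast
    obtain y where y: "y \<in> F (Suc l)" "h (x [^]\<^bsub>B\<^esub> k) = F (Suc i) #> y" using xk by (auto simp: D_def)
    have yE: "y \<in> carrier E" using y F_carrier by blast
    have "F (Suc i) #> z [^] k = F (Suc i) #> y"
      using y(2) z x by (simp add: h.hom_nat_pow N.nat_pow_rcos)
    then have "z [^] k \<otimes> inv y \<in> F (Suc i)" using N.rcos_eq_iff z yE by simp
    then have "z [^] k \<otimes> inv y \<in> F (Suc l)" using F_antimono[of "Suc l" "Suc i"] l by auto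
    then have "z [^] k \<otimes> inv y \<otimes> y \<in> F (Suc l)" using subgroup.m_closed[OF F_sub] y(1) by blast
    then have zk: "z [^] k \<in> F (Suc l)" using z yE by (simp add: m_assoc)
    \<comment> \<open>\<open>F_root\<close> applies within a single factor, so \<open>z\<close> is
      pushed down from the whole group one factor at a time.\<close>
    have "z \<in> F (Suc m)" if "m \<le> l" for m
      using that
    proof (induction m)
      case 0 then show ?case using z F_1 by simp
    next
      case (Suc m)
      then show ?case
        using F_root[of "Suc m" z k] F_antimono[of "Suc (Suc m)" "Suc l"] R'Q R' k zk l i by auto
    qed
    then show ?thesis using z x by (auto simp: D_def)
  qed
  have "Rlcs R' B j \<subseteq> D j"
  proof (rule B.Rlcs_least[where m = "Suc i"])
    show "D (Suc 0) = carrier B" using hB by (auto simp: D_def F_1)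
    show "subgroup (D l) B" for l
    proof -
      have img: "subgroup ((#>) (F (Suc i)) ` F l) (E Mod (F (Suc i)))"
        by (rule N.subgroup_image_Mod[OF F_sub])
      show ?thesis
        by (rule B.subgroupI)
          (use subgroup.one_closed[OF img] subgroup.m_inv_closed[OF img] subgroup.m_closed[OF img] h.hom_one h.hom_inv h.hom_mult
            in \<open>auto simp: D_def simp del: mult_FactGroup one_FactGroup\<close>)
    qed
    show "x \<otimes>\<^bsub>B\<^esub> y \<otimes>\<^bsub>B\<^esub> inv\<^bsub>B\<^esub> x \<otimes>\<^bsub>B\<^esub> inv\<^bsub>B\<^esub> y \<in> D (Suc l)"
      if l: "1 \<le> l" "l < Suc i" and x: "x \<in> carrier B" and y: "y \<in> D l" for l x y
    proof -
      obtain x' where x': "x' \<in> carrier E" "h x = F (Suc i) #> x'" using hB[OF x] by blast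
      obtain y' where y': "y' \<in> F l" "h y = F (Suc i) #> y'" and yB: "y \<in> carrier B" using y by (auto simp: D_def)
      have yE: "y' \<in> carrier E" using y' F_carrier by blast
      have "h (x \<otimes>\<^bsub>B\<^esub> y \<otimes>\<^bsub>B\<^esub> inv\<^bsub>B\<^esub> x \<otimes>\<^bsub>B\<^esub> inv\<^bsub>B\<^esub> y) = F (Suc i) #> (x' \<otimes> y' \<otimes> inv x' \<otimes> inv y')"
        using x yB x' y' yE by (simp add: N.inv_rcos N.rcos_sum)
      then show ?thesis using F_comm[OF l(1) x'(1) y'(1)] x yB by (auto simp: D_def)
    qed
    show "x \<in> D (Suc l)"
      if "R' = QQ" "1 \<le> l" "l < Suc i" "x \<in> carrier B" "0 < k" "x [^]\<^bsub>B\<^esub> (k::nat) \<in> D (Suc l)" for l x k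
      using D_root[OF that] .
    show "x [^]\<^bsub>B\<^esub> p \<in> D (Suc l)" if p: "R' = ZZp p" and l: "1 \<le> l" "l < Suc i" and x: "x \<in> D l" for l x p
    proof -
      obtain x' where x': "x' \<in> F l" "h x = F (Suc i) #> x'" and xB: "x \<in> carrier B" using x by (auto simp: D_def)
      have "h (x [^]\<^bsub>B\<^esub> p) = F (Suc i) #> x' [^] p"
        using xB x' F_carrier by (simp add: h.hom_nat_pow N.nat_pow_rcos)
      then show ?thesis using F_pow_p[of p l x'] p R' l x' xB i by (auto simp: D_def)
    qed
  qed (use j in auto)
  then show ?thesis using b by (auto simp: D_def)
qed

end

locale series_lifting = R_series E R n F + A: group A + B: group B
  for E :: "('e, 'z) monoid_scheme" (structure) and R n F
    and A :: "('a, 'x) monoid_scheme" and B :: "('b, 'y) monoid_scheme" +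
  fixes f :: "'a \<Rightarrow> 'b" and u :: "'a \<Rightarrow> 'e"
  assumes Dw: "Dwyer R n A B f" and u: "u \<in> hom A E"
begin

lemma f_closed: "a \<in> carrier A \<Longrightarrow> f a \<in> carrier B" using Dw by (auto simp: Dwyer_def hom_def)
lemma u_closed: "a \<in> carrier A \<Longrightarrow> u a \<in> carrier E" using u by (auto simp: hom_def)

text \<open>Because \<open>i \<le> n\<close>, the homomorphism \<open>h\<close> sends
  \<open>lcs B n\<close> into the trivial class and factors through the quotient. What remains is a
  lifting problem for the central extension by \<open>F i\<close> modulo
  \<open>F (Suc i)\<close>.\<close>

lemma lift_step:
  assumes i: "1 \<le> i" "i \<le> n" and h: "h \<in> hom B (E Mod (F i))"
    and hf: "\<And>a. a \<in> carrier A \<Longrightarrow> h (f a) = F i #> u a"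
  shows "\<exists>h'\<in>hom B (E Mod (F (Suc i))). \<forall>a\<in>carrier A. h' (f a) = F (Suc i) #> u a"
proof -
  let ?N = "F (Suc i)"
  let ?Q = "B Mod (lcs B n)"
  interpret N: normal ?N E by (rule F_normal)
  interpret L: normal "F i" E by (rule F_normal)
  interpret K: normal "lcs B n" B by (rule B.lcs_normal)
  interpret EN: group "E Mod ?N" by (rule N.factorgroup_is_group)
  interpret EL: group "E Mod (F i)" by (rule L.factorgroup_is_group)
  interpret Q: group ?Q by (rule K.factorgroup_is_group)
  interpret h: group_hom B "E Mod (F i)" h using h by unfold_locales
  obtain sm where sm: "coeff_module ((E Mod ?N)\<lparr>carrier := (#>) ?N ` F i\<rparr>) R sm"
    using F_module[OF i] by blast
  have hK: "h k = F i" if "k \<in> lcs B n" for k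
  proof -
    obtain i' where i': "i = Suc i'" using i by (cases i) auto
    have "lcs B n \<subseteq> lcs B i"
      using B.Rlcs_antimono[OF i(2), of ZZ] by (simp only: Rlcs_ZZ)
    then have "k \<in> Rlcs ZZ B i" using that by (auto simp: Rlcs_ZZ)
    then obtain x where "x \<in> F i" "h k = F i #> x"
      using hom_Rlcs[OF B.is_group, of h i' ZZ i k] h i i' by auto
    then show ?thesis using L.rcos_self_iff F_carrier by simp
  qed
  have hcos: "h b = h b'" if b: "b \<in> carrier B" and b': "b' \<in> lcs B n #>\<^bsub>B\<^esub> b" for b b'
  proof -
    obtain k where k: "k \<in> lcs B n" "b' = k \<otimes>\<^bsub>B\<^esub> b" using b' by (auto simp: r_coset_def)
    have kB: "k \<in> carrier B" using k K.subset by blast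
    have "h b' = h k \<otimes>\<^bsub>E Mod (F i)\<^esub> h b" using k kB b by (simp del: mult_FactGroup)
    also have "h k = \<one>\<^bsub>E Mod (F i)\<^esub>" using hK k by simp
    finally show ?thesis using h.hom_closed[OF b] by (simp only: EL.l_one)
  qed
  \<comment> \<open>The representative is chosen per coset of \<open>lcs B n\<close>, not per
    element of \<open>B\<close>, as the lifting problem requires.\<close>
  have "\<exists>x. x \<in> carrier E \<and> (\<forall>b\<in>carrier B. U = lcs B n #>\<^bsub>B\<^esub> b \<longrightarrow> F i #> x = h b)" if U: "U \<in> carrier ?Q" for U
  proof -
    obtain b where b: "b \<in> carrier B" "U = lcs B n #>\<^bsub>B\<^esub> b" using U by (rule K.Mod_cases)
    obtain x where x: "x \<in> carrier E" "h b = F i #> x"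
      using h.hom_closed[OF b(1)] by (rule L.Mod_cases)
    have "F i #> x = h b'" if "b' \<in> carrier B" "U = lcs B n #>\<^bsub>B\<^esub> b'" for b'
      using hcos[OF b(1), of b'] that b B.rcos_self[OF that(1) K.subgroup_axioms] x by simp
    then show ?thesis using x by blast
  qed
  then obtain \<sigma> where \<sigma>: "\<And>U. U \<in> carrier ?Q \<Longrightarrow> \<sigma> U \<in> carrier E"
    "\<And>b. b \<in> carrier B \<Longrightarrow> F i #> \<sigma> (lcs B n #>\<^bsub>B\<^esub> b) = h b"
    using K.rcos_in_Mod by metis
  define s where "s U = ?N #> \<sigma> U" for U
  define u' where "u' a = ?N #> u a" for a
  let ?C = "(#>) ?N ` F i"
  interpret P: lifting_problem A B "E Mod ?N" R n f u' ?C sm s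
  proof (intro lifting_problem.intro lifting_problem_axioms.intro)
    show "group A" "group B" "group (E Mod ?N)" by unfold_locales
    show "Dwyer R n A B f" by (rule Dw)
    show "u' \<in> hom A (E Mod ?N)"
      unfolding u'_def using Group.hom_compose[OF u N.r_coset_hom_Mod] by (simp add: comp_def)
    show "lcs B n \<lhd> B" by (rule B.lcs_normal)
    show "subgroup ?C (E Mod ?N)" by (rule N.subgroup_image_Mod[OF F_sub])
    show "c \<otimes>\<^bsub>E Mod ?N\<^esub> e = e \<otimes>\<^bsub>E Mod ?N\<^esub> c" if c: "c \<in> ?C" and e: "e \<in> carrier (E Mod ?N)" for c e
    proof -
      obtain x where x: "x \<in> F i" "c = ?N #> x" using c by blast
      obtain y where y: "y \<in> carrier E" "e = ?N #> y" using e by (rule N.Mod_cases)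
      have xE: "x \<in> carrier E" using x F_carrier by blast
      have "(y \<otimes> x) \<otimes> inv (x \<otimes> y) \<in> ?N"
        using F_comm[OF i(1) y(1) x(1)] y(1) xE by (simp add: inv_mult_group m_assoc)
      then have "?N #> (y \<otimes> x) = ?N #> (x \<otimes> y)" using N.rcos_eq_iff[of "y \<otimes> x" "x \<otimes> y"] xE y by simp
      then show ?thesis using x y xE by (simp add: N.rcos_sum)
    qed
    show "coeff_module ((E Mod ?N)\<lparr>carrier := ?C\<rparr>) R sm" by (rule sm)
    show sE: "s U \<in> carrier (E Mod ?N)" if "U \<in> carrier ?Q" for U
      using \<sigma>(1)[OF that] N.rcos_in_Mod by (simp add: s_def)
    show "s U \<otimes>\<^bsub>E Mod ?N\<^esub> s V \<otimes>\<^bsub>E Mod ?N\<^esub> inv\<^bsub>E Mod ?N\<^esub> s (U \<otimes>\<^bsub>?Q\<^esub> V) \<in> ?C"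
      if U: "U \<in> carrier ?Q" and V: "V \<in> carrier ?Q" for U V
    proof -
      obtain b where b: "b \<in> carrier B" "U = lcs B n #>\<^bsub>B\<^esub> b" using U by (rule K.Mod_cases)
      obtain c where c: "c \<in> carrier B" "V = lcs B n #>\<^bsub>B\<^esub> c" using V by (rule K.Mod_cases)
      have UV: "U \<otimes>\<^bsub>?Q\<^esub> V = lcs B n #>\<^bsub>B\<^esub> (b \<otimes>\<^bsub>B\<^esub> c)" using b c K.rcos_mult by simp
      note \<sigma>E = \<sigma>(1)[OF U] \<sigma>(1)[OF V] \<sigma>(1)[OF Q.m_closed[OF U V]]
      have "F i #> (\<sigma> U \<otimes> \<sigma> V) = F i #> \<sigma> (U \<otimes>\<^bsub>?Q\<^esub> V)"
        using \<sigma>(2)[OF b(1)] \<sigma>(2)[OF c(1)] \<sigma>(2)[OF B.m_closed[OF b(1) c(1)]] h.hom_mult[OF b(1) c(1)]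
          L.rcos_sum[OF \<sigma>E(1,2)] unfolding UV unfolding b(2) c(2) by simp
      then have "\<sigma> U \<otimes> \<sigma> V \<otimes> inv (\<sigma> (U \<otimes>\<^bsub>?Q\<^esub> V)) \<in> F i"
        using L.rcos_eq_iff \<sigma>E by (simp del: mult_FactGroup)
      moreover have "s U \<otimes>\<^bsub>E Mod ?N\<^esub> s V \<otimes>\<^bsub>E Mod ?N\<^esub> inv\<^bsub>E Mod ?N\<^esub> s (U \<otimes>\<^bsub>?Q\<^esub> V)
         = ?N #> (\<sigma> U \<otimes> \<sigma> V \<otimes> inv (\<sigma> (U \<otimes>\<^bsub>?Q\<^esub> V)))"
        unfolding s_def using \<sigma>E by (simp only: N.inv_rcos N.rcos_mult m_closed inv_closed)
      ultimately show ?thesis by blast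
    qed
    show "s (lcs B n #>\<^bsub>B\<^esub> f a) \<otimes>\<^bsub>E Mod ?N\<^esub> inv\<^bsub>E Mod ?N\<^esub> u' a \<in> ?C" if a: "a \<in> carrier A" for a
    proof -
      note b = f_closed[OF a]
      note \<sigma>E = \<sigma>(1)[OF K.rcos_in_Mod[OF b]]
      have "F i #> \<sigma> (lcs B n #>\<^bsub>B\<^esub> f a) = F i #> u a" using \<sigma>(2)[OF b] hf[OF a] by simp
      then have "\<sigma> (lcs B n #>\<^bsub>B\<^esub> f a) \<otimes> inv (u a) \<in> F i" using L.rcos_eq_iff \<sigma>E u_closed[OF a] by simp
      moreover have "s (lcs B n #>\<^bsub>B\<^esub> f a) \<otimes>\<^bsub>E Mod ?N\<^esub> inv\<^bsub>E Mod ?N\<^esub> u' a = ?N #> (\<sigma> (lcs B n #>\<^bsub>B\<^esub> f a) \<otimes> inv (u a))"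
        unfolding s_def u'_def using \<sigma>E u_closed[OF a] by (simp only: N.inv_rcos N.rcos_mult m_closed inv_closed)
      ultimately show ?thesis by blast
    qed
  qed
  show ?thesis using P.lift_exists by (auto simp: u'_def)
qed

lemma lift_all:
  "i \<le> n \<Longrightarrow> \<exists>h\<in>hom B (E Mod (F (Suc i))). \<forall>a\<in>carrier A. h (f a) = F (Suc i) #> u a"
proof (induction i)
  case 0
  interpret N: normal "F (Suc 0)" E by (rule F_normal)
  interpret EN: group "E Mod (F (Suc 0))" by (rule N.factorgroup_is_group)
  have "(\<lambda>_. \<one>\<^bsub>E Mod (F (Suc 0))\<^esub>) \<in> hom B (E Mod (F (Suc 0)))"
    by (rule homI) (use EN.one_closed EN.l_one in \<open>simp_all only:\<close>)
  moreover have "F (Suc 0) #> u a = F (Suc 0)" if "a \<in> carrier A" for a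
    using N.rcos_self_iff u_closed[OF that] F_1 by simp
  ultimately show ?case by auto
next
  case (Suc i)
  then show ?case using lift_step[of "Suc i"] by auto
qed

text \<open>The lift of \<open>u\<close> modulo \<open>F (Suc n)\<close> sends \<open>f a\<close> to
  the class of \<open>u a\<close>. It sends the \<open>Suc n\<close>-th term of the series of
  \<open>B\<close> to the trivial class.\<close>

theorem Rlcs_reflected:
  assumes a: "a \<in> carrier A" and fa: "f a \<in> Rlcs R B (Suc n)"
  shows "u a \<in> F (Suc n)"
proof -
  interpret N: normal "F (Suc n)" E by (rule F_normal)
  obtain h where h: "h \<in> hom B (E Mod (F (Suc n)))" "h (f a) = F (Suc n) #> u a"
    using lift_all[of n] a by auto
  obtain x where "x \<in> F (Suc n)" "h (f a) = F (Suc n) #> x"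
    using hom_Rlcs[OF B.is_group h(1) _ _ _ _ fa] by auto
  then show ?thesis using h(2) N.rcos_self_iff u_closed[OF a] F_carrier by metis
qed

end

section \<open>Integral and mod p coefficients: a group as its own target\<close>

lemma (in comm_group) int_coeff_module:
  assumes "R \<noteq> QQ" "\<And>p x. R = ZZp p \<Longrightarrow> x \<in> carrier G \<Longrightarrow> x [^] p = \<one>"
  shows "coeff_module G R (\<lambda>q x. x [^] \<lfloor>q\<rfloor>)"
proof
  \<comment> \<open>Apart from \<open>QQ\<close> all coefficient values are integers, so the floor
    only changes the type and rounds nothing.\<close>
  have vals: "\<exists>k. q = of_int k" if "q \<in> coeff_vals R" for q
    using that assms(1) by (auto simp: coeff_vals_def Ints_def split: coeff.splits)
  fix q r x y
  assume x: "x \<in> carrier G"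
  show "x [^] \<lfloor>q\<rfloor> \<in> carrier G" for q :: rat using x by simp
  show "x [^] \<lfloor>q + r\<rfloor> = x [^] \<lfloor>q\<rfloor> \<otimes> x [^] \<lfloor>r\<rfloor>" if "q \<in> coeff_vals R" "r \<in> coeff_vals R" for q r
    using vals[OF that(1)] vals[OF that(2)] x by (auto simp: int_pow_mult simp flip: of_int_add)
  show "(x \<otimes> y) [^] \<lfloor>q\<rfloor> = x [^] \<lfloor>q\<rfloor> \<otimes> y [^] \<lfloor>q\<rfloor>" if "y \<in> carrier G" for q :: rat and y
    using x that by (rule int_pow_distrib)
  show "x [^] \<lfloor>1::rat\<rfloor> = x" using x by simp
  show "x [^] \<lfloor>q\<rfloor> = \<one>" if "q \<in> coeff_ideal R" for q
  proof (cases R)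
    case (ZZp p)
    then obtain k where "q = of_int (int p * k)" using \<open>q \<in> coeff_ideal R\<close> by (auto simp: coeff_ideal_def)
    then have "\<lfloor>q\<rfloor> = int p * k" by (metis floor_of_int)
    moreover have "x [^] (int p * k) = (x [^] int p) [^] k" using x by (simp add: int_pow_pow)
    ultimately show ?thesis using assms(2)[OF ZZp x] by (simp add: int_pow_int)
  qed (use assms(1) that in \<open>auto simp: coeff_ideal_def\<close>)
qed

lemma (in group) Rlcs_series:
  assumes R: "R \<noteq> QQ"
  shows "R_series G R n (Rlcs R G)"
proof (intro R_series.intro R_series_axioms.intro)
  show "group G" by (rule is_group)
  show "Rlcs R G i \<lhd> G" "Rlcs R G (Suc i) \<subseteq> Rlcs R G i" for i by (rule Rlcs_normal, rule Rlcs_decr)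
  show "Rlcs R G (Suc 0) = carrier G" by simp
  show "x \<otimes> y \<otimes> inv x \<otimes> inv y \<in> Rlcs R G (Suc i)" if "1 \<le> i" "x \<in> carrier G" "y \<in> Rlcs R G i" for i x y
    using that by (rule Rlcs_comm)
  fix i :: nat assume i: "1 \<le> i"
  let ?N = "Rlcs R G (Suc i)" and ?F = "Rlcs R G i"
  interpret N: normal ?N G by (rule Rlcs_normal)
  interpret Q: group "G Mod ?N" by (rule N.factorgroup_is_group)
  define M where "M = (G Mod ?N)\<lparr>carrier := (#>) ?N ` ?F\<rparr>"
  have sub: "subgroup ((#>) ?N ` ?F) (G Mod ?N)" by (rule N.subgroup_image_Mod[OF Rlcs_sub])
  interpret M: comm_group M
    unfolding M_def
    by (rule quotient_comm_group[OF Rlcs_normal Rlcs_sub]) (rule Rlcs_comm[OF i Rlcs_carrier])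
  have "x [^]\<^bsub>M\<^esub> p = \<one>\<^bsub>M\<^esub>" if p: "R = ZZp p" and x: "x \<in> carrier M" for p x
  proof -
    obtain a where a: "a \<in> ?F" "x = ?N #> a" using x by (auto simp: M_def)
    have "a [^] p \<in> ?N" using a i p by (auto intro: generate.incl)
    then show ?thesis
      using a Rlcs_carrier[OF a(1)] N.nat_pow_rcos[of a p] N.rcos_self_iff[of "a [^] p"] Q.is_monoid
      by (simp add: M_def monoid.nat_pow_consistent[symmetric])
  qed
  then show "\<exists>sm. coeff_module ((G Mod ?N)\<lparr>carrier := (#>) ?N ` ?F\<rparr>) R sm"
    using M.int_coeff_module[OF R] unfolding M_def by blast
qed

section \<open>The rational lower central series is an N-series\<close>

context group
begin

lemma mult_commutes:
  assumes "x \<in> carrier G" "z \<in> carrier G" "y \<in> carrier G" "x \<otimes> y = y \<otimes> x" "z \<otimes> y = y \<otimes> z"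
  shows "x \<otimes> z \<otimes> y = y \<otimes> (x \<otimes> z)"
proof -
  have "x \<otimes> z \<otimes> y = x \<otimes> (y \<otimes> z)" using assms(1-3,5) by (simp add: m_assoc)
  also have "\<dots> = x \<otimes> y \<otimes> z" using assms(1-3) by (simp add: m_assoc)
  finally show ?thesis unfolding assms(4) using assms(1-3) by (simp add: m_assoc)
qed

lemma inv_commutes:
  assumes "x \<in> carrier G" "y \<in> carrier G" "x \<otimes> y = y \<otimes> x"
  shows "inv x \<otimes> y = y \<otimes> inv x"
proof -
  have "inv x \<otimes> y = inv x \<otimes> (y \<otimes> x) \<otimes> inv x" using assms(1,2) by (simp add: m_assoc)
  then show ?thesis unfolding assms(3)[symmetric] using assms(1,2) by (simp add: cancel_left)
qed

text \<open>Conjugation by \<open>y\<close> turns \<open>a\<close> into \<open>a \<otimes> c\<close>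
  and \<open>b\<close> into \<open>d \<otimes> b\<close>. Since \<open>d\<close> is central and
  \<open>c\<close> commutes with \<open>b\<close>, the commutator of \<open>a\<close> and
  \<open>b\<close> is unchanged. This takes the place of the three subgroups lemma.\<close>

lemma conj_commutator_eq:
  assumes cl: "a \<in> carrier G" "b \<in> carrier G" "y \<in> carrier G" "c \<in> carrier G" "d \<in> carrier G"
    and ya: "y \<otimes> a = a \<otimes> c \<otimes> y" and yb: "y \<otimes> b = d \<otimes> b \<otimes> y"
    and d: "\<And>g. g \<in> carrier G \<Longrightarrow> d \<otimes> g = g \<otimes> d" and cb: "c \<otimes> b = b \<otimes> c"
  shows "a \<otimes> b \<otimes> inv a \<otimes> inv b \<otimes> y = y \<otimes> (a \<otimes> b \<otimes> inv a \<otimes> inv b)"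
proof -
  have "y \<otimes> (a \<otimes> b) = a \<otimes> (c \<otimes> (d \<otimes> b)) \<otimes> y"
  proof -
    have "y \<otimes> (a \<otimes> b) = a \<otimes> (c \<otimes> (y \<otimes> b))" using cl ya by (simp add: m_assoc[symmetric])
    then show ?thesis unfolding yb using cl by (simp add: m_assoc)
  qed
  also have "c \<otimes> (d \<otimes> b) = d \<otimes> b \<otimes> c"
    using cl cb d[of c] by (metis m_assoc)
  finally have 1: "y \<otimes> (a \<otimes> b) = d \<otimes> (a \<otimes> b) \<otimes> (c \<otimes> y)"
    using cl d[of a] by (metis m_assoc m_closed)
  have 2: "y \<otimes> (b \<otimes> a) = d \<otimes> (b \<otimes> a) \<otimes> (c \<otimes> y)"
    using cl ya yb by (metis m_assoc m_closed)
  define k where "k = a \<otimes> b \<otimes> inv a \<otimes> inv b"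
  have k: "k \<in> carrier G" using cl by (simp add: k_def)
  have kba: "k \<otimes> (b \<otimes> a) = a \<otimes> b" using cl by (simp add: k_def m_assoc cancel_left)
  have "(y \<otimes> k) \<otimes> (b \<otimes> a) = d \<otimes> k \<otimes> (b \<otimes> a) \<otimes> (c \<otimes> y)"
    using 1 kba cl k by (simp add: m_assoc)
  also have "\<dots> = k \<otimes> (d \<otimes> (b \<otimes> a) \<otimes> (c \<otimes> y))" using d[OF k] cl k by (simp add: m_assoc)
  also have "\<dots> = (k \<otimes> y) \<otimes> (b \<otimes> a)" using 2 cl k by (simp add: m_assoc)
  finally have "y \<otimes> k = k \<otimes> y" using cl k by (simp del: m_assoc)
  then show ?thesis by (simp add: k_def)
qed

lemma central_commutator_pow:
  assumes cl: "x \<in> carrier G" "y \<in> carrier G" "e \<in> carrier G"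
    and e: "\<And>g. g \<in> carrier G \<Longrightarrow> e \<otimes> g = g \<otimes> e" and xy: "x \<otimes> y = e \<otimes> (y \<otimes> x)"
  shows "x [^] (k::nat) \<otimes> y = e [^] k \<otimes> (y \<otimes> x [^] k)"
proof (induction k)
  case (Suc k)
  have "x [^] Suc k \<otimes> y = x [^] k \<otimes> (e \<otimes> (y \<otimes> x))" using cl xy by (simp add: m_assoc)
  also have "\<dots> = e \<otimes> (x [^] k \<otimes> y) \<otimes> x" using cl e[of "x [^] k"] by (metis m_assoc m_closed nat_pow_closed)
  also have "\<dots> = e [^] Suc k \<otimes> (y \<otimes> x [^] Suc k)"
    unfolding Suc using cl e[of "e [^] k"] by (simp add: m_assoc[symmetric])
  finally show ?case .
qed (use cl in simp)

text \<open>Work modulo \<open>?K\<close>. By induction \<open>y\<close> commutes there with every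
  generating commutator of the ordinary step, hence with a power of \<open>x\<close>. The commutator
  of \<open>x\<close> and \<open>y\<close> is central there, so its \<open>k\<close>-th power is the
  commutator of the \<open>k\<close>-th power of \<open>x\<close> with \<open>y\<close> and is
  trivial. Isolation of \<open>?K\<close> removes the power.\<close>

theorem Rlcs_QQ_N_series:
  notes Rlcs.simps(2) [simp del] mult_FactGroup [simp del] one_FactGroup [simp del]
  assumes "1 \<le> i" "1 \<le> j" "x \<in> Rlcs QQ G i" "y \<in> Rlcs QQ G j"
  shows "x \<otimes> y \<otimes> inv x \<otimes> inv y \<in> Rlcs QQ G (i + j)"
  using assms
proof (induction i arbitrary: j x y)
  case (Suc i)
  show ?case
  proof (cases "i = 0")
    case True
    then show ?thesis using Rlcs_comm[OF Suc.prems(2) Rlcs_carrier[OF Suc.prems(3)] Suc.prems(4)] by simp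
  next
    case False
    then have i: "1 \<le> i" by simp
    let ?K = "Rlcs QQ G (Suc (i + j))"
    have KN: "?K \<lhd> G" by (rule Rlcs_normal)
    interpret K: normal ?K G by (rule KN)
    interpret Q: group "G Mod ?K" by (rule K.factorgroup_is_group)
    define \<pi> where "\<pi> g = ?K #> g" for g
    have \<pi>c: "\<pi> g \<in> carrier (G Mod ?K)" if "g \<in> carrier G" for g using K.rcos_in_Mod[OF that] by (simp add: \<pi>_def)
    have \<pi>m: "\<pi> (g \<otimes> h) = \<pi> g \<otimes>\<^bsub>G Mod ?K\<^esub> \<pi> h" if "g \<in> carrier G" "h \<in> carrier G" for g h
      unfolding \<pi>_def using that by (simp only: K.rcos_mult)
    have \<pi>i: "\<pi> (inv g) = inv\<^bsub>G Mod ?K\<^esub> \<pi> g" if "g \<in> carrier G" for g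
      unfolding \<pi>_def using that by (simp only: K.inv_rcos)
    have \<pi>p: "\<pi> (g [^] k) = \<pi> g [^]\<^bsub>G Mod ?K\<^esub> k" if "g \<in> carrier G" for g and k :: nat
      unfolding \<pi>_def using that by (simp only: K.nat_pow_rcos)
    have \<pi>_central: "\<pi> g \<otimes>\<^bsub>G Mod ?K\<^esub> h = h \<otimes>\<^bsub>G Mod ?K\<^esub> \<pi> g" if g: "g \<in> Rlcs QQ G (i + j)" and h: "h \<in> carrier (G Mod ?K)" for g h
    proof -
      obtain h' where h': "h' \<in> carrier G" "h = ?K #> h'" using h by (rule K.Mod_cases)
      have "h' \<otimes> g \<otimes> inv h' \<otimes> inv g \<in> ?K" using Rlcs_comm[of "i + j", OF _ h'(1) g] i by simp
      then show ?thesis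
        unfolding h'(2) \<pi>_def
        by (rule iffD2[OF rcos_commute_iff[OF KN h'(1) Rlcs_carrier[OF g]], symmetric])
    qed
    note y = Suc.prems(4)
    have yG: "y \<in> carrier G" using y Rlcs_carrier by blast
    have xG: "x \<in> carrier G" using Suc.prems(3) Rlcs_carrier by blast
    have xi: "x \<in> Rlcs QQ G i" using Suc.prems(3) Rlcs_decr by blast
    obtain k where k: "0 < (k::nat)" "x [^] k \<in> generate G (commutators G (carrier G) (Rlcs QQ G i))"
      using Suc.prems(3) False unfolding Rlcs.simps(2)[of QQ G i] by auto
    let ?Z = "{z \<in> carrier G. \<pi> z \<otimes>\<^bsub>G Mod ?K\<^esub> \<pi> y = \<pi> y \<otimes>\<^bsub>G Mod ?K\<^esub> \<pi> z}"
    have "subgroup ?Z G"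
    proof (rule subgroupI)
      show "?Z \<noteq> {}" using rcos_commute_iff[OF KN one_closed yG] yG K.one_closed one_closed
        by (auto simp: \<pi>_def intro!: exI[of _ \<one>])
      fix g assume g: "g \<in> ?Z"
      then have "inv\<^bsub>G Mod ?K\<^esub> \<pi> g \<otimes>\<^bsub>G Mod ?K\<^esub> \<pi> y = \<pi> y \<otimes>\<^bsub>G Mod ?K\<^esub> inv\<^bsub>G Mod ?K\<^esub> \<pi> g"
        by (intro Q.inv_commutes) (use \<pi>c yG in auto)
      then show "inv g \<in> ?Z" using g \<pi>i by simp
      fix h assume h: "h \<in> ?Z"
      have "\<pi> g \<otimes>\<^bsub>G Mod ?K\<^esub> \<pi> h \<otimes>\<^bsub>G Mod ?K\<^esub> \<pi> y = \<pi> y \<otimes>\<^bsub>G Mod ?K\<^esub> (\<pi> g \<otimes>\<^bsub>G Mod ?K\<^esub> \<pi> h)"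
        by (intro Q.mult_commutes) (use g h \<pi>c yG in auto)
      then show "g \<otimes> h \<in> ?Z" using g h \<pi>m by simp
    qed auto
    moreover have "commutators G (carrier G) (Rlcs QQ G i) \<subseteq> ?Z"
    proof
      fix z assume "z \<in> commutators G (carrier G) (Rlcs QQ G i)"
      then obtain a b where ab: "a \<in> carrier G" "b \<in> Rlcs QQ G i" "z = a \<otimes> b \<otimes> inv a \<otimes> inv b"
        by (auto simp: commutators_def)
      have bG: "b \<in> carrier G" using ab Rlcs_carrier by blast
      \<comment> \<open>\<open>?c\<close> has weight \<open>Suc j\<close>, so by induction it
        commutes with \<open>b\<close> modulo \<open>?K\<close>; \<open>?d\<close> has weight
        \<open>i + j\<close> and is central modulo \<open>?K\<close>.\<close>
      let ?c = "inv a \<otimes> y \<otimes> inv (inv a) \<otimes> inv y" and ?d = "y \<otimes> b \<otimes> inv y \<otimes> inv b"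
      have c: "?c \<in> Rlcs QQ G (Suc j)" using Rlcs_comm[OF Suc.prems(2) inv_closed[OF ab(1)] y] .
      have "b \<otimes> y \<otimes> inv b \<otimes> inv y \<in> Rlcs QQ G (i + j)" by (rule Suc.IH[OF i Suc.prems(2) ab(2) y])
      then have d: "?d \<in> Rlcs QQ G (i + j)"
        using commutator_flip[OF bG yG] subgroup.m_inv_closed[OF Rlcs_sub] by metis
      have "b \<otimes> ?c \<otimes> inv b \<otimes> inv ?c \<in> ?K" using Suc.IH[OF i _ ab(2) c] by simp
      then have "\<pi> b \<otimes>\<^bsub>G Mod ?K\<^esub> \<pi> ?c = \<pi> ?c \<otimes>\<^bsub>G Mod ?K\<^esub> \<pi> b"
        using rcos_commute_iff[OF KN bG, of ?c] Rlcs_carrier[OF c] by (simp add: \<pi>_def)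
      moreover have "\<pi> y \<otimes>\<^bsub>G Mod ?K\<^esub> \<pi> a = \<pi> a \<otimes>\<^bsub>G Mod ?K\<^esub> \<pi> ?c \<otimes>\<^bsub>G Mod ?K\<^esub> \<pi> y"
      proof -
        have "y \<otimes> a = a \<otimes> ?c \<otimes> y" using ab yG by (simp add: m_assoc cancel_left)
        then show ?thesis using \<pi>m ab(1) yG Rlcs_carrier[OF c] by (metis m_closed)
      qed
      moreover have "\<pi> y \<otimes>\<^bsub>G Mod ?K\<^esub> \<pi> b = \<pi> ?d \<otimes>\<^bsub>G Mod ?K\<^esub> \<pi> b \<otimes>\<^bsub>G Mod ?K\<^esub> \<pi> y"
      proof -
        have "y \<otimes> b = ?d \<otimes> b \<otimes> y" using bG yG by (simp add: m_assoc cancel_left)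
        then show ?thesis using \<pi>m bG yG Rlcs_carrier[OF d] by (metis m_closed)
      qed
      ultimately have "\<pi> a \<otimes>\<^bsub>G Mod ?K\<^esub> \<pi> b \<otimes>\<^bsub>G Mod ?K\<^esub> inv\<^bsub>G Mod ?K\<^esub> \<pi> a \<otimes>\<^bsub>G Mod ?K\<^esub> inv\<^bsub>G Mod ?K\<^esub> \<pi> b \<otimes>\<^bsub>G Mod ?K\<^esub> \<pi> y
          = \<pi> y \<otimes>\<^bsub>G Mod ?K\<^esub> (\<pi> a \<otimes>\<^bsub>G Mod ?K\<^esub> \<pi> b \<otimes>\<^bsub>G Mod ?K\<^esub> inv\<^bsub>G Mod ?K\<^esub> \<pi> a \<otimes>\<^bsub>G Mod ?K\<^esub> inv\<^bsub>G Mod ?K\<^esub> \<pi> b)"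
        using \<pi>_central[OF d] \<pi>c ab(1) bG yG Rlcs_carrier[OF c] Rlcs_carrier[OF d]
        by (intro Q.conj_commutator_eq[of "\<pi> a" "\<pi> b" "\<pi> y" "\<pi> ?c" "\<pi> ?d"]) simp_all
      then show "z \<in> ?Z" using ab bG by (simp add: \<pi>m \<pi>i)
    qed
    ultimately have "generate G (commutators G (carrier G) (Rlcs QQ G i)) \<subseteq> ?Z"
      by (intro generate_subgroup_incl)
    then have xk: "\<pi> (x [^] k) \<otimes>\<^bsub>G Mod ?K\<^esub> \<pi> y = \<pi> y \<otimes>\<^bsub>G Mod ?K\<^esub> \<pi> (x [^] k)" using k by blast
    let ?e = "x \<otimes> y \<otimes> inv x \<otimes> inv y"
    have e: "?e \<in> Rlcs QQ G (i + j)" by (rule Suc.IH[OF i Suc.prems(2) xi y])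
    have eG: "?e \<in> carrier G" using e Rlcs_carrier by blast
    have "x \<otimes> y = ?e \<otimes> (y \<otimes> x)" using xG yG by (simp add: m_assoc cancel_left)
    then have "\<pi> x \<otimes>\<^bsub>G Mod ?K\<^esub> \<pi> y = \<pi> ?e \<otimes>\<^bsub>G Mod ?K\<^esub> (\<pi> y \<otimes>\<^bsub>G Mod ?K\<^esub> \<pi> x)"
      using \<pi>m xG yG eG by (metis m_closed)
    then have "\<pi> x [^]\<^bsub>G Mod ?K\<^esub> k \<otimes>\<^bsub>G Mod ?K\<^esub> \<pi> y = \<pi> ?e [^]\<^bsub>G Mod ?K\<^esub> k \<otimes>\<^bsub>G Mod ?K\<^esub> (\<pi> y \<otimes>\<^bsub>G Mod ?K\<^esub> \<pi> x [^]\<^bsub>G Mod ?K\<^esub> k)"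
      by (intro Q.central_commutator_pow \<pi>c xG yG eG \<pi>_central[OF e])
    then have "\<pi> ?e [^]\<^bsub>G Mod ?K\<^esub> k \<otimes>\<^bsub>G Mod ?K\<^esub> (\<pi> y \<otimes>\<^bsub>G Mod ?K\<^esub> \<pi> x [^]\<^bsub>G Mod ?K\<^esub> k) = \<pi> y \<otimes>\<^bsub>G Mod ?K\<^esub> \<pi> x [^]\<^bsub>G Mod ?K\<^esub> k"
      using xk \<pi>p[OF xG, of k] by simp
    then have "\<pi> ?e [^]\<^bsub>G Mod ?K\<^esub> k = \<one>\<^bsub>G Mod ?K\<^esub>"
      using Q.right_cancel[of "\<pi> y \<otimes>\<^bsub>G Mod ?K\<^esub> \<pi> x [^]\<^bsub>G Mod ?K\<^esub> k" "\<pi> ?e [^]\<^bsub>G Mod ?K\<^esub> k" "\<one>\<^bsub>G Mod ?K\<^esub>"]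
        \<pi>c[OF xG] \<pi>c[OF yG] \<pi>c[OF eG] by simp
    then have "?K #> (?e [^] k) = ?K" using \<pi>p[OF eG, of k] by (simp add: \<pi>_def one_FactGroup)
    then have "?e [^] k \<in> ?K" using K.rcos_self_iff[OF nat_pow_closed[OF eG]] by blast
    then show ?thesis using Rlcs_isolated[OF eG k(1)] by simp
  qed
qed simp

end

section \<open>Weighted polynomial functions\<close>

text \<open>Total weight is measured with respect to a filtration \<open>F\<close>: a difference in the direction of an
  element of \<open>F v\<close> lowers the degree by \<open>v\<close>. The natural number \<open>k\<close> is the degree plus one, so that
  truncated subtraction makes functions of negative degree vanish.\<close>

context group
begin

function wpoly :: "'a set \<Rightarrow> (nat \<Rightarrow> 'a set) \<Rightarrow> nat \<Rightarrow> ('a \<Rightarrow> rat) \<Rightarrow> bool" where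
  "wpoly H F k p \<longleftrightarrow> (if k = 0 then \<forall>x\<in>H. p x = 0
     else \<forall>v\<in>{1..}. \<forall>g\<in>H \<inter> F v. wpoly H F (k - v) (\<lambda>x. p (x \<otimes> g) - p x))"
  by pat_completeness auto
termination by (relation "measure (\<lambda>(H, F, k, p). k)") auto

declare wpoly.simps [simp del]

lemma wpoly_0: "wpoly H F 0 p \<longleftrightarrow> (\<forall>x\<in>H. p x = 0)"
  by (subst wpoly.simps) simp

lemma wpoly_pos: "0 < k \<Longrightarrow> wpoly H F k p \<longleftrightarrow>
    (\<forall>v\<ge>1. \<forall>g\<in>H \<inter> F v. wpoly H F (k - v) (\<lambda>x. p (x \<otimes> g) - p x))"
  by (subst wpoly.simps) auto

lemma wpoly_cong:
  assumes H: "subgroup H G" and eq: "\<And>x. x \<in> H \<Longrightarrow> p x = q x"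
  shows "wpoly H F k p \<longleftrightarrow> wpoly H F k q"
  using eq
proof (induction k arbitrary: p q rule: less_induct)
  case (less k)
  show ?case
  proof (cases "k = 0")
    case False
    have "wpoly H F (k - v) (\<lambda>x. p (x \<otimes> g) - p x) \<longleftrightarrow> wpoly H F (k - v) (\<lambda>x. q (x \<otimes> g) - q x)"
      if "1 \<le> v" "g \<in> H \<inter> F v" for v g
      by (rule less.IH) (use that False less.prems subgroup.m_closed[OF H] in auto)
    then show ?thesis using False wpoly_pos[of k] by simp
  qed (use less.prems in \<open>simp add: wpoly_0\<close>)
qed

lemma wpoly_zero: "wpoly H F k (\<lambda>x. 0)"
proof (induction k rule: less_induct)
  case (less k)
  show ?case by (cases "k = 0") (use less in \<open>simp_all add: wpoly_0 wpoly_pos\<close>)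
qed

lemma wpoly_const: "0 < k \<Longrightarrow> wpoly H F k (\<lambda>x. c)"
  by (simp add: wpoly_pos wpoly_zero)

lemma wpoly_add:
  "wpoly H F k p \<Longrightarrow> wpoly H F k q \<Longrightarrow> wpoly H F k (\<lambda>x. p x + q x)"
proof (induction k arbitrary: p q rule: less_induct)
  case (less k)
  show ?case
  proof (cases "k = 0")
    case False
    have "wpoly H F (k - v) (\<lambda>x. p (x \<otimes> g) + q (x \<otimes> g) - (p x + q x))"
      if "1 \<le> v" "g \<in> H \<inter> F v" for v g
    proof -
      have "wpoly H F (k - v) (\<lambda>x. (p (x \<otimes> g) - p x) + (q (x \<otimes> g) - q x))"
        using less that False wpoly_pos[of k] by auto
      then show ?thesis by (simp add: algebra_simps)
    qed
    then show ?thesis using False wpoly_pos[of k] by simp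
  qed (use less.prems in \<open>simp add: wpoly_0\<close>)
qed

lemma wpoly_vanish:
  assumes "subgroup H G" "\<And>x. x \<in> H \<Longrightarrow> p x = 0"
  shows "wpoly H F k p"
  using wpoly_cong[OF assms(1), of p "\<lambda>x. 0"] assms(2) wpoly_zero by blast

lemma wpoly_mono:
  assumes H: "subgroup H G"
  shows "wpoly H F k p \<Longrightarrow> k \<le> l \<Longrightarrow> wpoly H F l p"
proof (induction l arbitrary: k p rule: less_induct)
  case (less l)
  consider "k = 0" | "0 < k" "0 < l" using less.prems by force
  then show ?case
  proof cases
    case 1
    then show ?thesis using wpoly_vanish[OF H] less.prems by (simp add: wpoly_0)
  next
    case 2
    have "wpoly H F (l - v) (\<lambda>x. p (x \<otimes> g) - p x)" if v: "1 \<le> v" "g \<in> H \<inter> F v" for v g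
      by (rule less.IH[of "l - v" "k - v"]) (use less.prems 2 v wpoly_pos[of k] in auto)
    then show ?thesis using 2 wpoly_pos[of l] by simp
  qed
qed

lemma wpoly_diff:
  assumes H: "subgroup H G" and p: "wpoly H F k p" and v: "1 \<le> v" "g \<in> H" "g \<in> F v"
  shows "wpoly H F (k - v) (\<lambda>x. p (x \<otimes> g) - p x)"
proof (cases "k = 0")
  case True
  then show ?thesis using p v wpoly_vanish[OF H] subgroup.m_closed[OF H] by (simp add: wpoly_0)
qed (use p v wpoly_pos[of k] in auto)

lemma wpoly_translate:
  assumes H: "subgroup H G" and p: "wpoly H F k p" and g: "g \<in> H" "g \<in> F (Suc 0)"
  shows "wpoly H F k (\<lambda>x. p (x \<otimes> g))"
proof -
  have "wpoly H F k (\<lambda>x. p (x \<otimes> g) - p x)"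
    by (rule wpoly_mono[OF H wpoly_diff[OF H p _ g]]) auto
  from wpoly_add[OF this p] show ?thesis by simp
qed

end

text \<open>Commutators add weights by \<open>F_N\<close>, and \<open>F_isolated\<close> makes the
  factors torsion-free. The first controls conjugation, the second produces infinite cyclic
  steps.\<close>

locale N_series = group G for G (structure) +
  fixes F :: "nat \<Rightarrow> 'a set"
  assumes F_sub: "subgroup (F i) G"
    and F_mono: "i \<le> j \<Longrightarrow> F j \<subseteq> F i"
    and F_1: "F (Suc 0) = carrier G"
    and F_N: "1 \<le> i \<Longrightarrow> 1 \<le> j \<Longrightarrow> x \<in> F i \<Longrightarrow> y \<in> F j \<Longrightarrow> x \<otimes> y \<otimes> inv x \<otimes> inv y \<in> F (i + j)"
    and F_isolated: "x \<in> carrier G \<Longrightarrow> 0 < (k::nat) \<Longrightarrow> x [^] k \<in> F i \<Longrightarrow> x \<in> F i"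
begin

section \<open>Composition with an endomorphism that is the identity up to weight w\<close>

context
  fixes N :: "'a set" and \<alpha> :: "'a \<Rightarrow> 'a" and w :: nat
  assumes N: "subgroup N G"
    and \<alpha>_closed: "\<And>x. x \<in> N \<Longrightarrow> \<alpha> x \<in> N"
    and \<alpha>_mult: "\<And>x y. x \<in> N \<Longrightarrow> y \<in> N \<Longrightarrow> \<alpha> (x \<otimes> y) = \<alpha> x \<otimes> \<alpha> y"
    and \<alpha>_shift: "\<And>v x. 1 \<le> v \<Longrightarrow> x \<in> N \<Longrightarrow> x \<in> F v \<Longrightarrow> inv x \<otimes> \<alpha> x \<in> F (v + w)"
begin

lemma N_carrier: "x \<in> N \<Longrightarrow> x \<in> carrier G"
  using subgroup.subset[OF N] by blast

lemma \<alpha>_eq: "x \<in> N \<Longrightarrow> \<alpha> x = x \<otimes> (inv x \<otimes> \<alpha> x)"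
  using N_carrier \<alpha>_closed by (simp add: cancel_left)

lemma \<alpha>_weight: "1 \<le> v \<Longrightarrow> x \<in> N \<Longrightarrow> x \<in> F v \<Longrightarrow> \<alpha> x \<in> F v"
  using \<alpha>_eq[of x] \<alpha>_shift[of v x] F_mono[of v "v + w"] subgroup.m_closed[OF F_sub] by (metis le_add1 subsetD)

lemma \<alpha>_quot: "x \<in> N \<Longrightarrow> inv x \<otimes> \<alpha> x \<in> N"
  using subgroup.m_closed[OF N subgroup.m_inv_closed[OF N]] \<alpha>_closed by blast

text \<open>The difference of the composite in direction \<open>g\<close> is the difference of
  \<open>p\<close> in direction \<open>\<alpha> g\<close>, again composed with
  \<open>\<alpha>\<close>, and \<open>\<alpha>\<close> preserves weights.\<close>

lemma wpoly_compose:
  "wpoly N F k p \<Longrightarrow> wpoly N F k (\<lambda>x. p (\<alpha> x))"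
proof (induction k arbitrary: p rule: less_induct)
  case (less k)
  show ?case
  proof (cases "k = 0")
    case False
    have "wpoly N F (k - v) (\<lambda>x. p (\<alpha> (x \<otimes> g)) - p (\<alpha> x))" if v: "1 \<le> v" "g \<in> N \<inter> F v" for v g
    proof -
      have "wpoly N F (k - v) (\<lambda>x. p (x \<otimes> \<alpha> g) - p x)"
        using wpoly_diff[OF N less.prems v(1)] \<alpha>_closed \<alpha>_weight v by auto
      then have "wpoly N F (k - v) (\<lambda>x. p (\<alpha> x \<otimes> \<alpha> g) - p (\<alpha> x))"
        using less.IH[of "k - v"] v False by simp
      then show ?thesis using wpoly_cong[OF N] \<alpha>_mult v by (smt (verit) IntE)
    qed
    then show ?thesis using False wpoly_pos[of k] by simp
  qed (use less.prems \<alpha>_closed in \<open>simp add: wpoly_0\<close>)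
qed

text \<open>A difference in direction \<open>g\<close> of weight \<open>v\<close> splits into two
  parts. One is the same expression for the difference of \<open>p\<close>, of degree lower by
  \<open>v\<close>. The other comes from the correction \<open>inv g \<otimes> \<alpha> g\<close>,
  which has weight \<open>v + w\<close>. Both have lost \<open>v + w\<close> in total.\<close>

lemma wpoly_compose_diff:
  "wpoly N F k p \<Longrightarrow> wpoly N F (k - w) (\<lambda>x. p (\<alpha> x) - p x)"
proof (induction k arbitrary: p rule: less_induct)
  case (less k)
  note p = less.prems
  show ?case
  proof (cases "k \<le> w")
    case True
    have "p (\<alpha> x) - p x = 0" if x: "x \<in> N" for x
    proof -
      \<comment> \<open>Every element has weight at least one, so this direction exhausts the whole
        degree and the difference vanishes.\<close>
      have "inv x \<otimes> \<alpha> x \<in> F (Suc 0 + w)" using \<alpha>_shift[of "Suc 0" x] x F_1 N_carrier by simp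
      then have "wpoly N F (k - (Suc 0 + w)) (\<lambda>y. p (y \<otimes> (inv x \<otimes> \<alpha> x)) - p y)"
        by (intro wpoly_diff[OF N p _ \<alpha>_quot[OF x]]) simp
      then have "p (x \<otimes> (inv x \<otimes> \<alpha> x)) - p x = 0" using True x by (simp add: wpoly_0)
      then show ?thesis using \<alpha>_eq[OF x] by simp
    qed
    then show ?thesis by (rule wpoly_vanish[OF N])
  next
    case False
    have "wpoly N F (k - w - v) (\<lambda>x. p (\<alpha> (x \<otimes> g)) - p (x \<otimes> g) - (p (\<alpha> x) - p x))"
      if v: "1 \<le> v" "g \<in> N \<inter> F v" for v g
    proof -
      let ?z = "inv g \<otimes> \<alpha> g"
      have g: "g \<in> N" "g \<in> F v" "g \<in> F (Suc 0)" using v F_1 N_carrier by auto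
      have z: "?z \<in> N" "?z \<in> F (v + w)" using \<alpha>_quot \<alpha>_shift v g by auto
      let ?p1 = "\<lambda>x. p (x \<otimes> g) - p x" and ?r = "\<lambda>x. p (x \<otimes> ?z) - p x"
      have "wpoly N F (k - v) ?p1" by (rule wpoly_diff[OF N p v(1) g(1,2)])
      then have 1: "wpoly N F (k - v - w) (\<lambda>x. ?p1 (\<alpha> x) - ?p1 x)"
        using less.IH[of "k - v"] v False by simp
      have "wpoly N F (k - (v + w)) ?r" by (rule wpoly_diff[OF N p _ z]) (use v in simp)
      then have "wpoly N F (k - (v + w)) (\<lambda>x. ?r (x \<otimes> g))" using g by (intro wpoly_translate[OF N])
      then have 2: "wpoly N F (k - (v + w)) (\<lambda>x. ?r (\<alpha> x \<otimes> g))" by (rule wpoly_compose)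
      have "wpoly N F (k - w - v) (\<lambda>x. (?p1 (\<alpha> x) - ?p1 x) + ?r (\<alpha> x \<otimes> g))"
        using wpoly_add[OF 1, of "\<lambda>x. ?r (\<alpha> x \<otimes> g)"] 2 by (simp only: diff_diff_left add.commute)
      moreover have "(?p1 (\<alpha> x) - ?p1 x) + ?r (\<alpha> x \<otimes> g) = p (\<alpha> (x \<otimes> g)) - p (x \<otimes> g) - (p (\<alpha> x) - p x)"
        if x: "x \<in> N" for x
      proof -
        have "\<alpha> x \<otimes> g \<otimes> ?z = \<alpha> (x \<otimes> g)"
          using \<alpha>_mult[OF x g(1)] N_carrier[OF g(1)] N_carrier[OF \<alpha>_closed[OF x]] N_carrier[OF \<alpha>_closed[OF g(1)]]
          by (simp add: m_assoc cancel_left)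
        then show ?thesis by simp
      qed
      ultimately show ?thesis
        using wpoly_cong[OF N, of "\<lambda>x. (?p1 (\<alpha> x) - ?p1 x) + ?r (\<alpha> x \<otimes> g)"
          "\<lambda>x. p (\<alpha> (x \<otimes> g)) - p (x \<otimes> g) - (p (\<alpha> x) - p x)"] by blast
    qed
    then show ?thesis using False wpoly_pos[of "k - w"] by simp
  qed
qed

end

end

text \<open>One infinite cyclic step \<open>H = \<langle>x\<rangle> N\<close> of weight \<open>w\<close>. Writing elements as \<open>x^k m\<close>, with the power of \<open>x\<close>
  on the left, makes the functions \<open>x^k m \<mapsto> p m\<close> stable under right translation.\<close>

locale cyclic_step = N_series +
  fixes N H :: "'a set" and x :: 'a and w :: nat
  assumes N: "subgroup N G" and H: "subgroup H G" and NH: "N \<subseteq> H" and x: "x \<in> H"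
    and conj: "\<And>m k. m \<in> N \<Longrightarrow> inv (x [^] (k::int)) \<otimes> m \<otimes> x [^] k \<in> N"
    and decomp: "\<And>h. h \<in> H \<Longrightarrow> \<exists>k::int. \<exists>m\<in>N. h = x [^] k \<otimes> m"
    and inf: "\<And>k::int. x [^] k \<in> N \<Longrightarrow> k = 0"
    and w: "1 \<le> w" "H \<subseteq> F w" and HN: "H \<inter> F (Suc w) \<subseteq> N"
begin

lemma H_carrier: "h \<in> H \<Longrightarrow> h \<in> carrier G"
  using subgroup.subset[OF H] by blast

lemma N_car: "m \<in> N \<Longrightarrow> m \<in> carrier G"
  using NH H_carrier by blast

lemma xc: "x \<in> carrier G" using x H_carrier by blast

lemma decomp_unique:
  assumes "m \<in> N" "m' \<in> N" "x [^] (k::int) \<otimes> m = x [^] (l::int) \<otimes> m'"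
  shows "k = l \<and> m = m'"
proof -
  note c = N_car[OF assms(1)] N_car[OF assms(2)] int_pow_closed[OF xc]
  have "x [^] (k - l) = inv (x [^] l) \<otimes> x [^] k"
    using int_pow_mult[OF xc, of "- l" k] xc by (simp add: int_pow_neg)
  also have "\<dots> = inv (x [^] l) \<otimes> (x [^] k \<otimes> m) \<otimes> inv m" using c by (simp add: m_assoc)
  also have "\<dots> = m' \<otimes> inv m" unfolding assms(3) using c by (simp add: cancel_left)
  finally have "x [^] (k - l) \<in> N"
    using subgroup.m_closed[OF N assms(2) subgroup.m_inv_closed[OF N assms(1)]] by simp
  then have "k = l" using inf[of "k - l"] by simp
  then show ?thesis using assms(3) c by simp
qed

definition ex :: "'a \<Rightarrow> int" where "ex h = (THE k. \<exists>m\<in>N. h = x [^] k \<otimes> m)"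
definition rest :: "'a \<Rightarrow> 'a" where "rest h = inv (x [^] ex h) \<otimes> h"

lemma ex_eq: "m \<in> N \<Longrightarrow> ex (x [^] k \<otimes> m) = k"
  unfolding ex_def using decomp_unique by (intro the_equality) blast+

lemma rest_eq: "m \<in> N \<Longrightarrow> rest (x [^] (k::int) \<otimes> m) = m"
  unfolding rest_def by (simp add: ex_eq xc N_car cancel_left)

text \<open>Right multiplication acts on the \<open>N\<close>-coordinate by a conjugation and a
  translation that do not depend on the exponent \<open>k\<close>. So functions of
  \<open>rest\<close> have differences that are functions of \<open>rest\<close>.\<close>

lemma mult_eq:
  assumes "m \<in> N" "m' \<in> N"
  shows "(x [^] (k::int) \<otimes> m) \<otimes> (x [^] (l::int) \<otimes> m') = x [^] (k + l) \<otimes> ((inv (x [^] l) \<otimes> m \<otimes> x [^] l) \<otimes> m')"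
  using N_car[OF assms(1)] N_car[OF assms(2)] xc by (simp add: int_pow_mult m_assoc cancel_left)

text \<open>In direction \<open>x [^] l \<otimes> m\<close> the difference is \<open>q\<close>
  composed with \<open>rest\<close>, where \<open>q\<close> compares \<open>p\<close> with its
  composite with a conjugation and a translation by \<open>m\<close>. Conjugation by an element of
  weight \<open>w\<close> and translation by \<open>m\<close>, also of weight \<open>w\<close>, each
  lower the degree by \<open>w\<close>, which suffices for directions of weight
  \<open>v \<le> w\<close>.\<close>

lemma extend:
  "wpoly N F k p \<Longrightarrow> wpoly H F k (\<lambda>h. p (rest h))"
proof (induction k arbitrary: p rule: less_induct)
  case (less k)
  note p = less.prems
  show ?case
  proof (cases "k = 0")
    case True
    have "rest h \<in> N" if "h \<in> H" for h using decomp[OF that] rest_eq by auto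
    then show ?thesis using True p by (simp add: wpoly_0)
  next
    case False
    have "wpoly H F (k - v) (\<lambda>h. p (rest (h \<otimes> g)) - p (rest h))" if v: "1 \<le> v" "g \<in> H \<inter> F v" for v g
    proof -
      obtain l :: int and m where g: "g = x [^] l \<otimes> m" and m: "m \<in> N" using decomp v(2) by blast
      define \<alpha> where "\<alpha> y = inv (x [^] l) \<otimes> y \<otimes> x [^] l" for y
      define q where "q y = p (\<alpha> y \<otimes> m) - p y" for y
      have xl: "x [^] l \<in> F w" using w x subgroup_int_pow_closed[OF H] by blast
      have xlc: "x [^] l \<in> carrier G" using xc by simp
      have \<alpha>N: "\<alpha> y \<in> N" if "y \<in> N" for y using conj that by (simp add: \<alpha>_def)
      have mF: "m \<in> F w" "m \<in> F (Suc 0)" using m NH w F_1 N_car by auto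
      have q: "wpoly N F (k - v) q"
      proof (cases "v \<le> w")
        case True
        have pm: "wpoly N F k (\<lambda>y. p (y \<otimes> m))" using wpoly_translate[OF N p m mF(2)] .
        have "wpoly N F (k - w) (\<lambda>y. p (\<alpha> y \<otimes> m) - p (y \<otimes> m))"
        proof (rule wpoly_compose_diff[OF N _ _ _ pm])
          show "\<alpha> y \<in> N" if "y \<in> N" for y by (rule \<alpha>N[OF that])
          show "\<alpha> (y \<otimes> z) = \<alpha> y \<otimes> \<alpha> z" if "y \<in> N" "z \<in> N" for y z
            unfolding \<alpha>_def using N_car that xlc by (simp add: m_assoc cancel_left)
          show "inv y \<otimes> \<alpha> y \<in> F (u + w)" if u: "1 \<le> u" and y: "y \<in> N" "y \<in> F u" for u y
          proof -
            have "inv y \<otimes> inv (x [^] l) \<otimes> inv (inv y) \<otimes> inv (inv (x [^] l)) \<in> F (u + w)"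
              by (rule F_N[OF u w(1) subgroup.m_inv_closed[OF F_sub y(2)] subgroup.m_inv_closed[OF F_sub xl]])
            then show ?thesis using N_car[OF y(1)] xlc by (simp add: \<alpha>_def m_assoc)
          qed
        qed
        from wpoly_add[OF this wpoly_diff[OF N p w(1) m mF(1)]]
        have "wpoly N F (k - w) q" by (simp add: q_def[abs_def])
        then show ?thesis by (rule wpoly_mono[OF N]) (use True in simp)
      next
        case False
        \<comment> \<open>A direction heavier than \<open>w\<close> lies in \<open>N\<close> by
          \<open>HN\<close>, so it involves no power of \<open>x\<close> and the conjugation is
          trivial.\<close>
        then have "F v \<subseteq> F (Suc w)" using F_mono[of "Suc w" v] by simp
        then have gN: "g \<in> N" using v(2) HN by blast
        have "x [^] l = g \<otimes> inv m" using g m N_car xlc by (simp add: m_assoc)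
        then have "x [^] l \<in> N" using subgroup.m_closed[OF N gN subgroup.m_inv_closed[OF N m]] by simp
        then have l: "l = 0" by (rule inf)
        then have gm: "g = m" using g N_car[OF m] by simp
        have "wpoly N F (k - v) (\<lambda>y. p (y \<otimes> m) - p y)"
          using wpoly_diff[OF N p v(1) m] gm v(2) by simp
        then show ?thesis
          using wpoly_cong[OF N, of "\<lambda>y. p (y \<otimes> m) - p y" q] N_car l by (simp add: q_def \<alpha>_def)
      qed
      then have "wpoly H F (k - v) (\<lambda>h. q (rest h))" using less.IH[of "k - v"] v False by simp
      moreover have "q (rest h) = p (rest (h \<otimes> g)) - p (rest h)" if hH: "h \<in> H" for h
      proof -
        obtain j :: int and y where h: "h = x [^] j \<otimes> y" and y: "y \<in> N" using decomp[OF hH] by blast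
        have "rest (h \<otimes> g) = \<alpha> y \<otimes> m"
          unfolding h g mult_eq[OF y m] \<alpha>_def[symmetric]
          by (rule rest_eq[OF subgroup.m_closed[OF N \<alpha>N[OF y] m]])
        then show ?thesis using rest_eq[OF y] by (simp add: h q_def)
      qed
      ultimately show ?thesis
        using wpoly_cong[OF H, of "\<lambda>h. q (rest h)" "\<lambda>h. p (rest (h \<otimes> g)) - p (rest h)"] by blast
    qed
    then show ?thesis using False wpoly_pos[of k] by simp
  qed
qed

text \<open>The exponent is additive, so its differences are constants, admissible for directions of
  weight at most \<open>n\<close>. Heavier directions lie in \<open>N\<close> and have exponent
  zero.\<close>

lemma exponent_wpoly:
  assumes n: "1 \<le> n" "H \<inter> F (Suc n) \<subseteq> N"
  shows "wpoly H F (Suc n) (\<lambda>h. of_int (ex h))"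
proof -
  have "wpoly H F (Suc n - v) (\<lambda>h. of_int (ex (h \<otimes> g)) - of_int (ex h))" if v: "1 \<le> v" "g \<in> H \<inter> F v" for v g
  proof -
    obtain l :: int and m where g: "g = x [^] l \<otimes> m" and m: "m \<in> N" using decomp v(2) by blast
    have eq: "of_int (ex (h \<otimes> g)) - of_int (ex h) = (of_int l :: rat)" if hH: "h \<in> H" for h
    proof -
      obtain j :: int and y where h: "h = x [^] j \<otimes> y" and y: "y \<in> N" using decomp[OF hH] by blast
      have "ex (h \<otimes> g) = j + l"
        unfolding h g mult_eq[OF y m] by (rule ex_eq[OF subgroup.m_closed[OF N conj[OF y] m]])
      then show ?thesis using ex_eq[OF y] by (simp add: h)
    qed
    have "wpoly H F (Suc n - v) (\<lambda>h. of_int l)"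
    proof (cases "v \<le> n")
      case True then show ?thesis by (intro wpoly_const) simp
    next
      case False
      then have "F v \<subseteq> F (Suc n)" using F_mono[of "Suc n" v] by simp
      then have "x [^] l \<otimes> m \<in> N" using v(2) n(2) g by blast
      moreover have "x [^] l = (x [^] l \<otimes> m) \<otimes> inv m" using N_car[OF m] xc by (simp add: m_assoc)
      ultimately have "x [^] l \<in> N" using subgroup.m_closed[OF N _ subgroup.m_inv_closed[OF N m]] by metis
      then have "l = 0" by (rule inf)
      then show ?thesis using wpoly_zero by simp
    qed
    then show ?thesis using wpoly_cong[OF H, of "\<lambda>h. of_int (ex (h \<otimes> g)) - of_int (ex h)" "\<lambda>h. of_int l"] eq by blast
  qed
  then show ?thesis using wpoly_pos[of "Suc n"] by simp
qed

text \<open>An element of \<open>N\<close> is separated by extending a function from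
  \<open>N\<close>, an element outside \<open>N\<close> by its exponent.\<close>

lemma separate_step:
  assumes n: "1 \<le> n" "H \<inter> F (Suc n) \<subseteq> N"
    and IH: "a \<in> N \<Longrightarrow> \<exists>p. wpoly N F (Suc n) p \<and> p a \<noteq> p \<one>" and a: "a \<in> H"
  shows "\<exists>p. wpoly H F (Suc n) p \<and> p a \<noteq> p \<one>"
proof -
  obtain k :: int and m where km: "a = x [^] k \<otimes> m" and m: "m \<in> N" using decomp a by blast
  have one: "\<one> = x [^] (0::int) \<otimes> \<one>" by simp
  have oneN: "\<one> \<in> N" using subgroup.one_closed[OF N] .
  show ?thesis
  proof (cases "k = 0")
    case True
    then have "a = m" using km N_car[OF m] by simp
    then obtain p where p: "wpoly N F (Suc n) p" "p a \<noteq> p \<one>" using IH m by blast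
    have "rest a = a" using rest_eq[OF m, of k] km \<open>a = m\<close> by simp
    moreover have "rest \<one> = \<one>" using rest_eq[OF oneN, of 0] one by simp
    ultimately show ?thesis using extend[OF p(1)] p(2) by (intro exI[of _ "\<lambda>h. p (rest h)"]) simp
  next
    case False
    have "ex a = k" using ex_eq[OF m] km by simp
    moreover have "ex \<one> = 0" using ex_eq[OF oneN, of 0] one by simp
    ultimately show ?thesis using exponent_wpoly[OF n] False
      by (intro exI[of _ "\<lambda>h. of_int (ex h)"]) simp
  qed
qed

end

section \<open>Finitely generated subgroups of torsion-free abelian groups\<close>

context comm_group
begin

lemma generate_finprod:
  assumes T: "finite T" "T \<subseteq> carrier G" and y: "y \<in> generate G T"
  shows "\<exists>e :: 'a \<Rightarrow> int. y = (\<Otimes>t\<in>T. t [^] e t)"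
proof -
  let ?P = "{\<Otimes>t\<in>T. t [^] e t | e :: 'a \<Rightarrow> int. True}"
  have cl: "(\<lambda>t. t [^] (e t :: int)) \<in> T \<rightarrow> carrier G" for e using T by auto
  have add: "(\<Otimes>t\<in>T. t [^] (e t + e' t :: int)) = (\<Otimes>t\<in>T. t [^] e t) \<otimes> (\<Otimes>t\<in>T. t [^] e' t)" for e e'
  proof -
    have "(\<Otimes>t\<in>T. t [^] (e t + e' t)) = (\<Otimes>t\<in>T. t [^] e t \<otimes> t [^] e' t)"
      by (rule finprod_cong') (use T in \<open>auto simp: int_pow_mult\<close>)
    then show ?thesis using finprod_multf[OF cl cl] by simp
  qed
  have zero: "(\<Otimes>t\<in>T. t [^] (0::int)) = \<one>" by simp
  have "subgroup ?P G"
  proof (rule subgroupI)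
    show "?P \<subseteq> carrier G" using finprod_closed[OF cl] by auto
    show "?P \<noteq> {}" by blast
    fix a assume "a \<in> ?P"
    then obtain e :: "'a \<Rightarrow> int" where a: "a = (\<Otimes>t\<in>T. t [^] e t)" by blast
    have "(\<Otimes>t\<in>T. t [^] (- e t)) \<otimes> a = \<one>"
      using add[of "\<lambda>t. - e t" e] zero a by simp
    then have "inv a = (\<Otimes>t\<in>T. t [^] (- e t))"
      using a finprod_closed[OF cl] finprod_closed[OF cl[of "\<lambda>t. - e t"]] by (intro inv_equality) auto
    then show "inv a \<in> ?P" by (intro CollectI exI[of _ "\<lambda>t. - e t"]) simp
    fix b assume "b \<in> ?P"
    then obtain e' :: "'a \<Rightarrow> int" where b: "b = (\<Otimes>t\<in>T. t [^] e' t)" by blast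
    have "a \<otimes> b = (\<Otimes>t\<in>T. t [^] (e t + e' t))" using add a b by simp
    then show "a \<otimes> b \<in> ?P" by (intro CollectI exI[of _ "\<lambda>t. e t + e' t"]) simp
  qed
  moreover have "T \<subseteq> ?P"
  proof
    fix s assume s: "s \<in> T"
    have "(\<Otimes>t\<in>T. t [^] (if t = s then 1 else 0 :: int)) = (\<Otimes>t\<in>T. if s = t then t else \<one>)"
      by (rule finprod_cong') (use T in auto)
    also have "\<dots> = s" using finprod_singleton[OF s T(1), of "\<lambda>t. t"] T by auto
    finally show "s \<in> ?P" by (intro CollectI exI[of _ "\<lambda>t. if t = s then 1 else 0"]) simp
  qed
  ultimately show ?thesis using generate_subgroup_incl[of T ?P] y by blast
qed

text \<open>Replacing the generator \<open>j\<close> by \<open>t\<close> is an elementary operation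
  on the relation: \<open>t [^] e j\<close> contributes \<open>i [^] (\<sigma> * e j)\<close>, which
  the new exponent of \<open>i\<close> compensates.\<close>

lemma relation_exchange:
  assumes U: "finite U" "U \<subseteq> carrier G" and i: "i \<in> carrier G" "i \<notin> U" and j: "j \<in> carrier G" "j \<notin> U" "i \<noteq> j"
    and t: "t = j \<otimes> i [^] (\<sigma>::int)" "t \<notin> U" "t \<noteq> i"
  shows "(\<Otimes>s\<in>insert i (insert t U). s [^] ((e(i := e i - \<sigma> * e j, t := e j)) s :: int))
    = (\<Otimes>s\<in>insert i (insert j U). s [^] (e s))"
proof -
  have tc: "t \<in> carrier G" using t i j by simp
  have cl: "(\<lambda>s. s [^] (e s :: int)) \<in> U \<rightarrow> carrier G" for e using U by auto
  let ?e = "e(i := e i - \<sigma> * e j, t := e j)"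
  have U': "(\<Otimes>s\<in>U. s [^] ?e s) = (\<Otimes>s\<in>U. s [^] e s)"
    by (rule finprod_cong') (use U i t in auto)
  have "(\<Otimes>s\<in>insert i (insert t U). s [^] ?e s) = i [^] (e i - \<sigma> * e j) \<otimes> (t [^] e j \<otimes> (\<Otimes>s\<in>U. s [^] e s))"
    using U i j t tc cl[of ?e] U' by simp
  also have "t [^] e j = j [^] e j \<otimes> i [^] (\<sigma> * e j)"
    unfolding t(1) using i j by (simp add: int_pow_distrib int_pow_pow)
  also have "i [^] (e i - \<sigma> * e j) \<otimes> (j [^] e j \<otimes> i [^] (\<sigma> * e j) \<otimes> (\<Otimes>s\<in>U. s [^] e s))
      = (i [^] (e i - \<sigma> * e j) \<otimes> i [^] (\<sigma> * e j)) \<otimes> (j [^] e j \<otimes> (\<Otimes>s\<in>U. s [^] e s))"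
    using i j finprod_closed[OF cl[of e]] by (simp add: m_ac)
  also have "i [^] (e i - \<sigma> * e j) \<otimes> i [^] (\<sigma> * e j) = i [^] e i"
    using i by (simp add: int_pow_mult[symmetric])
  also have "i [^] e i \<otimes> (j [^] e j \<otimes> (\<Otimes>s\<in>U. s [^] e s)) = (\<Otimes>s\<in>insert i (insert j U). s [^] e s)"
    using U i j cl by simp
  finally show ?thesis .
qed

text \<open>Among the generating sets of least cardinality choose a relation with the least sum of absolute values
  of the exponents: a Euclidean step between two of its exponents would decrease that sum.\<close>

theorem independent_generators:
  assumes tf: "\<And>x k. x \<in> carrier G \<Longrightarrow> 0 < (k::nat) \<Longrightarrow> x [^] k = \<one> \<Longrightarrow> x = \<one>"
    and S: "finite S" "S \<subseteq> carrier G"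
  shows "\<exists>T. finite T \<and> T \<subseteq> carrier G \<and> S \<subseteq> generate G T \<and>
    (\<forall>e :: 'a \<Rightarrow> int. (\<Otimes>t\<in>T. t [^] e t) = \<one> \<longrightarrow> (\<forall>t\<in>T. e t = 0))"
proof (rule ccontr)
  assume neg: "\<not> ?thesis"
  define P where "P T \<longleftrightarrow> finite T \<and> T \<subseteq> carrier G \<and> S \<subseteq> generate G T" for T
  have "P S" using S generate.incl by (auto simp: P_def)
  then obtain T0 where T0: "P T0" "\<And>T. P T \<Longrightarrow> card T0 \<le> card T"
    using ex_has_least_nat[of P S card] by blast
  define Q where "Q = (\<lambda>(T, e :: 'a \<Rightarrow> int). P T \<and> card T = card T0 \<and> (\<Otimes>t\<in>T. t [^] e t) = \<one> \<and> (\<exists>t\<in>T. e t \<noteq> 0))"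
  define m where "m = (\<lambda>(T, e :: 'a \<Rightarrow> int). \<Sum>t\<in>T. nat \<bar>e t\<bar>)"
  have "\<exists>e0. Q (T0, e0)" using neg T0(1) unfolding P_def Q_def by auto
  then obtain Te where Te: "Q Te" "\<And>Te'. Q Te' \<Longrightarrow> m Te \<le> m Te'"
    using ex_has_least_nat[of Q _ m] by blast
  obtain T e where TeE: "Te = (T, e)" by force
  have PT: "P T" and cT: "card T = card T0" and rel: "(\<Otimes>t\<in>T. t [^] e t) = \<one>" and nz: "\<exists>t\<in>T. e t \<noteq> 0"
    using Te(1) by (auto simp: TeE Q_def)
  have T: "finite T" "T \<subseteq> carrier G" "S \<subseteq> generate G T" using PT by (auto simp: P_def)
  have smaller: False if "finite T'" "T' \<subseteq> carrier G" "T \<subseteq> generate G T'" "card T' < card T" for T'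
  proof -
    have "generate G T \<subseteq> generate G T'"
      by (rule generate_subgroup_incl[OF that(3) generate_is_subgroup[OF that(2)]])
    then have "P T'" using that T by (auto simp: P_def)
    then show False using T0(2) that(4) cT by fastforce
  qed
  obtain t1 where t1: "t1 \<in> T" "e t1 \<noteq> 0" using nz by blast
  show False
  proof (cases "\<exists>t2\<in>T. t2 \<noteq> t1 \<and> e t2 \<noteq> 0")
    \<comment> \<open>With one nonzero exponent the relation says that a power of \<open>t1\<close>
      is trivial. Torsion-freeness makes \<open>t1\<close> trivial, so it could be dropped from the
      generators.\<close>
    case False
    have t1c: "t1 \<in> carrier G" using T t1 by blast
    have "(\<Otimes>t\<in>T. t [^] e t) = (\<Otimes>t\<in>T. if t1 = t then t [^] e t else \<one>)"
      by (rule finprod_cong') (use T False in auto)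
    also have "\<dots> = t1 [^] e t1" using finprod_singleton[OF t1(1) T(1), of "\<lambda>t. t [^] e t"] T by auto
    finally have "t1 [^] e t1 = \<one>" using rel by simp
    then have one: "t1 [^] e t1 = \<one>" .
    have "t1 [^] nat \<bar>e t1\<bar> = \<one>"
    proof (cases "e t1 \<ge> 0")
      case True
      then show ?thesis using one by (metis abs_of_nonneg int_pow_int nat_0_le)
    next
      case False
      then have neg: "e t1 < 0" and abs: "\<bar>e t1\<bar> = - e t1" by auto
      have "inv (t1 [^] nat \<bar>e t1\<bar>) = \<one>"
        using one neg unfolding int_pow_def2 abs by (simp only: if_True)
      then show ?thesis using inv_eq_1_iff[OF nat_pow_closed[OF t1c]] by blast
    qed
    then have "t1 = \<one>" using tf[OF t1c, of "nat \<bar>e t1\<bar>"] t1 by simp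
    then have "t1 \<in> generate G (T - {t1})" using generate.one[of G "T - {t1}"] by simp
    then have "T \<subseteq> generate G (T - {t1})" using generate.incl[of _ "T - {t1}" G] by auto
    moreover have "finite (T - {t1})" "T - {t1} \<subseteq> carrier G" using T by auto
    ultimately show False
      using smaller[of "T - {t1}"] card_Diff1_less[OF T(1) t1(1)] by blast
  next
    case True
    then obtain t2 where t2: "t2 \<in> T" "t2 \<noteq> t1" "e t2 \<noteq> 0" by blast
    obtain i j where ij: "i \<in> T" "j \<in> T" "i \<noteq> j" "e j \<noteq> 0" "\<bar>e j\<bar> \<le> \<bar>e i\<bar>"
    proof (cases "\<bar>e t2\<bar> \<le> \<bar>e t1\<bar>")
      case True then show ?thesis using that[of t1 t2] t1 t2 by blast
    next
      case False then show ?thesis using that[of t2 t1] t1 t2 by simp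
    qed
    \<comment> \<open>The sign that makes the new absolute exponent of \<open>i\<close> equal to the
      difference of the absolute values of \<open>e i\<close> and \<open>e j\<close>.\<close>
    define \<sigma> where "\<sigma> = sgn (e i) * sgn (e j)"
    define t where "t = j \<otimes> i [^] \<sigma>"
    define U where "U = T - {i, j}"
    have ijc: "i \<in> carrier G" "j \<in> carrier G" using T ij by auto
    have tc: "t \<in> carrier G" using ijc by (simp add: t_def)
    have TU: "T = insert i (insert j U)" using ij by (auto simp: U_def)
    have U: "finite U" "U \<subseteq> carrier G" "i \<notin> U" "j \<notin> U" using T by (auto simp: U_def)
    let ?T = "insert i (insert t U)"
    have T'c: "?T \<subseteq> carrier G" using ijc tc U by blast
    have sub: "subgroup (generate G ?T) G" using generate_is_subgroup[OF T'c] .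
    have gi: "i \<in> generate G ?T" and gt: "t \<in> generate G ?T" by (auto intro: generate.incl)
    have "t \<otimes> inv (i [^] \<sigma>) \<in> generate G ?T"
      using subgroup.m_closed[OF sub gt subgroup.m_inv_closed[OF sub subgroup_int_pow_closed[OF sub gi]]] .
    moreover have "t \<otimes> inv (i [^] \<sigma>) = j" using ijc by (simp add: t_def m_assoc)
    ultimately have TT': "T \<subseteq> generate G ?T" unfolding TU by (auto intro: generate.incl)
    have fin: "finite ?T" using U by simp
    \<comment> \<open>A coincidence of \<open>t\<close> with another generator would lower the
      number of generators, against their minimality.\<close>
    have fresh: "t \<notin> U \<and> t \<noteq> i"
    proof (rule ccontr)
      assume "\<not> ?thesis"
      then have "?T = insert i U" by blast
      then have "card ?T < card T" unfolding TU using U ij(3) by simp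
      then show False using smaller[OF fin T'c TT'] by blast
    qed
    have "card ?T = card T" unfolding TU using U fresh ij(3) by auto
    moreover have "P ?T"
    proof -
      have "generate G T \<subseteq> generate G ?T" by (rule generate_subgroup_incl[OF TT' sub])
      then show ?thesis using T fin T'c by (auto simp: P_def)
    qed
    moreover define e' where "e' = e(i := e i - \<sigma> * e j, t := e j)"
    moreover have "(\<Otimes>s\<in>?T. s [^] e' s) = \<one>"
      unfolding e'_def relation_exchange[OF U(1,2) ijc(1) U(3) ijc(2) U(4) ij(3) t_def conjunct1[OF fresh] conjunct2[OF fresh]]
      using rel TU by simp
    ultimately have "Q (?T, e')" using cT ij by (auto simp: Q_def)
    then have "m (T, e) \<le> m (?T, e')" using Te(2) TeE by blast
    moreover have "(\<Sum>s\<in>U. nat \<bar>e' s\<bar>) = (\<Sum>s\<in>U. nat \<bar>e s\<bar>)"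
      using fresh U by (intro sum.cong) (auto simp: e'_def)
    then have "m (?T, e') = nat \<bar>e i - \<sigma> * e j\<bar> + nat \<bar>e j\<bar> + (\<Sum>s\<in>U. nat \<bar>e s\<bar>)"
    proof -
      have "e' i = e i - \<sigma> * e j" "e' t = e j" using fresh by (auto simp: e'_def)
      moreover have "i \<noteq> t" using fresh by blast
      ultimately show ?thesis using U fresh \<open>(\<Sum>s\<in>U. nat \<bar>e' s\<bar>) = _\<close> by (simp add: m_def)
    qed
    moreover have "m (T, e) = nat \<bar>e i\<bar> + nat \<bar>e j\<bar> + (\<Sum>s\<in>U. nat \<bar>e s\<bar>)"
      unfolding TU m_def using U ij by simp
    moreover have "\<bar>e i - \<sigma> * e j\<bar> < \<bar>e i\<bar>"
      using ij(4,5) by (auto simp: \<sigma>_def sgn_if split: if_splits)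
    ultimately show False by linarith
  qed
qed

end

text \<open>Moving the power of \<open>t\<close> to the other side yields a relation on
  \<open>T\<close> whose exponent at \<open>t\<close> is \<open>- k\<close>.\<close>

lemma (in comm_group) independent_power:
  assumes ind: "\<And>e :: 'a \<Rightarrow> int. (\<Otimes>t\<in>T. t [^] e t) = \<one> \<Longrightarrow> \<forall>t\<in>T. e t = 0"
    and T: "finite T" "T \<subseteq> carrier G" and T0: "insert t T0 \<subseteq> T" "t \<notin> T0"
    and tk: "t [^] (k::int) \<in> generate G T0"
  shows "k = 0"
proof -
  have fin: "finite T0" "T0 \<subseteq> carrier G" "t \<in> carrier G" using T T0 finite_subset[of T0 T] by auto
  obtain e :: "'a \<Rightarrow> int" where e: "t [^] k = (\<Otimes>s\<in>T0. s [^] e s)" using generate_finprod[OF fin(1,2) tk] by blast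
  define e' where "e' s = (if s = t then - k else if s \<in> T0 then e s else 0)" for s
  have cl: "(\<lambda>s. s [^] (e s :: int)) \<in> T0 \<rightarrow> carrier G" for e using fin by auto
  have "(\<Otimes>s\<in>T. s [^] e' s) = (\<Otimes>s\<in>insert t T0. s [^] e' s)"
    by (rule finprod_mono_neutral_cong_right) (use T T0 in \<open>auto simp: e'_def\<close>)
  also have "\<dots> = t [^] (- k) \<otimes> (\<Otimes>s\<in>T0. s [^] e' s)"
    using fin T0(2) cl[of e'] by (simp add: e'_def)
  also have "(\<Otimes>s\<in>T0. s [^] e' s) = t [^] k"
    unfolding e by (rule finprod_cong') (use fin T0(2) in \<open>auto simp: e'_def\<close>)
  also have "t [^] (- k) \<otimes> t [^] k = \<one>" using fin by (simp add: int_pow_neg)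
  finally have "e' t = 0" using ind T0 by blast
  then show ?thesis by (simp add: e'_def)
qed

section \<open>Polycyclic chains and separation\<close>

text \<open>Both inclusions are demanded, since a conjugation can map an infinite subgroup properly
  into itself.\<close>

definition (in group) normalizes :: "'a \<Rightarrow> 'a set \<Rightarrow> bool" where
  "normalizes g N \<longleftrightarrow> (\<forall>m\<in>N. g \<otimes> m \<otimes> inv g \<in> N \<and> inv g \<otimes> m \<otimes> g \<in> N)"

lemma (in group) normalizes_nat_pow:
  assumes "normalizes g N" "g \<in> carrier G" "N \<subseteq> carrier G" "m \<in> N"
  shows "g [^] (k::nat) \<otimes> m \<otimes> inv (g [^] k) \<in> N \<and> inv (g [^] k) \<otimes> m \<otimes> g [^] k \<in> N"
  using assms(4)
proof (induction k arbitrary: m)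
  case 0 then show ?case using assms(3) by auto
next
  case (Suc k)
  have m: "m \<in> carrier G" using Suc.prems assms(3) by blast
  have "g \<otimes> m \<otimes> inv g \<in> N" using assms(1) Suc.prems by (simp add: normalizes_def)
  then have "g [^] k \<otimes> (g \<otimes> m \<otimes> inv g) \<otimes> inv (g [^] k) \<in> N" using Suc.IH by blast
  moreover have "inv g \<otimes> (inv (g [^] k) \<otimes> m \<otimes> g [^] k) \<otimes> g \<in> N"
    using Suc.IH[OF Suc.prems] assms(1) by (simp add: normalizes_def)
  ultimately show ?case using m assms(2) by (simp add: inv_mult_group m_assoc)
qed

lemma (in group) normalizes_int_pow:
  assumes "normalizes g N" "g \<in> carrier G" "N \<subseteq> carrier G" "m \<in> N"
  shows "inv (g [^] (k::int)) \<otimes> m \<otimes> g [^] k \<in> N"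
proof (cases k rule: int_cases2)
  case (nonneg j)
  then show ?thesis using normalizes_nat_pow[OF assms] by (simp only: int_pow_int)
next
  case (nonpos j)
  then show ?thesis using normalizes_nat_pow[OF assms, of j] assms(2) by (simp only: int_pow_neg_int inv_inv nat_pow_closed)
qed

lemma (in group) conj_int_pow:
  assumes "g \<in> carrier G" "x \<in> carrier G"
  shows "(g \<otimes> x \<otimes> inv g) [^] (k::int) = g \<otimes> x [^] k \<otimes> inv g"
proof (cases k rule: int_cases2)
  case (nonneg j)
  then show ?thesis using conj_nat_pow[OF assms] by (simp only: int_pow_int)
next
  case (nonpos j)
  have "(g \<otimes> x \<otimes> inv g) [^] k = inv ((g \<otimes> x \<otimes> inv g) [^] j)"
    unfolding nonpos using assms by (intro int_pow_neg_int) simp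
  also have "\<dots> = g \<otimes> inv (x [^] j) \<otimes> inv g"
    using conj_nat_pow[OF assms] assms by (simp add: inv_mult_group m_assoc)
  finally show ?thesis using int_pow_neg_int[OF assms(2), of j] nonpos by simp
qed

context N_series
begin

inductive pc :: "nat \<Rightarrow> 'a set \<Rightarrow> bool" for n where
  base: "pc n (F (Suc n))"
| step: "pc n N \<Longrightarrow> cyclic_step G F N H x w \<Longrightarrow> pc n H"

lemma pc_sub: "pc n H \<Longrightarrow> subgroup H G \<and> F (Suc n) \<subseteq> H"
proof (induction rule: pc.induct)
  case base show ?case using F_sub by simp
next
  case (step N H x w)
  interpret cyclic_step G F N H x w by (rule step(2))
  show ?case using step H NH by blast
qed

theorem pc_separates:
  assumes "pc n H" "1 \<le> n" "a \<in> H" "a \<notin> F (Suc n)"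
  shows "\<exists>p. wpoly H F (Suc n) p \<and> p a \<noteq> p \<one>"
  using assms(1,3,4)
proof (induction arbitrary: a rule: pc.induct)
  case base then show ?case by blast
next
  case (step N H x w)
  interpret cyclic_step G F N H x w by (rule step.hyps(2))
  show ?case
  proof (rule separate_step[OF assms(2) _ _ step.prems(1)])
    show "H \<inter> F (Suc n) \<subseteq> N" using pc_sub[OF step.hyps(1)] by blast
    show "\<exists>p. wpoly N F (Suc n) p \<and> p a \<noteq> p \<one>" if "a \<in> N" using step.IH[OF that step.prems(2)] .
  qed
qed

lemma F_normal:
  assumes "1 \<le> i" shows "F i \<lhd> G"
proof (rule normal_invI[OF F_sub])
  fix x h assume x: "x \<in> carrier G" and h: "h \<in> F i"
  have hc: "h \<in> carrier G" using h subgroup.mem_carrier[OF F_sub] by blast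
  have "x \<otimes> h \<otimes> inv x \<otimes> inv h \<in> F i"
    using F_N[of "Suc 0" i x h] F_mono[of i "Suc 0 + i"] assms x h F_1 by auto
  then have "(x \<otimes> h \<otimes> inv x \<otimes> inv h) \<otimes> h \<in> F i" by (rule subgroup.m_closed[OF F_sub _ h])
  then show "x \<otimes> h \<otimes> inv x \<in> F i" using x hc by (simp add: m_assoc)
qed

text \<open>Downward induction on the weight. The set \<open>Y\<close> is carried along because the
  elements adjoined at weight \<open>w\<close> must normalize the subgroup built at weight
  \<open>Suc w\<close>; that subgroup is therefore requested only after they are known. Independent
  generators of the image of \<open>S\<close> in the torsion-free factor provide them.\<close>

theorem pc_exists:
  assumes "1 \<le> w" "w \<le> Suc n" "finite S" "S \<subseteq> F w" "finite Y" "Y \<subseteq> carrier G"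
  shows "\<exists>H. pc n H \<and> S \<subseteq> H \<and> H \<subseteq> F w \<and> (\<forall>y\<in>Y. normalizes y H)"
  using assms(2,1,3-)
proof (induction arbitrary: S Y rule: inc_induct)
  case base
  have "normalizes y (F (Suc n))" if "y \<in> carrier G" for y
    using normal.inv_op_closed1[OF F_normal] normal.inv_op_closed2[OF F_normal] that
    by (simp add: normalizes_def)
  then show ?case using pc.base[of n] base by blast
next
  case (step w)
  let ?K = "F (Suc w)"
  have K: "?K \<lhd> G" by (rule F_normal) simp
  interpret K: normal ?K G by (rule K)
  interpret Q: group "G Mod ?K" by (rule K.factorgroup_is_group)
  have Fc: "x \<in> carrier G" if "x \<in> F i" for x i using subgroup.mem_carrier[OF F_sub that] .
  define V where "V = (G Mod ?K)\<lparr>carrier := (#>) ?K ` F w\<rparr>"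
  have sub: "subgroup ((#>) ?K ` F w) (G Mod ?K)" by (rule K.subgroup_image_Mod[OF F_sub])
  have "x \<otimes> y \<otimes> inv x \<otimes> inv y \<in> ?K" if "x \<in> F w" "y \<in> F w" for x y
    using F_N[OF step.prems(1) step.prems(1) that] F_mono[of "Suc w" "w + w"] step.prems(1) by auto
  then interpret V: comm_group V unfolding V_def by (intro quotient_comm_group K F_sub)
  have Vc: "carrier V = (#>) ?K ` F w" and Vm: "monoid.mult V = monoid.mult (G Mod ?K)" and Vone: "\<one>\<^bsub>V\<^esub> = ?K"
    by (simp_all add: V_def)
  have pi: "?K #> x \<in> carrier V" if "x \<in> F w" for x using that by (simp add: Vc)
  have pi_mult: "(?K #> x) \<otimes>\<^bsub>V\<^esub> (?K #> y) = ?K #> (x \<otimes> y)" if "x \<in> F w" "y \<in> F w" for x y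
    using K.rcos_sum Fc that by (simp add: Vm)
  have pi_inv: "inv\<^bsub>V\<^esub> (?K #> x) = ?K #> inv x" if "x \<in> F w" for x
    using Q.m_inv_consistent[OF sub] K.inv_rcos Fc that by (simp add: V_def)
  have pi_pow: "(?K #> x) [^]\<^bsub>V\<^esub> (k::int) = ?K #> x [^] k" if "x \<in> F w" for x k
    using Q.int_pow_consistent[OF sub, of "?K #> x"] K.FactGroup_int_pow[OF Fc[OF that]] that
    by (simp add: V_def)
  have pi_one: "?K #> x = \<one>\<^bsub>V\<^esub> \<longleftrightarrow> x \<in> ?K" if "x \<in> F w" for x
    using K.rcos_self_iff Fc that by (simp add: Vone)
  have tf: "x = \<one>\<^bsub>V\<^esub>" if x: "x \<in> carrier V" and k: "0 < (k::nat)" and xk: "x [^]\<^bsub>V\<^esub> k = \<one>\<^bsub>V\<^esub>" for x k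
  proof -
    obtain y where y: "y \<in> F w" "x = ?K #> y" using x by (auto simp: Vc)
    have "?K #> y [^] int k = \<one>\<^bsub>V\<^esub>" using pi_pow[OF y(1), of "int k"] xk y(2) by (simp add: int_pow_int)
    then have "y [^] k \<in> ?K" using pi_one[of "y [^] int k"] subgroup_int_pow_closed[OF F_sub y(1), of "int k"] by (simp add: int_pow_int)
    then have "y \<in> ?K" using F_isolated[OF Fc[OF y(1)] k] by blast
    then show ?thesis using pi_one y by simp
  qed
  have "\<exists>T. finite T \<and> T \<subseteq> carrier V \<and> (#>) ?K ` S \<subseteq> generate V T \<and>
    (\<forall>e :: 'a set \<Rightarrow> int. (\<Otimes>\<^bsub>V\<^esub>t\<in>T. t [^]\<^bsub>V\<^esub> e t) = \<one>\<^bsub>V\<^esub> \<longrightarrow> (\<forall>t\<in>T. e t = 0))"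
  proof (rule V.independent_generators)
    show "x = \<one>\<^bsub>V\<^esub>" if "x \<in> carrier V" "0 < (k::nat)" "x [^]\<^bsub>V\<^esub> k = \<one>\<^bsub>V\<^esub>" for x k
      using that by (rule tf)
    show "finite ((#>) ?K ` S)" using step.prems(2) by (rule finite_imageI)
    show "(#>) ?K ` S \<subseteq> carrier V" using step.prems(3) by (auto simp: Vc)
  qed
  then obtain T where TT: "finite T \<and> T \<subseteq> carrier V \<and> (#>) ?K ` S \<subseteq> generate V T \<and>
    (\<forall>e :: 'a set \<Rightarrow> int. (\<Otimes>\<^bsub>V\<^esub>t\<in>T. t [^]\<^bsub>V\<^esub> e t) = \<one>\<^bsub>V\<^esub> \<longrightarrow> (\<forall>t\<in>T. e t = 0))"
    by (rule exE)
  then have T: "finite T" "T \<subseteq> carrier V" "(#>) ?K ` S \<subseteq> generate V T" by simp_all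
  have ind: "\<forall>t\<in>T. e t = 0" if "(\<Otimes>\<^bsub>V\<^esub>t\<in>T. t [^]\<^bsub>V\<^esub> e t) = \<one>\<^bsub>V\<^esub>" for e :: "'a set \<Rightarrow> int"
    using TT that by simp
  have "\<forall>t\<in>T. \<exists>x\<in>F w. ?K #> x = t" using T(2) by (auto simp: Vc)
  then have "\<forall>t\<in>T. \<exists>x. x \<in> F w \<and> ?K #> x = t" by blast
  then obtain l where l: "\<forall>t\<in>T. l t \<in> F w \<and> ?K #> l t = t" by (rule bchoice[THEN exE])
  \<comment> \<open>The lifts join \<open>Y\<close>: each must normalize the lower subgroup and
    those obtained by adjoining the other lifts.\<close>
  define Z where "Z = Y \<union> l ` T"
  have ZG: "Z \<subseteq> carrier G" using step.prems(5) l Fc by (auto simp: Z_def)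
  have finZ: "finite Z" using step.prems(4) T(1) by (simp add: Z_def)
  have lT: "l ` T \<subseteq> F w" using l by blast
  have "\<forall>s\<in>S. \<exists>h\<in>generate G (l ` T). ?K #> h = ?K #> s"
  proof
    fix s assume s: "s \<in> S"
    interpret p: group_hom G "G Mod ?K" "(#>) ?K" using K.r_coset_hom_Mod by unfold_locales
    have "l ` T \<subseteq> carrier G" using lT Fc by blast
    then have img: "(#>) ?K ` generate G (l ` T) = generate (G Mod ?K) ((#>) ?K ` l ` T)"
      by (rule p.generate_img[symmetric])
    have "(#>) ?K ` l ` T = (\<lambda>t. t) ` T"
      unfolding image_image by (rule image_cong[OF refl]) (use l in blast)
    then have lT': "(#>) ?K ` l ` T = T" by simp
    have gen: "generate V T = generate (G Mod ?K) T"
      using Q.generate_consistent[OF _ sub, of T] T(2) by (simp add: V_def)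
    have "?K #> s \<in> generate V T" using T(3) s by blast
    then have "?K #> s \<in> (#>) ?K ` generate G (l ` T)" unfolding img lT' gen .
    then obtain h where "h \<in> generate G (l ` T)" "?K #> s = ?K #> h" by (rule imageE)
    then show "\<exists>h\<in>generate G (l ` T). ?K #> h = ?K #> s" by (intro bexI[of _ h]) simp_all
  qed
  then have "\<forall>s\<in>S. \<exists>h. h \<in> generate G (l ` T) \<and> ?K #> h = ?K #> s" by blast
  then obtain h where h: "\<forall>s\<in>S. h s \<in> generate G (l ` T) \<and> ?K #> h s = ?K #> s" by (rule bchoice[THEN exE])
  have gen_F: "generate G (l ` T) \<subseteq> F w" by (rule generate_subgroup_incl[OF lT F_sub])
  \<comment> \<open>All that the lower subgroup has to contain: the commutators by which conjugation
    by \<open>Z\<close> moves the lifts, and the errors in writing \<open>S\<close> through the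
    lifts. All of these have weight \<open>Suc w\<close>.\<close>
  define S' where "S' = (\<lambda>(z, x). z \<otimes> x \<otimes> inv z \<otimes> inv x) ` (Z \<times> l ` T)
    \<union> (\<lambda>(z, x). inv z \<otimes> x \<otimes> z \<otimes> inv x) ` (Z \<times> l ` T) \<union> (\<lambda>s. s \<otimes> inv (h s)) ` S"
  have S'fin: "finite S'" using finZ T(1) step.prems(2) by (simp add: S'_def)
  have S'K: "S' \<subseteq> ?K"
  proof -
    have c: "z \<otimes> x \<otimes> inv z \<otimes> inv x \<in> ?K" if "z \<in> carrier G" "x \<in> F w" for z x
      using F_N[of "Suc 0" w z x] that step.prems(1) F_1 by simp
    have c2: "inv z \<otimes> x \<otimes> z \<otimes> inv x \<in> ?K" if "z \<in> carrier G" "x \<in> F w" for z x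
      using c[of "inv z" x] that by simp
    have c3: "s \<otimes> inv (h s) \<in> ?K" if "s \<in> S" for s
    proof -
      have hs: "h s \<in> F w" "?K #> h s = ?K #> s" using h that gen_F by auto
      have "s \<in> F w" using that step.prems(3) by blast
      then show ?thesis using K.rcos_eq_iff[OF Fc Fc[OF hs(1)], of s w] hs(2) by simp
    qed
    have lF: "l t \<in> F w" if "t \<in> T" for t using l that by blast
    have zG: "z \<in> carrier G" if "z \<in> Z" for z using ZG that by blast
    show ?thesis unfolding S'_def
      by (intro Un_least image_subsetI) (use c c2 c3 lF zG in auto)
  qed
  obtain N where N: "pc n N" "S' \<subseteq> N" "N \<subseteq> ?K" "\<forall>z\<in>Z. normalizes z N"
    using step.IH[OF _ S'fin S'K finZ ZG] by auto
  have Nsub: "subgroup N G" using pc_sub[OF N(1)] by blast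
  \<comment> \<open>The lifts are adjoined one at a time. The last conjunct bounds the image of
    \<open>H\<close> in \<open>V\<close>, so that independence of \<open>T\<close> can be applied to
    the next lift.\<close>
  have "\<exists>H. pc n H \<and> N \<subseteq> H \<and> l ` T0 \<subseteq> H \<and> H \<subseteq> F w \<and> (\<forall>z\<in>Z. normalizes z H) \<and> (\<forall>m\<in>H. ?K #> m \<in> generate V T0)"
    if "T0 \<subseteq> T" for T0
    using finite_subset[OF that T(1)] that
  proof (induction T0 rule: finite_induct)
    case empty
    have "?K #> m \<in> generate V {}" if "m \<in> N" for m
    proof -
      have "m \<in> F w" "m \<in> ?K" using that N(3) F_mono[of w "Suc w"] by auto
      then have "?K #> m = \<one>\<^bsub>V\<^esub>" using pi_one by simp
      then show ?thesis using generate.one by metis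
    qed
    moreover have "N \<subseteq> F w" using N(3) F_mono[of w "Suc w"] by auto
    ultimately show ?case using N by (intro exI[of _ N]) auto
  next
    case (insert t T0)
    then obtain H where H: "pc n H" "N \<subseteq> H" "l ` T0 \<subseteq> H" "H \<subseteq> F w" "\<forall>z\<in>Z. normalizes z H"
      "\<forall>m\<in>H. ?K #> m \<in> generate V T0" by auto
    have Hs: "subgroup H G" using pc_sub[OF H(1)] by blast
    have Hc: "m \<in> carrier G" if "m \<in> H" for m using subgroup.mem_carrier[OF Hs that] .
    define x where "x = l t"
    have t: "t \<in> T" using insert by simp
    have x: "x \<in> F w" "?K #> x = t" "x \<in> carrier G" "x \<in> Z" using l t Fc by (auto simp: x_def Z_def)
    have cx: "inv (x [^] (k::int)) \<otimes> m \<otimes> x [^] k \<in> H" if "m \<in> H" for m k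
      using normalizes_int_pow[of x H m k] H(5) x that Hc by auto
    have cx': "x [^] (k::int) \<otimes> m \<otimes> inv (x [^] k) \<in> H" if "m \<in> H" for m k
      using cx[OF that, of "- k"] x by (simp add: int_pow_neg)
    define H' where "H' = {x [^] k \<otimes> m | (k::int) m. m \<in> H}"
    have H'I: "x [^] k \<otimes> m \<in> H'" if "m \<in> H" for m and k :: int using that by (auto simp: H'_def)
    have HH': "H \<subseteq> H'"
    proof
      fix m assume m: "m \<in> H"
      show "m \<in> H'" using H'I[OF m, of 0] Hc[OF m] by simp
    qed
    have xH': "x \<in> H'" using H'I[OF subgroup.one_closed[OF Hs], of 1] x by simp
    have H's: "subgroup H' G"
    proof (rule subgroupI)
      show "H' \<subseteq> carrier G" using x Hc by (auto simp: H'_def)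
      show "H' \<noteq> {}" using xH' by blast
      fix a assume "a \<in> H'"
      then obtain k :: int and m where a: "a = x [^] k \<otimes> m" "m \<in> H" by (auto simp: H'_def)
      have mi: "inv m \<in> H" using subgroup.m_inv_closed[OF Hs a(2)] .
      have "inv a = x [^] (- k) \<otimes> (x [^] k \<otimes> inv m \<otimes> inv (x [^] k))"
        using a x Hc by (simp add: int_pow_neg inv_mult_group m_assoc cancel_left)
      then show "inv a \<in> H'" using H'I[OF cx'[OF mi]] by simp
      fix b assume "b \<in> H'"
      then obtain j :: int and q where b: "b = x [^] j \<otimes> q" "q \<in> H" by (auto simp: H'_def)
      have "a \<otimes> b = x [^] (k + j) \<otimes> ((inv (x [^] j) \<otimes> m \<otimes> x [^] j) \<otimes> q)"
        using a b x Hc by (simp add: int_pow_mult m_assoc cancel_left)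
      then show "a \<otimes> b \<in> H'" using H'I[OF subgroup.m_closed[OF Hs cx[OF a(2)] b(2)]] by simp
    qed
    \<comment> \<open>Modulo \<open>?K\<close> this is a power of \<open>t\<close> in the span of
      \<open>T0\<close>. It serves twice: the step is infinite cyclic, and elements of weight
      \<open>Suc w\<close> in \<open>H'\<close> already lie in \<open>H\<close>.\<close>
    have inf: "k = 0" if "x [^] k \<otimes> m \<in> ?K" "m \<in> H" for m and k :: int
    proof -
      have xk: "x [^] k \<in> F w" using subgroup_int_pow_closed[OF F_sub x(1)] .
      have mF: "m \<in> F w" using that H(4) by blast
      have "(?K #> x [^] k) \<otimes>\<^bsub>V\<^esub> (?K #> m) = \<one>\<^bsub>V\<^esub>"
        using pi_mult[OF xk mF] pi_one[OF subgroup.m_closed[OF F_sub xk mF]] that(1) by simp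
      then have "?K #> x [^] k = inv\<^bsub>V\<^esub> (?K #> m)"
        using V.inv_equality pi[OF mF] pi[OF xk] by metis
      moreover have "?K #> m \<in> generate V T0" using H(6) that(2) by blast
      moreover have T0V: "T0 \<subseteq> carrier V" using insert(4) T(2) by blast
      ultimately have "t [^]\<^bsub>V\<^esub> k \<in> generate V T0"
        using V.generate_m_inv_closed[OF T0V] pi_pow[OF x(1), of k] x(2) by simp
      then show "k = 0"
        using V.independent_power[OF ind T(1,2) insert(4) insert(2)] by blast
    qed
    have "cyclic_step G F H H' x w"
    proof (intro cyclic_step.intro cyclic_step_axioms.intro)
      show "N_series G F" by (rule N_series_axioms)
      show "subgroup H G" "subgroup H' G" "H \<subseteq> H'" "x \<in> H'" by (fact Hs, fact H's, fact HH', fact xH')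
      show "inv (x [^] k) \<otimes> m \<otimes> x [^] k \<in> H" if "m \<in> H" for m and k :: int using cx[OF that] .
      show "\<exists>k::int. \<exists>m\<in>H. h = x [^] k \<otimes> m" if "h \<in> H'" for h using that by (auto simp: H'_def)
      show "k = 0" if "x [^] k \<in> H" for k :: int
      proof -
        have "x [^] k \<otimes> inv (x [^] k) \<in> ?K" using x(3) K.one_closed by simp
        then show ?thesis using inf subgroup.m_inv_closed[OF Hs that] by blast
      qed
      show "1 \<le> w" by (fact step.prems(1))
      show "H' \<subseteq> F w"
        using subgroup.m_closed[OF F_sub subgroup_int_pow_closed[OF F_sub x(1)]] H(4) by (auto simp: H'_def)
      show "H' \<inter> F (Suc w) \<subseteq> H"
      proof
        fix a assume a: "a \<in> H' \<inter> F (Suc w)"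
        then obtain k :: int and m where km: "a = x [^] k \<otimes> m" "m \<in> H" by (auto simp: H'_def)
        then have "k = 0" using inf a by blast
        then show "a \<in> H" using km Hc by simp
      qed
    qed
    then have "pc n H'" using pc.step H(1) by blast
    moreover have "normalizes z H'" if z: "z \<in> Z" for z
    proof -
      have zc: "z \<in> carrier G" using z ZG by blast
      have xl: "x \<in> l ` T" using t by (simp add: x_def)
      \<comment> \<open>By the choice of \<open>S'\<close>, conjugation by \<open>z\<close> changes
        \<open>x\<close> only by a factor that is already in the subgroup.\<close>
      have "z \<otimes> x \<otimes> inv z \<otimes> inv x \<in> S'" "inv z \<otimes> x \<otimes> z \<otimes> inv x \<in> S'"
        unfolding S'_def using z xl by force+
      then have "z \<otimes> x \<otimes> inv z \<otimes> inv x \<in> H'" "inv z \<otimes> x \<otimes> z \<otimes> inv x \<in> H'"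
        using N(2) H(2) HH' by blast+
      then have "(z \<otimes> x \<otimes> inv z \<otimes> inv x) \<otimes> x \<in> H'" "(inv z \<otimes> x \<otimes> z \<otimes> inv x) \<otimes> x \<in> H'"
        using subgroup.m_closed[OF H's _ xH'] by blast+
      then have zx: "z \<otimes> x \<otimes> inv z \<in> H'" "inv z \<otimes> x \<otimes> z \<in> H'" using zc x(3) by (simp_all add: m_assoc)
      have cp: "g \<otimes> (x [^] k \<otimes> m) \<otimes> inv g = (g \<otimes> x \<otimes> inv g) [^] k \<otimes> (g \<otimes> m \<otimes> inv g)"
        if "g \<in> carrier G" "m \<in> H" for g m and k :: int
      proof -
        have "(g \<otimes> x \<otimes> inv g) [^] k = g \<otimes> x [^] k \<otimes> inv g"
          by (rule conj_int_pow[OF that(1) x(3)])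
        then show ?thesis using that Hc x(3) by (simp add: m_assoc cancel_left)
      qed
      show ?thesis
        unfolding normalizes_def
      proof
        fix a assume "a \<in> H'"
        then obtain k :: int and m where km: "a = x [^] k \<otimes> m" "m \<in> H" by (auto simp: H'_def)
        have "z \<otimes> m \<otimes> inv z \<in> H" "inv z \<otimes> m \<otimes> z \<in> H" using H(5) z km(2) by (auto simp: normalizes_def)
        then have zm: "z \<otimes> m \<otimes> inv z \<in> H'" "inv z \<otimes> m \<otimes> z \<in> H'" using HH' by blast+
        have "z \<otimes> a \<otimes> inv z \<in> H'"
          unfolding km(1) cp[OF zc km(2)]
          by (rule subgroup.m_closed[OF H's subgroup_int_pow_closed[OF H's zx(1)] zm(1)])
        moreover have "inv z \<otimes> a \<otimes> z \<in> H'"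
          using cp[OF inv_closed[OF zc] km(2), of k] zc km(1)
            subgroup.m_closed[OF H's subgroup_int_pow_closed[OF H's zx(2)] zm(2)] by simp
        ultimately show "z \<otimes> a \<otimes> inv z \<in> H' \<and> inv z \<otimes> a \<otimes> z \<in> H'" ..
      qed
    qed
    moreover have "?K #> a \<in> generate V (insert t T0)" if "a \<in> H'" for a
    proof -
      obtain k :: int and m where km: "a = x [^] k \<otimes> m" "m \<in> H" using \<open>a \<in> H'\<close> by (auto simp: H'_def)
      have iV: "insert t T0 \<subseteq> carrier V" using insert(4) T(2) by blast
      note gs = V.generate_is_subgroup[OF iV]
      have "?K #> m \<in> generate V (insert t T0)"
        using V.mono_generate[of T0 "insert t T0"] H(6) km(2) by blast
      moreover have "t [^]\<^bsub>V\<^esub> k \<in> generate V (insert t T0)"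
        by (rule V.subgroup_int_pow_closed[OF gs]) (auto intro: generate.incl)
      moreover have "?K #> a = t [^]\<^bsub>V\<^esub> k \<otimes>\<^bsub>V\<^esub> (?K #> m)"
        using pi_mult[OF subgroup_int_pow_closed[OF F_sub x(1)], of m k] H(4) km pi_pow[OF x(1), of k] x(2) by auto
      ultimately show ?thesis using subgroup.m_closed[OF gs] by metis
    qed
    moreover have "H' \<subseteq> F w"
      using subgroup.m_closed[OF F_sub subgroup_int_pow_closed[OF F_sub x(1)]] H(4) by (auto simp: H'_def)
    ultimately show ?case using H HH' xH' by (intro exI[of _ H']) (auto simp: x_def)
  qed
  from this[OF subset_refl] obtain H where H: "pc n H" "N \<subseteq> H" "l ` T \<subseteq> H" "H \<subseteq> F w" "\<forall>z\<in>Z. normalizes z H"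
    by blast
  have Hs: "subgroup H G" using pc_sub[OF H(1)] by blast
  have "S \<subseteq> H"
  proof
    fix s assume s: "s \<in> S"
    have "s \<otimes> inv (h s) \<in> H" using s N(2) H(2) by (auto simp: S'_def)
    moreover have hs: "h s \<in> H" using h s generate_subgroup_incl[OF H(3) Hs] by blast
    ultimately have "(s \<otimes> inv (h s)) \<otimes> h s \<in> H" by (rule subgroup.m_closed[OF Hs])
    then show "s \<in> H" using s step.prems(3) Fc subgroup.mem_carrier[OF Hs hs] by (auto simp: m_assoc)
  qed
  then show ?case using H by (auto simp: Z_def)
qed

end

section \<open>Polynomial functions separate the rational lower central series\<close>

definition fscale :: "rat \<Rightarrow> ('x \<Rightarrow> rat) \<Rightarrow> 'x \<Rightarrow> rat" where
  "fscale c f = (\<lambda>x. c * f x)"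

lemma vector_space_fscale: "vector_space (fscale :: rat \<Rightarrow> ('x \<Rightarrow> rat) \<Rightarrow> 'x \<Rightarrow> rat)"
  by unfold_locales (simp_all add: fscale_def fun_eq_iff algebra_simps)

interpretation fv: vector_space "fscale :: rat \<Rightarrow> ('x \<Rightarrow> rat) \<Rightarrow> 'x \<Rightarrow> rat"
  by (rule vector_space_fscale)

text \<open>A basis of the span of \<open>U\<close>, taken inside \<open>U\<close>, stays
  independent when \<open>v\<close> is added; the functional is the coordinate of
  \<open>v\<close>.\<close>

lemma separating_functional:
  fixes v :: "'x \<Rightarrow> rat"
  assumes v: "v \<notin> fv.span U"
  shows "\<exists>\<Phi> :: ('x \<Rightarrow> rat) \<Rightarrow> rat. (\<forall>f g. \<Phi> (\<lambda>x. f x - g x) = \<Phi> f - \<Phi> g) \<and> (\<forall>u\<in>U. \<Phi> u = 0) \<and> \<Phi> v = 1"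
proof -
  interpret vp: vector_space_pair "fscale :: rat \<Rightarrow> ('x \<Rightarrow> rat) \<Rightarrow> 'x \<Rightarrow> rat" "(*) :: rat \<Rightarrow> rat \<Rightarrow> rat"
    by unfold_locales (simp_all add: algebra_simps)
  obtain B where B: "B \<subseteq> U" "\<not> fv.dependent B" "U \<subseteq> fv.span B" by (rule fv.maximal_independent_subset)
  have "v \<notin> fv.span B" using v fv.span_mono[OF B(1)] by blast
  then have "\<not> fv.dependent (insert v B)" and vB: "v \<notin> B"
    using B(2) fv.independent_insertI fv.span_base by blast+
  then obtain \<Phi> where \<Phi>: "Vector_Spaces.linear fscale (*) \<Phi>" "\<forall>x\<in>insert v B. \<Phi> x = (if x = v then 1 else 0)"
    using vp.linear_independent_extend[of "insert v B" "\<lambda>x. if x = v then 1 else 0"] by blast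
  interpret L: Vector_Spaces.linear fscale "(*)" \<Phi> by (rule \<Phi>(1))
  have "\<Phi> u = 0" if "u \<in> U" for u
    using subsetD[OF B(3) that]
  proof (induction rule: fv.span_induct_alt)
    case base show ?case by (rule L.zero)
  next
    case (step c x y)
    then have "\<Phi> x = 0" using \<Phi>(2) vB by auto
    then show ?case unfolding L.add L.scale using step by simp
  qed
  moreover have "\<Phi> (\<lambda>x. f x - g x) = \<Phi> f - \<Phi> g" for f g
    using L.diff[of f g] by (simp add: fun_diff_def)
  ultimately show ?thesis using \<Phi>(2) by (intro exI[of _ \<Phi>]) auto
qed

section \<open>Unweighted polynomial functions and powers of the augmentation ideal\<close>

context group
begin

text \<open>As before, \<open>k\<close> is the degree plus one. These functions are dual to the
  group ring: the linear extension of \<open>p\<close> vanishes on all products of \<open>k\<close>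
  factors \<open>g - 1\<close> with a group element, which is \<open>upoly_iff\<close>.\<close>

fun upoly :: "'a set \<Rightarrow> nat \<Rightarrow> ('a \<Rightarrow> rat) \<Rightarrow> bool" where
  "upoly H 0 p \<longleftrightarrow> (\<forall>x\<in>H. p x = 0)"
| "upoly H (Suc k) p \<longleftrightarrow> (\<forall>g\<in>H. upoly H k (\<lambda>x. p (x \<otimes> g) - p x))"

lemma wpoly_imp_upoly:
  assumes "subgroup H G" "H \<subseteq> F (Suc 0)"
  shows "wpoly H F k p \<Longrightarrow> upoly H k p"
proof (induction k arbitrary: p)
  case (Suc k)
  have "wpoly H F (Suc k - Suc 0) (\<lambda>x. p (x \<otimes> g) - p x)" if "g \<in> H" for g
    by (rule wpoly_diff[OF assms(1) Suc.prems]) (use that assms(2) in auto)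
  then show ?case using Suc.IH by simp
qed (simp add: wpoly_0)

fun iter_diff :: "'a list \<Rightarrow> ('a \<Rightarrow> rat) \<Rightarrow> 'a \<Rightarrow> rat" where
  "iter_diff [] p x = p x"
| "iter_diff (g # gs) p x = iter_diff gs p (x \<otimes> g) - iter_diff gs p x"

text \<open>The element \<open>x (g\<^sub>1 - 1) \<cdots> (g\<^sub>k - 1)\<close> of the group ring.\<close>

fun ring_elt :: "'a list \<Rightarrow> 'a \<Rightarrow> 'a \<Rightarrow> rat" where
  "ring_elt [] x = delta x"
| "ring_elt (g # gs) x = (\<lambda>y. ring_elt gs (x \<otimes> g) y - ring_elt gs x y)"

text \<open>\<open>iter_diff\<close> removes the head of the list to match \<open>ring_elt\<close>,
  while the first difference taken by \<open>upoly\<close> corresponds to the last entry. This lemma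
  bridges the two orders.\<close>

lemma iter_diff_snoc: "iter_diff (gs @ [g]) p x = iter_diff gs (\<lambda>x. p (x \<otimes> g) - p x) x"
  by (induction gs arbitrary: x) simp_all

lemma upoly_iff:
  "upoly H k p \<longleftrightarrow> (\<forall>gs. length gs = k \<longrightarrow> set gs \<subseteq> H \<longrightarrow> (\<forall>x\<in>H. iter_diff gs p x = 0))"
proof (induction k arbitrary: p)
  case (Suc k)
  show ?case
  proof
    assume L: "upoly H (Suc k) p"
    show "\<forall>gs. length gs = Suc k \<longrightarrow> set gs \<subseteq> H \<longrightarrow> (\<forall>x\<in>H. iter_diff gs p x = 0)"
    proof (intro allI impI ballI)
      fix gs x assume gs: "length gs = Suc k" "set gs \<subseteq> H" and x: "x \<in> H"
      obtain hs g where hg: "gs = hs @ [g]" using gs(1) by (cases gs rule: rev_cases) auto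
      have "upoly H k (\<lambda>x. p (x \<otimes> g) - p x)" using L gs(2) hg by simp
      then have "iter_diff hs (\<lambda>x. p (x \<otimes> g) - p x) x = 0" using Suc gs hg x by simp
      then show "iter_diff gs p x = 0" by (simp add: hg iter_diff_snoc)
    qed
  next
    assume R: "\<forall>gs. length gs = Suc k \<longrightarrow> set gs \<subseteq> H \<longrightarrow> (\<forall>x\<in>H. iter_diff gs p x = 0)"
    have "upoly H k (\<lambda>x. p (x \<otimes> g) - p x)" if g: "g \<in> H" for g
    proof -
      have "iter_diff hs (\<lambda>x. p (x \<otimes> g) - p x) x = 0" if "length hs = k" "set hs \<subseteq> H" "x \<in> H" for hs x
        using R[rule_format, of "hs @ [g]" x] that g by (simp add: iter_diff_snoc)
      then show ?thesis using Suc by simp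
    qed
    then show "upoly H (Suc k) p" by simp
  qed
qed simp

lemma fin_supp_ring_elt: "fin_supp (ring_elt gs x)"
  by (induction gs arbitrary: x) (auto intro: fin_supp_diff)

lemma functional_ring_elt:
  assumes "\<And>f g. \<Phi> (\<lambda>y. f y - g y) = \<Phi> f - (\<Phi> g :: rat)"
  shows "\<Phi> (ring_elt gs x) = iter_diff gs (\<lambda>y. \<Phi> (delta y)) x"
  by (induction gs arbitrary: x) (simp_all add: assms)

lemma pairing_ring_elt: "lin (ring_elt gs x) (\<lambda>y _. p y) z = iter_diff gs p x"
proof (induction gs arbitrary: x)
  case (Cons g gs)
  then show ?case unfolding ring_elt.simps lin_diff[OF fin_supp_ring_elt fin_supp_ring_elt] by simp
qed simp

lemma fscale_supp: "{x. fscale c f x \<noteq> 0} \<subseteq> {x. f x \<noteq> 0}"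
  by (auto simp: fscale_def)

lemma fin_supp_fscale: "fin_supp f \<Longrightarrow> fin_supp (fscale c f)"
  unfolding fin_supp_def by (rule finite_subset[OF fscale_supp])

lemma lin_fscale:
  assumes "fin_supp f"
  shows "lin (fscale c f) g y = c * lin f g y"
proof -
  have "lin (fscale c f) g y = (\<Sum>x | f x \<noteq> 0. fscale c f x * g x y)"
    by (rule lin_superset[OF _ fscale_supp]) (use assms in \<open>simp add: fin_supp_def\<close>)
  then show ?thesis by (simp add: lin_def fscale_def sum_distrib_left mult.assoc)
qed

text \<open>The span is the \<open>k\<close>-th power of the augmentation ideal. An element of it is
  a finite combination and involves only the finitely many group elements collected in
  \<open>S\<close>, so functions polynomial on a subset containing \<open>S\<close> already
  annihilate it. The target \<open>()\<close> is a dummy that turns \<open>lin\<close> into a scalar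
  pairing.\<close>

lemma augmentation_power_local:
  assumes "f \<in> fv.span {ring_elt gs x | gs x. length gs = k \<and> set gs \<subseteq> carrier G \<and> x \<in> carrier G}"
  shows "fin_supp f \<and> (\<exists>S. finite S \<and> S \<subseteq> carrier G \<and>
    (\<forall>H p. S \<subseteq> H \<longrightarrow> upoly H k p \<longrightarrow> lin f (\<lambda>y _. p y) () = 0))"
  using assms
proof (induction rule: fv.span_induct_alt)
  case base
  show ?case by (auto simp: fin_supp_def lin_def intro!: exI[of _ "{}"])
next
  case (step c u f)
  from step(1) obtain gs x where gs: "u = ring_elt gs x" "length gs = k" "set gs \<subseteq> carrier G" "x \<in> carrier G" by blast
  from step(2) obtain S where S: "fin_supp f" "finite S" "S \<subseteq> carrier G"
    "\<And>H p. S \<subseteq> H \<Longrightarrow> upoly H k p \<Longrightarrow> lin f (\<lambda>y _. p y) () = 0" by blast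
  have fu: "fin_supp u" using gs fin_supp_ring_elt by simp
  have fcu: "fin_supp (fscale c u)" using fin_supp_fscale[OF fu] .
  have plus: "fscale c u + f = (\<lambda>x. fscale c u x + f x)" by (simp add: fun_eq_iff)
  have "lin (fscale c u + f) (\<lambda>y _. p y) () = 0" if "S \<union> set gs \<union> {x} \<subseteq> H" "upoly H k p" for H p
  proof -
    have "lin u (\<lambda>y _. p y) () = 0"
      unfolding gs(1) pairing_ring_elt using that gs(2) upoly_iff[of H k p] by simp
    then show ?thesis using that S(4)[of H p]
      unfolding plus lin_add[OF fcu S(1)] by (simp add: lin_fscale[OF fu])
  qed
  moreover have "finite (S \<union> set gs \<union> {x})" "S \<union> set gs \<union> {x} \<subseteq> carrier G" using S gs by auto
  moreover have "fin_supp (fscale c u + f)" unfolding plus by (rule fin_supp_add[OF fcu S(1)])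
  ultimately show ?case by (intro conjI exI[of _ "S \<union> set gs \<union> {x}"] allI impI)
qed

lemma N_series_Rlcs_QQ: "N_series G (Rlcs QQ G)"
proof (intro N_series.intro N_series_axioms.intro)
  show "group G" by (rule is_group)
  show "subgroup (Rlcs QQ G i) G" for i by (rule Rlcs_sub)
  show "Rlcs QQ G j \<subseteq> Rlcs QQ G i" if "i \<le> j" for i j using that by (rule Rlcs_antimono)
  show "Rlcs QQ G (Suc 0) = carrier G" by simp
  show "x \<otimes> y \<otimes> inv x \<otimes> inv y \<in> Rlcs QQ G (i + j)"
    if "1 \<le> i" "1 \<le> j" "x \<in> Rlcs QQ G i" "y \<in> Rlcs QQ G j" for i j x y using that by (rule Rlcs_QQ_N_series)
  show "x \<in> Rlcs QQ G i" if "x \<in> carrier G" "0 < (k::nat)" "x [^] k \<in> Rlcs QQ G i" for x k i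
    using that by (rule Rlcs_isolated)
qed

text \<open>It suffices that \<open>a - 1\<close> lies outside the power \<open>Suc n\<close> of the
  augmentation ideal: a functional that kills this power but not \<open>a - 1\<close> restricts to
  the required function on group elements. Membership would already be visible on a subgroup
  \<open>H\<close> with \<open>pc n H\<close>, where a weighted polynomial contradicts it.\<close>

theorem upoly_separates:
  assumes n: "1 \<le> n" and a: "a \<in> carrier G" "a \<notin> Rlcs QQ G (Suc n)"
  shows "\<exists>p. upoly (carrier G) (Suc n) p \<and> p a \<noteq> p \<one>"
proof -
  interpret N_series G "Rlcs QQ G" by (rule N_series_Rlcs_QQ)
  let ?U = "{ring_elt gs x | gs x. length gs = Suc n \<and> set gs \<subseteq> carrier G \<and> x \<in> carrier G}"
  let ?v = "\<lambda>y. delta a y - delta \<one> y"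
  have "?v \<notin> fv.span ?U"
  proof
    assume "?v \<in> fv.span ?U"
    note local = augmentation_power_local[OF this]
    obtain S where "finite S \<and> S \<subseteq> carrier G \<and>
        (\<forall>H p. S \<subseteq> H \<longrightarrow> upoly H (Suc n) p \<longrightarrow> lin ?v (\<lambda>y _. p y) () = 0)"
      using conjunct2[OF local] by (rule exE)
    then have S: "finite S" "S \<subseteq> carrier G"
      and kill: "\<And>H p. S \<subseteq> H \<Longrightarrow> upoly H (Suc n) p \<Longrightarrow> lin ?v (\<lambda>y _. p y) () = 0" by simp_all
    have fS: "finite (insert a S)" "insert a S \<subseteq> Rlcs QQ G 1" using S a by auto
    obtain H where H: "pc n H" "insert a S \<subseteq> H" using pc_exists[of 1 n "insert a S" "{}"] fS by auto
    obtain p where p: "wpoly H (Rlcs QQ G) (Suc n) p" "p a \<noteq> p \<one>"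
      using pc_separates[OF H(1) n _ a(2)] H(2) by blast
    have Hs: "subgroup H G" using pc_sub[OF H(1)] by blast
    have "upoly H (Suc n) p"
      by (rule wpoly_imp_upoly[OF Hs _ p(1)]) (use subgroup.subset[OF Hs] in simp)
    then have "lin ?v (\<lambda>y _. p y) () = 0" using kill[of H p] H(2) by simp
    then show False using p(2) by (simp add: lin_diff)
  qed
  then obtain \<Phi> :: "('a \<Rightarrow> rat) \<Rightarrow> rat" where
    "(\<forall>f g. \<Phi> (\<lambda>x. f x - g x) = \<Phi> f - \<Phi> g) \<and> (\<forall>u\<in>?U. \<Phi> u = 0) \<and> \<Phi> ?v = 1"
    by (rule separating_functional[THEN exE])
  then have \<Phi>: "\<And>f g. \<Phi> (\<lambda>x. f x - g x) = \<Phi> f - \<Phi> g" "\<And>u. u \<in> ?U \<Longrightarrow> \<Phi> u = 0" "\<Phi> ?v = 1"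
    by blast+
  have "upoly (carrier G) (Suc n) (\<lambda>y. \<Phi> (delta y))"
    unfolding upoly_iff
  proof (intro allI impI ballI)
    fix gs x assume "length gs = Suc n" "set gs \<subseteq> carrier G" "x \<in> carrier G"
    then have "\<Phi> (ring_elt gs x) = 0" by (intro \<Phi>(2)) blast
    then show "iter_diff gs (\<lambda>y. \<Phi> (delta y)) x = 0"
      using functional_ring_elt[where \<Phi> = \<Phi> and gs = gs and x = x, OF \<Phi>(1)] by simp
  qed
  moreover have "\<Phi> (delta a) \<noteq> \<Phi> (delta \<one>)" using \<Phi>(1)[of "delta a" "delta \<one>"] \<Phi>(3) by simp
  ultimately show ?thesis by blast
qed

end

section \<open>Unipotent operators on a filtered rational vector space\<close>

lemmas fun_apply = plus_fun_apply zero_fun_apply minus_apply uminus_apply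

text \<open>Used as rewrite rules, these would expand functions that occur as arguments of operators.\<close>

declare fun_apply [simp del]

locale filtered_space =
  fixes W :: "nat \<Rightarrow> ('x \<Rightarrow> rat) set" and n :: nat
  assumes W_0: "W 0 = {0}"
    and W_add: "p \<in> W k \<Longrightarrow> q \<in> W k \<Longrightarrow> p + q \<in> W k"
    and W_scale: "p \<in> W k \<Longrightarrow> fscale c p \<in> W k"
    and W_Suc: "W k \<subseteq> W (Suc k)"
begin

lemma W_mono: "j \<le> k \<Longrightarrow> W j \<subseteq> W k"
  by (rule lift_Suc_mono_le[of W, OF W_Suc])

lemma W_zero: "0 \<in> W k"
  using W_mono[of 0 k] W_0 by blast

lemma W_uminus: "p \<in> W k \<Longrightarrow> - p \<in> W k"
  using W_scale[of p k "-1"] by (simp add: fv.scale_minus_left)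

lemma W_diff: "p \<in> W k \<Longrightarrow> q \<in> W k \<Longrightarrow> p - q \<in> W k"
  using W_add[OF _ W_uminus, of p k q] by simp

abbreviation "Top \<equiv> W (Suc n)"

text \<open>The operators \<open>T\<close> for which \<open>T - 1\<close> lowers the filtration by
  \<open>i\<close>. Fixing everything off \<open>Top\<close> makes equality of functions the same as
  equality on \<open>Top\<close>. Additivity stands for linearity, as additive maps of rational
  vector spaces are linear.\<close>

definition ops :: "nat \<Rightarrow> (('x \<Rightarrow> rat) \<Rightarrow> ('x \<Rightarrow> rat)) set" where
  "ops i = {T. (\<forall>p. p \<notin> Top \<longrightarrow> T p = p) \<and> (\<forall>p\<in>Top. \<forall>q\<in>Top. T (p + q) = T p + T q) \<and>
     (\<forall>k\<le>Suc n. \<forall>p\<in>W k. T p - p \<in> W (k - i))}"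

lemma opsI:
  assumes "\<And>p. p \<notin> Top \<Longrightarrow> T p = p" "\<And>p q. p \<in> Top \<Longrightarrow> q \<in> Top \<Longrightarrow> T (p + q) = T p + T q"
    "\<And>k p. k \<le> Suc n \<Longrightarrow> p \<in> W k \<Longrightarrow> T p - p \<in> W (k - i)"
  shows "T \<in> ops i"
  using assms by (simp add: ops_def)

lemma ops_outside: "T \<in> ops i \<Longrightarrow> p \<notin> Top \<Longrightarrow> T p = p"
  and ops_add: "T \<in> ops i \<Longrightarrow> p \<in> Top \<Longrightarrow> q \<in> Top \<Longrightarrow> T (p + q) = T p + T q"
  and ops_lower: "T \<in> ops i \<Longrightarrow> k \<le> Suc n \<Longrightarrow> p \<in> W k \<Longrightarrow> T p - p \<in> W (k - i)"
  by (simp_all add: ops_def)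

lemma ops_antimono: "i \<le> j \<Longrightarrow> ops j \<subseteq> ops i"
  unfolding ops_def using W_mono[OF diff_le_mono2[of i j]] by blast

lemma W_Top: "k \<le> Suc n \<Longrightarrow> p \<in> W k \<Longrightarrow> p \<in> Top"
  using W_mono by blast

lemma ops_W:
  assumes "T \<in> ops i" "k \<le> Suc n" "p \<in> W k"
  shows "T p \<in> W k"
proof -
  have "T p - p \<in> W k" using ops_lower[OF assms] W_mono[of "k - i" k] by auto
  from W_add[OF this assms(3)] show ?thesis by simp
qed

lemma ops_Top: "T \<in> ops i \<Longrightarrow> p \<in> Top \<Longrightarrow> T p \<in> Top"
  by (rule ops_W) simp_all

lemma ops_zero: "T \<in> ops i \<Longrightarrow> T 0 = 0"
  using ops_add[of T i 0 0] W_zero by simp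

lemma ops_diff:
  assumes "T \<in> ops i" "p \<in> Top" "q \<in> Top"
  shows "T (p - q) = T p - T q"
  using ops_add[OF assms(1) W_diff[OF assms(2,3)] assms(3)] by simp

lemma ops_id: "id \<in> ops i"
  by (rule opsI) (simp_all add: W_zero)

lemma ops_comp:
  assumes S: "S \<in> ops i" and T: "T \<in> ops i"
  shows "S \<circ> T \<in> ops i"
proof (rule opsI)
  show "(S \<circ> T) p = p" if "p \<notin> Top" for p using that ops_outside[OF S] ops_outside[OF T] by simp
  show "(S \<circ> T) (p + q) = (S \<circ> T) p + (S \<circ> T) q" if "p \<in> Top" "q \<in> Top" for p q
    using that ops_add[OF S] ops_add[OF T] ops_Top[OF T] by simp
  show "(S \<circ> T) p - p \<in> W (k - i)" if "k \<le> Suc n" "p \<in> W k" for k p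
    using W_add[OF ops_lower[OF S that(1) ops_W[OF T that]] ops_lower[OF T that]] by simp
qed

text \<open>\<open>T p\<close> is \<open>p\<close> plus an error of lower degree; the error has a
  preimage by induction, and subtracting it from \<open>p\<close> corrects the value.\<close>

lemma ops_surj:
  assumes T: "T \<in> ops i" and i: "1 \<le> i"
  shows "k \<le> Suc n \<Longrightarrow> p \<in> W k \<Longrightarrow> \<exists>q\<in>W k. T q = p"
proof (induction k arbitrary: p)
  case 0
  then show ?case using ops_zero[OF T] by (simp add: W_0)
next
  case (Suc k)
  have le: "Suc k - i \<le> k" using i by simp
  have "T p - p \<in> W (Suc k - i)" using ops_lower[OF T Suc.prems] .
  then have "T p - p \<in> W k" using W_mono[OF le] by blast
  then obtain q where q: "q \<in> W k" "T q = T p - p" using Suc.IH Suc.prems by auto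
  have q': "q \<in> W (Suc k)" using q(1) W_Suc by blast
  have "T (p - q) = T p - T q"
    by (rule ops_diff[OF T W_Top[OF Suc.prems] W_Top[OF Suc.prems(1) q']])
  then have "T (p - q) = p" using q(2) by simp
  then show ?case using W_diff[OF Suc.prems(2) q'] by blast
qed

text \<open>If \<open>T p = 0\<close> then \<open>T p - p\<close> is \<open>- p\<close>, so
  \<open>p\<close> drops in degree until it vanishes.\<close>

lemma ops_inj:
  assumes T: "T \<in> ops i" and i: "1 \<le> i"
  shows "k \<le> Suc n \<Longrightarrow> p \<in> W k \<Longrightarrow> T p = 0 \<Longrightarrow> p = 0"
proof (induction k arbitrary: p)
  case 0
  then show ?case by (simp add: W_0)
next
  case (Suc k)
  have le: "Suc k - i \<le> k" using i by simp
  have "T p - p \<in> W (Suc k - i)" using ops_lower[OF T Suc.prems(1,2)] .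
  then have "T p - p \<in> W k" using W_mono[OF le] by blast
  then have "- p \<in> W k" using Suc.prems(3) by simp
  then have "p \<in> W k" using W_uminus[of "- p" k] by simp
  then show ?case using Suc by simp
qed

lemma ops_inverse:
  assumes T: "T \<in> ops i" and i: "1 \<le> i"
  shows "\<exists>S\<in>ops i. S \<circ> T = id"
proof -
  define S where "S p = (if p \<in> Top then (SOME q. q \<in> Top \<and> T q = p) else p)" for p
  have inj: "p = q" if "p \<in> Top" "q \<in> Top" "T p = T q" for p q
    using ops_inj[OF T i le_refl W_diff[OF that(1,2)]] ops_diff[OF T that(1,2)] that(3) by simp
  have S: "S p \<in> Top \<and> T (S p) = p" if "p \<in> Top" for p
    unfolding S_def using that someI_ex[of "\<lambda>q. q \<in> Top \<and> T q = p"] ops_surj[OF T i le_refl that] by auto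
  \<comment> \<open>\<open>ops_surj\<close> finds preimages within each \<open>W k\<close>, so the
    inverse respects the filtration level by level.\<close>
  have S_W: "S p \<in> W k" if k: "k \<le> Suc n" and p: "p \<in> W k" for k p
  proof -
    obtain q where q: "q \<in> W k" "T q = p" using ops_surj[OF T i k p] by blast
    have "S p = q" by (rule inj) (use S[OF W_Top[OF k p]] q W_Top[OF k] in auto)
    then show ?thesis using q by simp
  qed
  have "S \<in> ops i"
  proof (rule opsI)
    show "S p = p" if "p \<notin> Top" for p using that by (simp add: S_def)
    show "S (p + q) = S p + S q" if pq: "p \<in> Top" "q \<in> Top" for p q
    proof (rule inj)
      show "S (p + q) \<in> Top" "S p + S q \<in> Top" using S W_add pq by auto
      show "T (S (p + q)) = T (S p + S q)" using S[OF W_add[OF pq]] S[OF pq(1)] S[OF pq(2)] ops_add[OF T] by simp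
    qed
    show "S p - p \<in> W (k - i)" if k: "k \<le> Suc n" and p: "p \<in> W k" for k p
    proof -
      have "T (S p) - S p \<in> W (k - i)" by (rule ops_lower[OF T k S_W[OF k p]])
      then have "p - S p \<in> W (k - i)" using S[OF W_Top[OF k p]] by simp
      then show ?thesis using W_uminus[of "p - S p" "k - i"] by simp
    qed
  qed
  moreover have "S \<circ> T = id"
  proof
    fix p show "(S \<circ> T) p = id p"
    proof (cases "p \<in> Top")
      case True
      have "S (T p) = p" by (rule inj) (use S[OF ops_Top[OF T True]] True in auto)
      then show ?thesis by simp
    qed (simp add: ops_outside[OF T] S_def)
  qed
  ultimately show ?thesis by blast
qed

definition E :: "(('x \<Rightarrow> rat) \<Rightarrow> ('x \<Rightarrow> rat)) monoid" where
  "E = \<lparr>carrier = ops 1, monoid.mult = (\<circ>), one = id\<rparr>"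

lemma E_simps [simp]: "carrier E = ops 1" "S \<otimes>\<^bsub>E\<^esub> T = S \<circ> T" "\<one>\<^bsub>E\<^esub> = id"
  by (simp_all add: E_def)

sublocale E: group E
proof (rule groupI)
  fix T assume "T \<in> carrier E"
  then show "\<exists>S\<in>carrier E. S \<otimes>\<^bsub>E\<^esub> T = \<one>\<^bsub>E\<^esub>" using ops_inverse[of T 1] by simp
qed (auto simp: ops_comp ops_id comp_assoc)

lemma ops_carrier: "1 \<le> i \<Longrightarrow> T \<in> ops i \<Longrightarrow> T \<in> carrier E"
  using ops_antimono[of 1 i] by auto

lemma ops_inv:
  assumes T: "T \<in> ops i" and i: "1 \<le> i"
  shows "inv\<^bsub>E\<^esub> T \<in> ops i"
proof -
  obtain S where S: "S \<in> ops i" "S \<circ> T = id" using ops_inverse[OF assms] by blast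
  have "inv\<^bsub>E\<^esub> T = S"
    by (rule E.inv_equality) (use S ops_carrier[OF i] T in auto)
  then show ?thesis using S by simp
qed

lemma ops_subgroup:
  assumes i: "1 \<le> i" shows "subgroup (ops i) E"
proof (rule E.subgroupI)
  show "ops i \<subseteq> carrier E" using ops_carrier[OF i] by blast
  show "ops i \<noteq> {}" using ops_id by blast
qed (use ops_inv i ops_comp in auto)

text \<open>Substituting \<open>T p\<close>, or its preimage, for \<open>p\<close> translates one
  side into the other, because both maps preserve every \<open>W k\<close>. Congruence modulo
  \<open>ops i\<close> is thus tested without computing inverses.\<close>

lemma ops_cong:
  assumes S: "S \<in> carrier E" and T: "T \<in> carrier E" and i: "1 \<le> i"
  shows "S \<otimes>\<^bsub>E\<^esub> inv\<^bsub>E\<^esub> T \<in> ops i \<longleftrightarrow> (\<forall>k\<le>Suc n. \<forall>p\<in>W k. S p - T p \<in> W (k - i))"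
proof -
  have T1: "T \<in> ops 1" and S1: "S \<in> ops 1" using S T by auto
  have I1: "inv\<^bsub>E\<^esub> T \<in> ops 1" using ops_inv[OF T1] by simp
  have IT: "(inv\<^bsub>E\<^esub> T) (T p) = p" for p using E.l_inv[OF T] by (simp add: fun_eq_iff)
  have TI: "T ((inv\<^bsub>E\<^esub> T) p) = p" for p using E.r_inv[OF T] by (simp add: fun_eq_iff)
  have "S \<circ> inv\<^bsub>E\<^esub> T \<in> ops 1" by (rule ops_comp[OF S1 I1])
  then have "S \<circ> inv\<^bsub>E\<^esub> T \<in> ops i \<longleftrightarrow> (\<forall>k\<le>Suc n. \<forall>p\<in>W k. S ((inv\<^bsub>E\<^esub> T) p) - p \<in> W (k - i))"
    by (simp add: ops_def)
  also have "\<dots> \<longleftrightarrow> (\<forall>k\<le>Suc n. \<forall>p\<in>W k. S p - T p \<in> W (k - i))"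
  proof (intro iffI allI impI ballI)
    fix k p assume L: "\<forall>k\<le>Suc n. \<forall>p\<in>W k. S ((inv\<^bsub>E\<^esub> T) p) - p \<in> W (k - i)" and k: "k \<le> Suc n" and p: "p \<in> W k"
    show "S p - T p \<in> W (k - i)" using L[rule_format, OF k ops_W[OF T1 k p]] by (simp add: IT)
  next
    fix k p assume R: "\<forall>k\<le>Suc n. \<forall>p\<in>W k. S p - T p \<in> W (k - i)" and k: "k \<le> Suc n" and p: "p \<in> W k"
    show "S ((inv\<^bsub>E\<^esub> T) p) - p \<in> W (k - i)" using R[rule_format, OF k ops_W[OF I1 k p]] by (simp add: TI)
  qed
  finally show ?thesis by simp
qed

text \<open>With \<open>x = 1 + \<xi>\<close> and \<open>y = 1 + \<eta>\<close> the products
  \<open>x y\<close> and \<open>y x\<close> differ by \<open>\<xi> \<eta> - \<eta> \<xi>\<close>,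
  and each summand lowers the degree by \<open>i + 1\<close>.\<close>

lemma ops_commutator:
  assumes i: "1 \<le> i" and x: "x \<in> carrier E" and y: "y \<in> ops i"
  shows "x \<otimes>\<^bsub>E\<^esub> y \<otimes>\<^bsub>E\<^esub> inv\<^bsub>E\<^esub> x \<otimes>\<^bsub>E\<^esub> inv\<^bsub>E\<^esub> y \<in> ops (Suc i)"
proof -
  have yc: "y \<in> carrier E" using y ops_carrier i by blast
  have x1: "x \<in> ops 1" using x by simp
  have "(x \<otimes>\<^bsub>E\<^esub> y) p - (y \<otimes>\<^bsub>E\<^esub> x) p \<in> W (k - Suc i)" if k: "k \<le> Suc n" and p: "p \<in> W k" for k p
  proof -
    define j where "j = y p - p"
    define l where "l = x p - p"
    have j: "j \<in> W (k - i)" unfolding j_def by (rule ops_lower[OF y k p])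
    have l: "l \<in> W (k - 1)" unfolding l_def by (rule ops_lower[OF x1 k p])
    have ki: "k - i \<le> Suc n" "k - 1 \<le> Suc n" using k by auto
    have pT: "p \<in> Top" "j \<in> Top" "l \<in> Top" using W_Top[OF k p] W_Top[OF ki(1) j] W_Top[OF ki(2) l] by auto
    have "x (y p) = x p + x j" using ops_add[OF x1 pT(1,2)] by (simp add: j_def)
    moreover have "y (x p) = y p + y l" using ops_add[OF y pT(1,3)] by (simp add: l_def)
    ultimately have "(x \<otimes>\<^bsub>E\<^esub> y) p - (y \<otimes>\<^bsub>E\<^esub> x) p = (x j - j) - (y l - l)"
      by (simp add: j_def l_def algebra_simps)
    moreover have "x j - j \<in> W (k - Suc i)" using ops_lower[OF x1 ki(1) j] by simp
    moreover have "y l - l \<in> W (k - Suc i)" using ops_lower[OF y ki(2) l] by simp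
    ultimately show ?thesis using W_diff by simp
  qed
  then have "(x \<otimes>\<^bsub>E\<^esub> y) \<otimes>\<^bsub>E\<^esub> inv\<^bsub>E\<^esub> (y \<otimes>\<^bsub>E\<^esub> x) \<in> ops (Suc i)"
    using ops_cong[OF E.m_closed[OF x yc] E.m_closed[OF yc x], of "Suc i"] by simp
  then show ?thesis
    unfolding E.inv_mult_group[OF yc x] using x yc by (simp add: E.m_assoc del: E_simps)
qed

lemma ops_normal:
  assumes i: "1 \<le> i" shows "ops i \<lhd> E"
proof (rule E.normal_invI[OF ops_subgroup[OF i]])
  fix x h assume x: "x \<in> carrier E" and h: "h \<in> ops i"
  have hc: "h \<in> carrier E" using h ops_carrier i by blast
  have "x \<otimes>\<^bsub>E\<^esub> h \<otimes>\<^bsub>E\<^esub> inv\<^bsub>E\<^esub> x \<otimes>\<^bsub>E\<^esub> inv\<^bsub>E\<^esub> h \<in> ops i"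
    using ops_commutator[OF i x h] ops_antimono[of i "Suc i"] by auto
  from subgroup.m_closed[OF ops_subgroup[OF i] this h]
  show "x \<otimes>\<^bsub>E\<^esub> h \<otimes>\<^bsub>E\<^esub> inv\<^bsub>E\<^esub> x \<in> ops i" using x hc by (simp add: E.m_assoc del: E_simps)
qed

text \<open>The operator \<open>1 + q (T - 1)\<close>: the first-order part of the binomial series
  for the \<open>q\<close>-th power of \<open>T\<close>, which is all that matters modulo
  \<open>ops (Suc i)\<close>.\<close>

definition sm :: "rat \<Rightarrow> (('x \<Rightarrow> rat) \<Rightarrow> ('x \<Rightarrow> rat)) \<Rightarrow> ('x \<Rightarrow> rat) \<Rightarrow> ('x \<Rightarrow> rat)" where
  "sm q T p = (if p \<in> Top then p + fscale q (T p - p) else p)"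

lemma sm_ops:
  assumes T: "T \<in> ops i" shows "sm q T \<in> ops i"
proof (rule opsI)
  show "sm q T p = p" if "p \<notin> Top" for p using that by (simp add: sm_def)
  show "sm q T (p + r) = sm q T p + sm q T r" if "p \<in> Top" "r \<in> Top" for p r
    using that W_add[OF that] ops_add[OF T that]
    by (simp add: sm_def fv.scale_right_distrib fv.scale_right_diff_distrib)
  show "sm q T p - p \<in> W (k - i)" if "k \<le> Suc n" "p \<in> W k" for k p
    using W_scale[OF ops_lower[OF T that], of q] W_Top[OF that] by (simp add: sm_def)
qed

text \<open>The maximum makes the term of index 0 the whole group, since \<open>ops 0\<close> can
  contain operators that are not invertible. The module laws hold on the factors because every error
  is of second order in operators \<open>T - 1\<close> with \<open>T\<close> in
  \<open>ops i\<close>.\<close>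

lemma R_series_ops: "R_series E QQ n (\<lambda>i. ops (max 1 i))"
proof (intro R_series.intro R_series_axioms.intro)
  show "group E" by (rule E.is_group)
  show "ops (max 1 i) \<lhd> E" for i by (rule ops_normal) simp
  show "ops (max 1 (Suc 0)) = carrier E" by simp
  show "ops (max 1 (Suc i)) \<subseteq> ops (max 1 i)" for i by (rule ops_antimono) simp
  show "x \<otimes>\<^bsub>E\<^esub> y \<otimes>\<^bsub>E\<^esub> inv\<^bsub>E\<^esub> x \<otimes>\<^bsub>E\<^esub> inv\<^bsub>E\<^esub> y \<in> ops (max 1 (Suc i))"
    if "1 \<le> i" "x \<in> carrier E" "y \<in> ops (max 1 i)" for i x y
    using ops_commutator[of i x y] that by (simp add: max_def split: if_splits)
  fix i :: nat assume i: "1 \<le> i" "i \<le> n"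
  have mi: "max 1 i = i" "max 1 (Suc i) = Suc i" using i by auto
  let ?N = "ops (Suc i)"
  interpret N: normal ?N E by (rule ops_normal) simp
  define M where "M = (E Mod ?N)\<lparr>carrier := (\<lambda>T. ?N #>\<^bsub>E\<^esub> T) ` ops i\<rparr>"
  have oc: "T \<in> carrier E" if "T \<in> ops i" for T using ops_carrier[OF i(1) that] .
  interpret M: comm_group M
    unfolding M_def
    by (rule E.quotient_comm_group[OF N.normal_axioms ops_subgroup[OF i(1)]])
      (use ops_commutator[OF i(1)] oc in blast)
  have cong: "?N #>\<^bsub>E\<^esub> S = ?N #>\<^bsub>E\<^esub> T \<longleftrightarrow> (\<forall>k\<le>Suc n. \<forall>p\<in>W k. S p - T p \<in> W (k - Suc i))"
    if "S \<in> ops i" "T \<in> ops i" for S T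
    using N.rcos_eq_iff[OF oc[OF that(1)] oc[OF that(2)]] ops_cong[OF oc[OF that(1)] oc[OF that(2)], of "Suc i"] by simp
  define rep where "rep U = (SOME T. T \<in> ops i \<and> U = ?N #>\<^bsub>E\<^esub> T)" for U
  define SM where "SM q U = ?N #>\<^bsub>E\<^esub> sm q (rep U)" for q U
  have SM: "SM q (?N #>\<^bsub>E\<^esub> T) = ?N #>\<^bsub>E\<^esub> sm q T" if T: "T \<in> ops i" for q T
  proof -
    have r: "rep (?N #>\<^bsub>E\<^esub> T) \<in> ops i \<and> ?N #>\<^bsub>E\<^esub> T = ?N #>\<^bsub>E\<^esub> rep (?N #>\<^bsub>E\<^esub> T)"
      unfolding rep_def by (rule someI[of _ T]) (use T in simp)
    define S where "S = rep (?N #>\<^bsub>E\<^esub> T)"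
    have S: "S \<in> ops i" "?N #>\<^bsub>E\<^esub> S = ?N #>\<^bsub>E\<^esub> T" using r by (simp_all add: S_def)
    have "sm q S p - sm q T p \<in> W (k - Suc i)" if k: "k \<le> Suc n" and p: "p \<in> W k" for k p
    proof -
      have "S p - T p \<in> W (k - Suc i)" using cong[OF S(1) T] S(2) k p by blast
      then have "fscale q (S p - T p) \<in> W (k - Suc i)" by (rule W_scale)
      then show ?thesis using W_Top[OF k p] by (simp add: sm_def fv.scale_right_diff_distrib)
    qed
    then have "?N #>\<^bsub>E\<^esub> sm q S = ?N #>\<^bsub>E\<^esub> sm q T" using cong[OF sm_ops[OF S(1)] sm_ops[OF T]] by blast
    then show ?thesis by (simp add: SM_def S_def)
  qed
  \<comment> \<open>Second-order terms lower the degree by \<open>i + i\<close>, which is at least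
    \<open>Suc i\<close>.\<close>
  have lower2: "p \<in> W (k - Suc i)" if "p \<in> W (k - i - i)" for p k
  proof -
    have "k - i - i \<le> k - Suc i" using i(1) by simp
    then show ?thesis using that W_mono by blast
  qed
  have sm_plus: "?N #>\<^bsub>E\<^esub> sm (q + r) T = ?N #>\<^bsub>E\<^esub> (sm q T \<otimes>\<^bsub>E\<^esub> sm r T)" if T: "T \<in> ops i" for q r T
  proof -
    have "sm (q + r) T p - (sm q T \<otimes>\<^bsub>E\<^esub> sm r T) p \<in> W (k - Suc i)" if k: "k \<le> Suc n" and p: "p \<in> W k" for k p
    proof -
      define j where "j = T p - p"
      have rj: "fscale r j \<in> W (k - i)" unfolding j_def by (rule W_scale[OF ops_lower[OF T k p]])
      have ki: "k - i \<le> Suc n" using k by simp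
      have pT: "p \<in> Top" "fscale r j \<in> Top" using W_Top[OF k p] W_Top[OF ki rj] by auto
      define l where "l = T (fscale r j) - fscale r j"
      have l: "fscale q l \<in> W (k - Suc i)" unfolding l_def by (rule W_scale[OF lower2[OF ops_lower[OF T ki rj]]])
      have "T (p + fscale r j) = T p + T (fscale r j)" by (rule ops_add[OF T pT])
      then have "T (p + fscale r j) - (p + fscale r j) = j + l" by (simp add: j_def l_def algebra_simps)
      then have "sm q T (p + fscale r j) = p + fscale r j + fscale q (j + l)"
        using W_add[OF pT] by (simp add: sm_def)
      then have "sm (q + r) T p - (sm q T \<otimes>\<^bsub>E\<^esub> sm r T) p = - fscale q l"
        using pT by (simp add: sm_def[of r] sm_def[of "q + r"] j_def[symmetric] fv.scale_left_distrib fv.scale_right_distrib)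
      then show ?thesis using W_uminus[OF l] by simp
    qed
    then show ?thesis using cong[OF sm_ops[OF T]] ops_comp[OF sm_ops[OF T] sm_ops[OF T]] by simp
  qed
  have sm_comp: "?N #>\<^bsub>E\<^esub> sm q (S \<otimes>\<^bsub>E\<^esub> T) = ?N #>\<^bsub>E\<^esub> (sm q S \<otimes>\<^bsub>E\<^esub> sm q T)" if S: "S \<in> ops i" and T: "T \<in> ops i" for q S T
  proof -
    have "sm q (S \<otimes>\<^bsub>E\<^esub> T) p - (sm q S \<otimes>\<^bsub>E\<^esub> sm q T) p \<in> W (k - Suc i)" if k: "k \<le> Suc n" and p: "p \<in> W k" for k p
    proof -
      define j where "j = T p - p"
      have j: "j \<in> W (k - i)" unfolding j_def by (rule ops_lower[OF T k p])
      have qj: "fscale q j \<in> W (k - i)" by (rule W_scale[OF j])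
      have ki: "k - i \<le> Suc n" using k by simp
      have pT: "p \<in> Top" "fscale q j \<in> Top" "j \<in> Top" using W_Top[OF k p] W_Top[OF ki qj] W_Top[OF ki j] by auto
      define l where "l = S (fscale q j) - fscale q j"
      define m where "m = S j - j"
      have lm: "fscale q (m - l) \<in> W (k - Suc i)" unfolding l_def m_def
        by (rule W_scale[OF W_diff[OF lower2[OF ops_lower[OF S ki j]] lower2[OF ops_lower[OF S ki qj]]]])
      have "S (T p) = S p + S j" using ops_add[OF S pT(1,3)] by (simp add: j_def)
      then have 1: "S (T p) - p = (S p - p) + j + m" by (simp add: m_def)
      have "S (p + fscale q j) = S p + S (fscale q j)" by (rule ops_add[OF S pT(1,2)])
      then have "S (p + fscale q j) - (p + fscale q j) = (S p - p) + l" by (simp add: l_def algebra_simps)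
      then have 2: "sm q S (p + fscale q j) = p + fscale q j + fscale q ((S p - p) + l)"
        using W_add[OF pT(1,2)] by (simp add: sm_def)
      have "sm q (S \<otimes>\<^bsub>E\<^esub> T) p = p + fscale q ((S p - p) + j + m)" using pT 1 by (simp add: sm_def)
      moreover have "(sm q S \<otimes>\<^bsub>E\<^esub> sm q T) p = p + fscale q j + fscale q ((S p - p) + l)"
        using pT 2 by (simp add: sm_def[of q T] j_def[symmetric])
      ultimately have "sm q (S \<otimes>\<^bsub>E\<^esub> T) p - (sm q S \<otimes>\<^bsub>E\<^esub> sm q T) p = fscale q (m - l)"
        by (simp add: fv.scale_right_distrib fv.scale_right_diff_distrib)
      then show ?thesis using lm by simp
    qed
    then show ?thesis
      using cong[OF sm_ops ops_comp[OF sm_ops sm_ops]] ops_comp[OF S T] S T by (simp add: ops_comp sm_ops)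
  qed
  have Mc: "\<exists>T. T \<in> ops i \<and> U = ?N #>\<^bsub>E\<^esub> T" if "U \<in> carrier M" for U using that by (auto simp: M_def)
  have Mm: "(?N #>\<^bsub>E\<^esub> S) \<otimes>\<^bsub>M\<^esub> (?N #>\<^bsub>E\<^esub> T) = ?N #>\<^bsub>E\<^esub> (S \<otimes>\<^bsub>E\<^esub> T)" if "S \<in> ops i" "T \<in> ops i" for S T
    using N.rcos_sum[OF oc[OF that(1)] oc[OF that(2)]] by (simp add: M_def)
  have Mi: "?N #>\<^bsub>E\<^esub> T \<in> carrier M" if "T \<in> ops i" for T using that by (simp add: M_def)
  have "coeff_module M QQ SM"
  proof (intro coeff_module.intro coeff_module_axioms.intro)
    show "comm_group M" by (rule M.comm_group_axioms)
    fix q r :: rat and U assume "U \<in> carrier M"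
    then obtain T where T: "T \<in> ops i" "U = ?N #>\<^bsub>E\<^esub> T" using Mc by blast
    show "SM q U \<in> carrier M" using Mi[OF sm_ops[OF T(1)]] by (simp add: T SM)
    show "SM (q + r) U = SM q U \<otimes>\<^bsub>M\<^esub> SM r U"
      using sm_plus[OF T(1)] Mm[OF sm_ops[OF T(1)] sm_ops[OF T(1)]] by (simp add: T SM)
    show "SM q (U \<otimes>\<^bsub>M\<^esub> V) = SM q U \<otimes>\<^bsub>M\<^esub> SM q V" if V: "V \<in> carrier M" for V
    proof -
      obtain S where S: "S \<in> ops i" "V = ?N #>\<^bsub>E\<^esub> S" using Mc[OF V] by blast
      have TS: "T \<otimes>\<^bsub>E\<^esub> S \<in> ops i" using ops_comp[OF T(1) S(1)] by simp
      show ?thesis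
        unfolding T(2) S(2) Mm[OF T(1) S(1)] SM[OF TS] SM[OF T(1)] SM[OF S(1)] Mm[OF sm_ops[OF T(1)] sm_ops[OF S(1)]]
        by (rule sm_comp[OF T(1) S(1)])
    qed
    have "sm 1 T = T" using ops_outside[OF T(1)] by (auto simp: sm_def)
    then show "SM 1 U = U" by (simp add: T SM)
    have "sm 0 T = id" by (auto simp: sm_def)
    then show "SM q U = \<one>\<^bsub>M\<^esub>" if "q \<in> coeff_ideal QQ"
      using that N.rcos_self_iff[OF E.one_closed] N.one_closed by (simp add: T SM M_def coeff_ideal_def)
  qed
  then show "\<exists>sm. coeff_module ((E Mod (ops (max 1 (Suc i))))\<lparr>carrier := (\<lambda>T. ops (max 1 (Suc i)) #>\<^bsub>E\<^esub> T) ` ops (max 1 i)\<rparr>) QQ sm"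
    unfolding mi M_def by blast
qed

end

section \<open>Stability of the R-lower central series\<close>

context group
begin

section \<open>Polynomial functions as a filtered space with translations\<close>

lemma upoly_add: "upoly H k p \<Longrightarrow> upoly H k q \<Longrightarrow> upoly H k (\<lambda>x. p x + q x)"
proof (induction k arbitrary: p q)
  case (Suc k)
  have "upoly H k (\<lambda>x. (p (x \<otimes> g) - p x) + (q (x \<otimes> g) - q x))" if "g \<in> H" for g
    using Suc that by simp
  then show ?case by (simp add: algebra_simps)
qed simp

lemma upoly_scale: "upoly H k p \<Longrightarrow> upoly H k (\<lambda>x. c * p x)"
proof (induction k arbitrary: p)
  case (Suc k)
  have "upoly H k (\<lambda>x. c * (p (x \<otimes> g) - p x))" if "g \<in> H" for g
    using Suc that by simp
  then show ?case by (simp add: algebra_simps)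
qed simp

lemma upoly_cong: "subgroup H G \<Longrightarrow> (\<And>x. x \<in> H \<Longrightarrow> p x = q x) \<Longrightarrow> upoly H k p = upoly H k q"
proof (induction k arbitrary: p q)
  case (Suc k)
  have "upoly H k (\<lambda>x. p (x \<otimes> g) - p x) = upoly H k (\<lambda>x. q (x \<otimes> g) - q x)" if "g \<in> H" for g
    by (rule Suc.IH[OF Suc.prems(1)]) (use Suc.prems that subgroup.m_closed[OF Suc.prems(1)] in auto)
  then show ?case by simp
qed simp

lemma upoly_Suc: "subgroup H G \<Longrightarrow> upoly H k p \<Longrightarrow> upoly H (Suc k) p"
proof (induction k arbitrary: p)
  case 0 then show ?case using subgroup.m_closed by fastforce
next
  case (Suc k)
  have "upoly H (Suc k) (\<lambda>x. p (x \<otimes> g) - p x)" if "g \<in> H" for g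
    by (rule Suc.IH[OF Suc.prems(1)]) (use Suc.prems(2) that in simp)
  then show ?case by (simp only: upoly.simps(2)[of _ "Suc k"]) simp
qed

text \<open>Vanishing off the carrier makes a function determined by its values on the group, so
  that degree index 0 leaves only the zero function.\<close>

definition poly_fun :: "nat \<Rightarrow> ('a \<Rightarrow> rat) set" where
  "poly_fun k = {p. upoly (carrier G) k p \<and> (\<forall>x. x \<notin> carrier G \<longrightarrow> p x = 0)}"

text \<open>Right translation, so that \<open>g\<close> followed by \<open>h\<close> in a product
  acts as the composite in the same order and a homomorphism results.\<close>

definition translate :: "'a \<Rightarrow> ('a \<Rightarrow> rat) \<Rightarrow> 'a \<Rightarrow> rat" where
  "translate g p = (\<lambda>x. if x \<in> carrier G then p (x \<otimes> g) else 0)"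

lemma filtered_poly_fun: "filtered_space poly_fun"
proof
  show "poly_fun 0 = {0}" by (auto simp: poly_fun_def fun_eq_iff fun_apply) blast
  fix k
  show "p + q \<in> poly_fun k" if "p \<in> poly_fun k" "q \<in> poly_fun k" for p q
    using that upoly_add[of "carrier G" k p q] by (auto simp: poly_fun_def plus_fun_def)
  show "fscale c p \<in> poly_fun k" if "p \<in> poly_fun k" for c p
    using that upoly_scale by (auto simp: poly_fun_def fscale_def)
  show "poly_fun k \<subseteq> poly_fun (Suc k)"
    using upoly_Suc[OF subgroup_self] by (auto simp: poly_fun_def simp del: upoly.simps)
qed

lemma translate_lower:
  assumes "p \<in> poly_fun k" "g \<in> carrier G"
  shows "translate g p - p \<in> poly_fun (k - 1)"
proof (cases k)
  case 0
  then show ?thesis using assms by (auto simp: poly_fun_def translate_def fun_apply)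
next
  case (Suc k')
  have "upoly (carrier G) k' (\<lambda>x. p (x \<otimes> g) - p x)" using assms Suc by (simp add: poly_fun_def)
  then have "upoly (carrier G) k' (translate g p - p)"
    using upoly_cong[OF subgroup_self, of "\<lambda>x. p (x \<otimes> g) - p x" "translate g p - p"] by (simp add: translate_def fun_apply)
  then show ?thesis using assms Suc by (simp add: poly_fun_def translate_def fun_apply)
qed

end

text \<open>Lifting places the translation by \<open>a\<close> in \<open>ops (Suc n)\<close>, so it
  fixes every polynomial function of degree at most \<open>n\<close>. If \<open>a\<close> were
  outside the rational series, some such function would distinguish \<open>a\<close> from
  \<open>\<one>\<close>.\<close>

theorem Rlcs_QQ_reflected:
  assumes "group A" "group B" "1 \<le> n" "Dwyer QQ n A B f" "a \<in> carrier A" "f a \<in> Rlcs QQ B (Suc n)"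
  shows "a \<in> Rlcs QQ A (Suc n)"
proof (rule ccontr)
  assume na: "a \<notin> Rlcs QQ A (Suc n)"
  interpret A: group A by fact
  interpret B: group B by fact
  interpret W: filtered_space A.poly_fun n by (rule A.filtered_poly_fun)
  let ?u = "\<lambda>g p. if p \<in> W.Top then A.translate g p else p"
  have Top: "A.translate g p \<in> W.Top" if "p \<in> W.Top" "g \<in> carrier A" for g p
  proof -
    have "A.translate g p - p \<in> W.Top"
      using A.translate_lower[OF that] W.W_Suc[of n] by auto
    from W.W_add[OF this that(1)] show ?thesis by simp
  qed
  have u_hom: "?u \<in> hom A W.E"
  proof (rule homI)
    fix g assume g: "g \<in> carrier A"
    show "?u g \<in> carrier W.E"
      unfolding W.E_simps
    proof (rule W.opsI)
      show "?u g (p + q) = ?u g p + ?u g q" if "p \<in> W.Top" "q \<in> W.Top" for p q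
        using that W.W_add[OF that] by (auto simp: A.translate_def fun_eq_iff fun_apply)
      show "?u g p - p \<in> A.poly_fun (k - 1)" if "k \<le> Suc n" "p \<in> A.poly_fun k" for k p
        using A.translate_lower[OF that(2) g] W.W_Top[OF that] by simp
    qed simp
    fix h assume h: "h \<in> carrier A"
    have "A.translate (g \<otimes>\<^bsub>A\<^esub> h) p = A.translate g (A.translate h p)" for p
      using g h by (auto simp: A.translate_def A.m_assoc fun_eq_iff)
    then show "?u (g \<otimes>\<^bsub>A\<^esub> h) = ?u g \<otimes>\<^bsub>W.E\<^esub> ?u h"
      using Top h by (auto simp: fun_eq_iff)
  qed
  interpret L: series_lifting W.E QQ n "\<lambda>i. W.ops (max 1 i)" A B f ?u
    by (intro series_lifting.intro series_lifting_axioms.intro W.R_series_ops A.is_group B.is_group assms(4) u_hom)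
  have "?u a \<in> W.ops (max 1 (Suc n))" by (rule L.Rlcs_reflected[OF assms(5,6)])
  then have ua: "?u a \<in> W.ops (Suc n)" by simp
  obtain p where p: "A.upoly (carrier A) (Suc n) p" "p a \<noteq> p \<one>\<^bsub>A\<^esub>"
    using A.upoly_separates[OF assms(3,5) na] by blast
  define q where "q x = (if x \<in> carrier A then p x else 0)" for x
  have "A.upoly (carrier A) (Suc n) q"
    using A.upoly_cong[OF A.subgroup_self, of p q "Suc n"] p(1) by (simp add: q_def)
  then have q: "q \<in> W.Top" by (simp add: A.poly_fun_def q_def)
  have "?u a q - q \<in> A.poly_fun (Suc n - Suc n)" by (rule W.ops_lower[OF ua le_refl q])
  then have "A.translate a q - q = 0" using W.W_0 q by simp
  \<comment> \<open>At \<open>\<one>\<close> the translate takes the value \<open>q a\<close>, so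
    invariance compares exactly the two values that were separated.\<close>
  then have "A.translate a q \<one>\<^bsub>A\<^esub> - q \<one>\<^bsub>A\<^esub> = 0" by (metis fun_diff_def zero_fun_def)
  then show False using p(2) assms(5) by (simp add: A.translate_def q_def)
qed

theorem Rlcs_reflected:
  assumes A: "group A" and B: "group B" and n: "1 \<le> n" and f: "Dwyer R n A B f"
    and a: "a \<in> carrier A" and fa: "f a \<in> Rlcs R B (Suc n)"
  shows "a \<in> Rlcs R A (Suc n)"
proof (cases "R = QQ")
  case True
  then show ?thesis using Rlcs_QQ_reflected[OF A B n _ a] f fa by simp
next
  case False
  have "id \<in> hom A A" by (simp add: hom_def)
  then interpret L: series_lifting A R n "Rlcs R A" A B f id
    by (intro series_lifting.intro series_lifting_axioms.intro group.Rlcs_series[OF A False] A B f)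
  show ?thesis using L.Rlcs_reflected[OF a fa] by simp
qed

section \<open>The identity homomorphism belongs to the Dwyer class\<close>

lemma zero_cycle: "(\<lambda>xs. 0) \<in> cycles R k G"
  by (simp add: cycles_def chains_zero ideal_chains_zero bd_def)

lemma zero_boundary: "(\<lambda>xs. 0) \<in> boundaries R k G"
  unfolding boundaries_def
  by (auto simp: bd_def intro!: bexI[of _ "\<lambda>xs. 0"] chains_zero ideal_chains_zero)

lemma push_id: "push id c = c"
proof
  fix ys
  have "{xs. c xs \<noteq> 0 \<and> map id xs = ys} = (if c ys = 0 then {} else {ys})" by auto
  then show "push id c ys = c ys" by (simp add: push_def)
qed

lemma Dwyer_id: "Dwyer R n A A id"
proof -
  have "push g (\<lambda>xs. 0) = (\<lambda>ys. 0)" for g :: "'a \<Rightarrow> 'a set" by (simp add: push_def)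
  then have "(\<lambda>xs. 0) \<in> Phi_cycles R n A" by (simp add: Phi_cycles_def zero_cycle zero_boundary)
  then have Phi: "(\<lambda>xs. c xs - c xs) \<in> Phi_cycles R n A" for c by simp
  have bd: "(\<lambda>xs. c xs - c xs) \<in> boundaries R 1 A" for c by (simp add: zero_boundary)
  have "\<exists>x\<in>cycles R 2 A. (\<lambda>xs. x xs - y xs) \<in> Phi_cycles R n A" if "y \<in> cycles R 2 A" for y
    using Phi[of y] that by blast
  moreover have "\<exists>x\<in>cycles R 1 A. (\<lambda>xs. x xs - y xs) \<in> boundaries R 1 A" if "y \<in> cycles R 1 A" for y
    using bd[of y] that by blast
  ultimately show ?thesis
    unfolding Dwyer_def H_iso_def push_id by (simp add: hom_def)
qed

text \<open>The equality of sets appears as two inclusions because no quantifier ranges over types: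
  in the first the carrier type of \<open>B\<close> is arbitrary, in the second the witness lives on
  the type of \<open>A\<close>.\<close>

theorem theorem3p4:
  fixes R :: coeff and n :: nat and A :: "'a monoid"
  assumes "valid_coeff R" and "group A" and "n \<ge> 1"
  shows "(\<forall>(B :: 'b monoid) f a. group B \<and> Dwyer R n A B f \<and> a \<in> carrier A
            \<and> f a \<in> Rlcs R B (n + 1) \<longrightarrow> a \<in> Rlcs R A (n + 1))
       \<and> (\<forall>a \<in> Rlcs R A (n + 1). \<exists>(B :: 'a monoid) f. group B \<and> Dwyer R n A B f
            \<and> f a \<in> Rlcs R B (n + 1))"
proof (intro conjI allI ballI impI)
  fix B :: "'b monoid" and f a
  assume "group B \<and> Dwyer R n A B f \<and> a \<in> carrier A \<and> f a \<in> Rlcs R B (n + 1)"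
  then show "a \<in> Rlcs R A (n + 1)" using Rlcs_reflected[of A B n R f a] assms by simp
next
  fix a assume "a \<in> Rlcs R A (n + 1)"
  then show "\<exists>(B :: 'a monoid) f. group B \<and> Dwyer R n A B f \<and> f a \<in> Rlcs R B (n + 1)"
    using Dwyer_id[of R n A] assms(2) by (intro exI[of _ A] exI[of _ id]) simp
qed

end
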